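(* Let observations $X_1,\dots,X_T$ come from the model $X_t=f_t+\epsilon_t$, $t=1,\dots,T$, where $(f_t)$ is a fixed piecewise constant real signal with an unknown number $N$ of change points at unknown locations and $\epsilon_1,\dots,\epsilon_T$ are i.i.d. $\mathcal N(0,1)$. Fix a decay parameter $a\in[1/2,1)$, a minimal segment length $m\ge 2$, and an arbitrary single threshold $\kappa$. Consider seeded binary segmentation with decay $a$ and minimal segment length $m$, in which the final change points are chosen either by the greedy selection with threshold $\kappa$ or by the narrowest over threshold selection with threshold $\kappa$. Then, for either selection method, seeded binary segmentation has computational complexity $O(T\log T)$ and memory complexity $O(T)$ as a function of the number $T$ of observations. (These are worst-case bounds, with implied constants not depending on the data, on $\kappa$, or on $N$: there is an implementation which computes the output of the procedure within these time and memory bounds.)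
   Context: Complexity is counted in the usual unit-cost model (arithmetic operations, comparisons and memory accesses on real numbers and on integers of size polynomial in $T$ cost $O(1)$; one number takes one unit of memory). The parameters $a,m$ are fixed. Seeded intervals. For $a\in[1/2,1)$ and $1\le k\le \lceil \log_{1/a}(T)\rceil$ let $n_k=2\lceil (1/a)^{k-1}\rceil-1$, $l_k=Ta^{k-1}$, $s_k=(T-l_k)/(n_k-1)$ (for $k=1$, where $n_1=1$, put $s_1=0$), and $$\mathcal I_k=\bigcup_{i=1}^{n_k}\{(\lfloor (i-1)s_k\rfloor,\ \lceil (i-1)s_k+l_k\rceil]\}.$$ The collection of seeded intervals is $\mathcal I=\bigcup_{k=1}^{\lceil\log_{1/a}(T)\rceil}\mathcal I_k$. With minimal segment length $m$, only those intervals $(\ell,r]\in\mathcal I$ with $r-\ell\ge m$ are kept; the resulting collection is again denoted $\mathcal I$. CUSUM statistics. For integers $0\le \ell<r\le T$, $n=r-\ell$ and $s\in\{\ell+1,\dots,r-1\}$, $$T_{(\ell,r]}(s)=\sqrt{\frac{r-s}{n(s-\ell)}}\sum_{t=\ell+1}^{s}X_t-\sqrt{\frac{s-\ell}{n(r-s)}}\sum_{t=s+1}^{r}X_t .$$ The best split of $(\ell,r]$ is $\hat s_{(\ell,r]}\in\arg\max_{s\in\{\ell+1,\dots,r-1\}}|T_{(\ell,r]}(s)|$, and $|T_{(\ell,r]}(\hat s_{(\ell,r]})|$ is the maximal gain of $(\ell,r]$ (ties are broken by any fixed rule). Seeded binary segmentation: create $\mathcal I$, compute $T_{(\ell,r]}(s)$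 for all $(\ell,r]\in\mathcal I$ and all $s\in\{\ell+1,\dots,r-1\}$ (and hence the best split and maximal gain of each interval), then apply a selection method, which outputs the estimated change points. Greedy selection with threshold $\kappa$: among the remaining intervals of $\mathcal I$ take one with the largest maximal gain; if this maximal gain exceeds $\kappa$, declare its best split a change point, delete from $\mathcal I$ all intervals that contain this change point, and repeat; stop when no remaining interval has maximal gain above $\kappa$. Narrowest over threshold selection with threshold $\kappa$: among the remaining intervals of $\mathcal I$ whose maximal gain exceeds $\kappa$ take a shortest one (smallest $r-\ell$); declare its best split a change point, delete from $\mathcal I$ all intervals that contain this change point, and repeat; stop when no remaining interval has maximal gain above $\kappa$. *)

theory Defs
  imports "HOL-Probability.Probability" "HOL-Library.Landau_Symbols"
begin

section \<open>The change point model\<close>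

text \<open>
  \<open>\<tau> 1 < \<dots> < \<tau> N\<close> are the change points, \<open>\<tau> 0 = 0\<close> and \<open>\<tau> (N + 1) = T\<close> are sentinels.  Indices of
  \<^term>\<open>f\<close> and \<^term>\<open>\<epsilon>\<close> outside \<open>{1..T}\<close> are irrelevant.
\<close>

definition piecewise_constant :: "nat \<Rightarrow> nat \<Rightarrow> (nat \<Rightarrow> nat) \<Rightarrow> (nat \<Rightarrow> real) \<Rightarrow> bool" where
  "piecewise_constant T N \<tau> f \<longleftrightarrow>
     \<tau> 0 = 0 \<and> \<tau> (N + 1) = T \<and> (\<forall>i\<le>N. \<tau> i < \<tau> (i + 1)) \<and>
     (\<forall>i\<le>N. \<forall>t\<in>{\<tau> i<..\<tau> (i + 1)}. f t = f (\<tau> (i + 1))) \<and>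
     (\<forall>i\<in>{1..N}. f (\<tau> i) \<noteq> f (\<tau> i + 1))"

locale gaussian_change_point_model = prob_space M
  for M :: "'w measure" +
  fixes T N :: nat and \<tau> :: "nat \<Rightarrow> nat" and f :: "nat \<Rightarrow> real" and \<epsilon> :: "nat \<Rightarrow> 'w \<Rightarrow> real"
  assumes signal: "piecewise_constant T N \<tau> f"
    and noise_indep: "indep_vars (\<lambda>_. borel) \<epsilon> {1..T}"
    and noise_normal: "t \<in> {1..T} \<Longrightarrow> distributed M lborel (\<epsilon> t) std_normal_density"

section \<open>Seeded intervals\<close>

text \<open>A pair \<open>(l, r)\<close> stands for the integer interval \<open>(l, r]\<close>.\<close>

type_synonym interval = "nat \<times> nat"

definition layers :: "real \<Rightarrow> nat \<Rightarrow> nat" where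
  "layers a T = nat \<lceil>log (1 / a) (real T)\<rceil>"

definition layer_count :: "real \<Rightarrow> nat \<Rightarrow> nat" where
  "layer_count a k = nat (2 * \<lceil>(1 / a) ^ (k - 1)\<rceil> - 1)"

definition layer_length :: "real \<Rightarrow> nat \<Rightarrow> nat \<Rightarrow> real" where
  "layer_length a T k = real T * a ^ (k - 1)"

definition layer_shift :: "real \<Rightarrow> nat \<Rightarrow> nat \<Rightarrow> real" where
  "layer_shift a T k =
     (if k = 1 then 0 else (real T - layer_length a T k) / (real (layer_count a k) - 1))"

definition seeded_layer :: "real \<Rightarrow> nat \<Rightarrow> nat \<Rightarrow> interval set" where
  "seeded_layer a T k =
     (\<Union>i\<in>{1..layer_count a k}.
        {(nat \<lfloor>(real i - 1) * layer_shift a T k\<rfloor>,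
          nat \<lceil>(real i - 1) * layer_shift a T k + layer_length a T k\<rceil>)})"

definition seeded_intervals :: "real \<Rightarrow> nat \<Rightarrow> nat \<Rightarrow> interval set" where
  "seeded_intervals a m T = {(l, r) \<in> (\<Union>k\<in>{1..layers a T}. seeded_layer a T k). l + m \<le> r}"

section \<open>CUSUM statistics\<close>

definition cusum :: "(nat \<Rightarrow> real) \<Rightarrow> nat \<Rightarrow> nat \<Rightarrow> nat \<Rightarrow> real" where
  "cusum x l r s =
     (let n = real r - real l in
      sqrt ((real r - real s) / (n * (real s - real l))) * (\<Sum>t\<in>{l + 1..s}. x t)
      - sqrt ((real s - real l) / (n * (real r - real s))) * (\<Sum>t\<in>{s + 1..r}. x t))"

definition best_splits :: "(nat \<Rightarrow> real) \<Rightarrow> interval \<Rightarrow> nat set" where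
  "best_splits x = (\<lambda>(l, r). {s. is_arg_max (\<lambda>s. \<bar>cusum x l r s\<bar>) (\<lambda>s. s \<in> {l + 1..r - 1}) s})"

text \<open>A fixed rule for breaking ties picks one element from every nonempty set of maximisers.\<close>

definition tie_rule :: "(nat set \<Rightarrow> nat) \<Rightarrow> bool" where
  "tie_rule \<rho> \<longleftrightarrow> (\<forall>S. finite S \<and> S \<noteq> {} \<longrightarrow> \<rho> S \<in> S)"

definition best_split :: "(nat set \<Rightarrow> nat) \<Rightarrow> (nat \<Rightarrow> real) \<Rightarrow> interval \<Rightarrow> nat" where
  "best_split \<rho> x I = \<rho> (best_splits x I)"

definition max_gain :: "(nat set \<Rightarrow> nat) \<Rightarrow> (nat \<Rightarrow> real) \<Rightarrow> interval \<Rightarrow> real" where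
  "max_gain \<rho> x I = \<bar>cusum x (fst I) (snd I) (best_split \<rho> x I)\<bar>"

section \<open>Selection methods\<close>

definition delete_containing :: "nat \<Rightarrow> interval set \<Rightarrow> interval set" where
  "delete_containing s \<I> = {(l, r) \<in> \<I>. s \<notin> {l<..r}}"

datatype selection = Greedy | Narrowest_Over_Threshold

definition selectable ::
  "selection \<Rightarrow> real \<Rightarrow> (interval \<Rightarrow> real) \<Rightarrow> interval set \<Rightarrow> interval \<Rightarrow> bool" where
  "selectable sel \<kappa> gain \<I> I = (case sel of
     Greedy \<Rightarrow> is_arg_max gain (\<lambda>J. J \<in> \<I>) I \<and> gain I > \<kappa>
   | Narrowest_Over_Threshold \<Rightarrow>
       is_arg_min (\<lambda>(l, r). r - l) (\<lambda>J. J \<in> \<I> \<and> gain J > \<kappa>) I)"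

text \<open>
  A relation and not a function, because which of several equally good intervals is taken next is
  left open.  The list holds the change points in the order of their declaration.
\<close>

inductive selects ::
  "selection \<Rightarrow> real \<Rightarrow> (interval \<Rightarrow> real) \<Rightarrow> (interval \<Rightarrow> nat) \<Rightarrow> interval set \<Rightarrow> nat list \<Rightarrow> bool"
  for sel :: selection and \<kappa> :: real and gain :: "interval \<Rightarrow> real" and split :: "interval \<Rightarrow> nat"
where
  stop: "\<forall>I\<in>\<I>. \<not> gain I > \<kappa> \<Longrightarrow> selects sel \<kappa> gain split \<I> []"
| declare_split: "selectable sel \<kappa> gain \<I> I \<Longrightarrow>
    selects sel \<kappa> gain split (delete_containing (split I) \<I>) cps \<Longrightarrow>
    selects sel \<kappa> gain split \<I> (split I # cps)"

definition seeded_binary_segmentation ::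
  "(nat set \<Rightarrow> nat) \<Rightarrow> real \<Rightarrow> nat \<Rightarrow> selection \<Rightarrow> real \<Rightarrow> nat \<Rightarrow> (nat \<Rightarrow> real) \<Rightarrow> nat list \<Rightarrow> bool" where
  "seeded_binary_segmentation \<rho> a m sel \<kappa> T x cps \<longleftrightarrow>
     selects sel \<kappa> (max_gain \<rho> x) (best_split \<rho> x) (seeded_intervals a m T) cps"

section \<open>The unit-cost model\<close>

text \<open>
  An imperative language over integer and real scalars and over zero-indexed integer and real
  arrays.  The only real operations are the four arithmetic ones, the embedding of the integers
  and comparison; in particular there is no rounding of reals, and no real constant other than an
  integer.  Every operation and memory access costs one unit.
\<close>

type_synonym vname = string

datatype iexp =
    IConst int | IVar vname | IArr vname iexp
  | IAdd iexp iexp | ISub iexp iexp | IMul iexp iexp | IDiv iexp iexp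

datatype rexp =
    RInt iexp | RVar vname | RArr vname iexp
  | RAdd rexp rexp | RSub rexp rexp | RMul rexp rexp | RDiv rexp rexp

datatype bexp = ILess iexp iexp | RLess rexp rexp | Not bexp | And bexp bexp

datatype com =
    Skip
  | ISet vname iexp | RSet vname rexp
  | IStore vname iexp iexp | RStore vname iexp rexp
  | INew vname iexp | RNew vname iexp
  | Seq com com | If bexp com com | While bexp com

record state =
  ivars :: "vname \<Rightarrow> int"
  rvars :: "vname \<Rightarrow> real"
  iarrs :: "vname \<Rightarrow> int list"
  rarrs :: "vname \<Rightarrow> real list"

primrec ival :: "state \<Rightarrow> iexp \<Rightarrow> int" where
  "ival \<sigma> (IConst c) = c"
| "ival \<sigma> (IVar v) = ivars \<sigma> v"
| "ival \<sigma> (IArr A e) = iarrs \<sigma> A ! nat (ival \<sigma> e)"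
| "ival \<sigma> (IAdd e e') = ival \<sigma> e + ival \<sigma> e'"
| "ival \<sigma> (ISub e e') = ival \<sigma> e - ival \<sigma> e'"
| "ival \<sigma> (IMul e e') = ival \<sigma> e * ival \<sigma> e'"
| "ival \<sigma> (IDiv e e') = ival \<sigma> e div ival \<sigma> e'"

primrec rval :: "state \<Rightarrow> rexp \<Rightarrow> real" where
  "rval \<sigma> (RInt e) = of_int (ival \<sigma> e)"
| "rval \<sigma> (RVar v) = rvars \<sigma> v"
| "rval \<sigma> (RArr A e) = rarrs \<sigma> A ! nat (ival \<sigma> e)"
| "rval \<sigma> (RAdd e e') = rval \<sigma> e + rval \<sigma> e'"
| "rval \<sigma> (RSub e e') = rval \<sigma> e - rval \<sigma> e'"
| "rval \<sigma> (RMul e e') = rval \<sigma> e * rval \<sigma> e'"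
| "rval \<sigma> (RDiv e e') = rval \<sigma> e / rval \<sigma> e'"

primrec bval :: "state \<Rightarrow> bexp \<Rightarrow> bool" where
  "bval \<sigma> (ILess e e') = (ival \<sigma> e < ival \<sigma> e')"
| "bval \<sigma> (RLess e e') = (rval \<sigma> e < rval \<sigma> e')"
| "bval \<sigma> (Not b) = (\<not> bval \<sigma> b)"
| "bval \<sigma> (And b b') = (bval \<sigma> b \<and> bval \<sigma> b')"

primrec icost :: "iexp \<Rightarrow> nat" where
  "icost (IConst c) = 1"
| "icost (IVar v) = 1"
| "icost (IArr A e) = 1 + icost e"
| "icost (IAdd e e') = 1 + icost e + icost e'"
| "icost (ISub e e') = 1 + icost e + icost e'"
| "icost (IMul e e') = 1 + icost e + icost e'"
| "icost (IDiv e e') = 1 + icost e + icost e'"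

primrec rcost :: "rexp \<Rightarrow> nat" where
  "rcost (RInt e) = 1 + icost e"
| "rcost (RVar v) = 1"
| "rcost (RArr A e) = 1 + icost e"
| "rcost (RAdd e e') = 1 + rcost e + rcost e'"
| "rcost (RSub e e') = 1 + rcost e + rcost e'"
| "rcost (RMul e e') = 1 + rcost e + rcost e'"
| "rcost (RDiv e e') = 1 + rcost e + rcost e'"

primrec bcost :: "bexp \<Rightarrow> nat" where
  "bcost (ILess e e') = 1 + icost e + icost e'"
| "bcost (RLess e e') = 1 + rcost e + rcost e'"
| "bcost (Not b) = 1 + bcost b"
| "bcost (And b b') = 1 + bcost b + bcost b'"

definition in_range :: "int \<Rightarrow> 'a list \<Rightarrow> bool" where
  "in_range i xs \<longleftrightarrow> 0 \<le> i \<and> i < int (length xs)"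

text \<open>
  An expression is safe if its evaluation neither divides by zero nor leaves the bounds of an array
  and if no integer with absolute value above \<open>B\<close> occurs.  Commands with unsafe expressions get
  stuck.
\<close>

primrec isafe :: "nat \<Rightarrow> state \<Rightarrow> iexp \<Rightarrow> bool" where
  "isafe B \<sigma> (IConst c) \<longleftrightarrow> \<bar>c\<bar> \<le> int B"
| "isafe B \<sigma> (IVar v) \<longleftrightarrow> \<bar>ivars \<sigma> v\<bar> \<le> int B"
| "isafe B \<sigma> (IArr A e) \<longleftrightarrow>
     isafe B \<sigma> e \<and> in_range (ival \<sigma> e) (iarrs \<sigma> A) \<and> \<bar>ival \<sigma> (IArr A e)\<bar> \<le> int B"
| "isafe B \<sigma> (IAdd e e') \<longleftrightarrow> isafe B \<sigma> e \<and> isafe B \<sigma> e' \<and> \<bar>ival \<sigma> (IAdd e e')\<bar> \<le> int B"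
| "isafe B \<sigma> (ISub e e') \<longleftrightarrow> isafe B \<sigma> e \<and> isafe B \<sigma> e' \<and> \<bar>ival \<sigma> (ISub e e')\<bar> \<le> int B"
| "isafe B \<sigma> (IMul e e') \<longleftrightarrow> isafe B \<sigma> e \<and> isafe B \<sigma> e' \<and> \<bar>ival \<sigma> (IMul e e')\<bar> \<le> int B"
| "isafe B \<sigma> (IDiv e e') \<longleftrightarrow>
     isafe B \<sigma> e \<and> isafe B \<sigma> e' \<and> ival \<sigma> e' \<noteq> 0 \<and> \<bar>ival \<sigma> (IDiv e e')\<bar> \<le> int B"

primrec rsafe :: "nat \<Rightarrow> state \<Rightarrow> rexp \<Rightarrow> bool" where
  "rsafe B \<sigma> (RInt e) \<longleftrightarrow> isafe B \<sigma> e"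
| "rsafe B \<sigma> (RVar v) \<longleftrightarrow> True"
| "rsafe B \<sigma> (RArr A e) \<longleftrightarrow> isafe B \<sigma> e \<and> in_range (ival \<sigma> e) (rarrs \<sigma> A)"
| "rsafe B \<sigma> (RAdd e e') \<longleftrightarrow> rsafe B \<sigma> e \<and> rsafe B \<sigma> e'"
| "rsafe B \<sigma> (RSub e e') \<longleftrightarrow> rsafe B \<sigma> e \<and> rsafe B \<sigma> e'"
| "rsafe B \<sigma> (RMul e e') \<longleftrightarrow> rsafe B \<sigma> e \<and> rsafe B \<sigma> e'"
| "rsafe B \<sigma> (RDiv e e') \<longleftrightarrow> rsafe B \<sigma> e \<and> rsafe B \<sigma> e' \<and> rval \<sigma> e' \<noteq> 0"

primrec bsafe :: "nat \<Rightarrow> state \<Rightarrow> bexp \<Rightarrow> bool" where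
  "bsafe B \<sigma> (ILess e e') \<longleftrightarrow> isafe B \<sigma> e \<and> isafe B \<sigma> e'"
| "bsafe B \<sigma> (RLess e e') \<longleftrightarrow> rsafe B \<sigma> e \<and> rsafe B \<sigma> e'"
| "bsafe B \<sigma> (Not b) \<longleftrightarrow> bsafe B \<sigma> b"
| "bsafe B \<sigma> (And b b') \<longleftrightarrow> bsafe B \<sigma> b \<and> (bval \<sigma> b \<longrightarrow> bsafe B \<sigma> b')"

text \<open>
  Array cells in use.  Scalars are not counted: a program mentions only a fixed finite number of
  them.
\<close>

definition cells :: "state \<Rightarrow> nat" where
  "cells \<sigma> = (\<Sum>A | iarrs \<sigma> A \<noteq> []. length (iarrs \<sigma> A)) + (\<Sum>A | rarrs \<sigma> A \<noteq> []. length (rarrs \<sigma> A))"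

text \<open>
  \<open>exec B c \<sigma> t p \<sigma>'\<close>: from \<open>\<sigma>\<close>, command \<open>c\<close> terminates in \<open>\<sigma>'\<close> after \<open>t\<close> units of time, using
  at most \<open>p\<close> cells at any one moment, and all integers stay within the bound \<open>B\<close>.
\<close>

inductive exec :: "nat \<Rightarrow> com \<Rightarrow> state \<Rightarrow> nat \<Rightarrow> nat \<Rightarrow> state \<Rightarrow> bool" for B :: nat where
  Skip: "exec B Skip \<sigma> 1 (cells \<sigma>) \<sigma>"
| ISet: "isafe B \<sigma> e \<Longrightarrow>
    exec B (ISet v e) \<sigma> (1 + icost e) (cells \<sigma>) (\<sigma>\<lparr>ivars := (ivars \<sigma>)(v := ival \<sigma> e)\<rparr>)"
| RSet: "rsafe B \<sigma> e \<Longrightarrow>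
    exec B (RSet v e) \<sigma> (1 + rcost e) (cells \<sigma>) (\<sigma>\<lparr>rvars := (rvars \<sigma>)(v := rval \<sigma> e)\<rparr>)"
| IStore: "isafe B \<sigma> i \<Longrightarrow> isafe B \<sigma> e \<Longrightarrow> in_range (ival \<sigma> i) (iarrs \<sigma> A) \<Longrightarrow>
    exec B (IStore A i e) \<sigma> (1 + icost i + icost e) (cells \<sigma>)
      (\<sigma>\<lparr>iarrs := (iarrs \<sigma>)(A := (iarrs \<sigma> A)[nat (ival \<sigma> i) := ival \<sigma> e])\<rparr>)"
| RStore: "isafe B \<sigma> i \<Longrightarrow> rsafe B \<sigma> e \<Longrightarrow> in_range (ival \<sigma> i) (rarrs \<sigma> A) \<Longrightarrow>
    exec B (RStore A i e) \<sigma> (1 + icost i + rcost e) (cells \<sigma>)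
      (\<sigma>\<lparr>rarrs := (rarrs \<sigma>)(A := (rarrs \<sigma> A)[nat (ival \<sigma> i) := rval \<sigma> e])\<rparr>)"
| INew: "isafe B \<sigma> e \<Longrightarrow> 0 \<le> ival \<sigma> e \<Longrightarrow>
    \<sigma>' = \<sigma>\<lparr>iarrs := (iarrs \<sigma>)(A := replicate (nat (ival \<sigma> e)) 0)\<rparr> \<Longrightarrow>
    exec B (INew A e) \<sigma> (1 + icost e + nat (ival \<sigma> e)) (max (cells \<sigma>) (cells \<sigma>')) \<sigma>'"
| RNew: "isafe B \<sigma> e \<Longrightarrow> 0 \<le> ival \<sigma> e \<Longrightarrow>
    \<sigma>' = \<sigma>\<lparr>rarrs := (rarrs \<sigma>)(A := replicate (nat (ival \<sigma> e)) 0)\<rparr> \<Longrightarrow>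
    exec B (RNew A e) \<sigma> (1 + icost e + nat (ival \<sigma> e)) (max (cells \<sigma>) (cells \<sigma>')) \<sigma>'"
| Seq: "exec B c \<sigma> t p \<sigma>' \<Longrightarrow> exec B c' \<sigma>' t' p' \<sigma>'' \<Longrightarrow>
    exec B (Seq c c') \<sigma> (t + t') (max p p') \<sigma>''"
| IfTrue: "bsafe B \<sigma> b \<Longrightarrow> bval \<sigma> b \<Longrightarrow> exec B c \<sigma> t p \<sigma>' \<Longrightarrow>
    exec B (If b c c') \<sigma> (1 + bcost b + t) p \<sigma>'"
| IfFalse: "bsafe B \<sigma> b \<Longrightarrow> \<not> bval \<sigma> b \<Longrightarrow> exec B c' \<sigma> t p \<sigma>' \<Longrightarrow>
    exec B (If b c c') \<sigma> (1 + bcost b + t) p \<sigma>'"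
| WhileFalse: "bsafe B \<sigma> b \<Longrightarrow> \<not> bval \<sigma> b \<Longrightarrow>
    exec B (While b c) \<sigma> (1 + bcost b) (cells \<sigma>) \<sigma>"
| WhileTrue: "bsafe B \<sigma> b \<Longrightarrow> bval \<sigma> b \<Longrightarrow> exec B c \<sigma> t p \<sigma>' \<Longrightarrow>
    exec B (While b c) \<sigma>' t' p' \<sigma>'' \<Longrightarrow>
    exec B (While b c) \<sigma> (1 + bcost b + t + t') (max p p') \<sigma>''"

inductive_cases exec_SkipE: "exec B Skip \<sigma> t p \<sigma>'"
inductive_cases exec_ISetE: "exec B (ISet v e) \<sigma> t p \<sigma>'"
inductive_cases exec_RSetE: "exec B (RSet v e) \<sigma> t p \<sigma>'"
inductive_cases exec_IStoreE: "exec B (IStore A i e) \<sigma> t p \<sigma>'"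
inductive_cases exec_RStoreE: "exec B (RStore A i e) \<sigma> t p \<sigma>'"
inductive_cases exec_INewE: "exec B (INew A e) \<sigma> t p \<sigma>'"
inductive_cases exec_RNewE: "exec B (RNew A e) \<sigma> t p \<sigma>'"
inductive_cases exec_SeqE: "exec B (Seq c c') \<sigma> t p \<sigma>'"
inductive_cases exec_IfE: "exec B (If b c c') \<sigma> t p \<sigma>'"
inductive_cases exec_WhileE: "exec B (While b c) \<sigma> t p \<sigma>'"

lemma exec_deterministic:
  "exec B c \<sigma> t p \<sigma>' \<Longrightarrow> exec B c \<sigma> t' p' \<sigma>'' \<Longrightarrow> t' = t \<and> p' = p \<and> \<sigma>'' = \<sigma>'"
proof (induction arbitrary: t' p' \<sigma>'' rule: exec.induct)
  case Skip then show ?case by (elim exec_SkipE) simp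
next
  case ISet then show ?case by (elim exec_ISetE) simp
next
  case RSet then show ?case by (elim exec_RSetE) simp
next
  case IStore then show ?case by (elim exec_IStoreE) simp
next
  case RStore then show ?case by (elim exec_RStoreE) simp
next
  case INew from INew.prems INew.hyps show ?case by (elim exec_INewE) simp
next
  case RNew from RNew.prems RNew.hyps show ?case by (elim exec_RNewE) simp
next
  case (Seq c \<sigma> t p \<sigma>1 c' u q \<sigma>2)
  from Seq.prems obtain u1 q1 \<rho> u2 q2
    where body: "exec B c \<sigma> u1 q1 \<rho>" and rest: "exec B c' \<rho> u2 q2 \<sigma>''"
      and eqs: "t' = u1 + u2" "p' = max q1 q2"
    by (rule exec_SeqE)
  from Seq.IH(1)[OF body] have "u1 = t" "q1 = p" "\<rho> = \<sigma>1" by simp_all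
  with Seq.IH(2)[of u2 q2 \<sigma>''] rest eqs show ?case by simp
next
  case (IfTrue \<sigma> b c t p \<sigma>1 c')
  from IfTrue.prems IfTrue.hyps obtain u
    where "exec B c \<sigma> u p' \<sigma>''" and t': "t' = 1 + bcost b + u"
    by (elim exec_IfE) auto
  from IfTrue.IH[OF this(1)] t' show ?case by simp
next
  case (IfFalse \<sigma> b c' t p \<sigma>1 c)
  from IfFalse.prems IfFalse.hyps obtain u
    where "exec B c' \<sigma> u p' \<sigma>''" and t': "t' = 1 + bcost b + u"
    by (elim exec_IfE) auto
  from IfFalse.IH[OF this(1)] t' show ?case by simp
next
  case WhileFalse
  from WhileFalse.prems show ?case
    by (rule exec_WhileE) (use WhileFalse.hyps in simp_all)
next
  case (WhileTrue \<sigma> b c t p \<sigma>1 u q \<sigma>2)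
  from WhileTrue.prems obtain u1 q1 \<rho> u2 q2
    where body: "exec B c \<sigma> u1 q1 \<rho>" and rest: "exec B (While b c) \<rho> u2 q2 \<sigma>''"
      and eqs: "t' = 1 + bcost b + u1 + u2" "p' = max q1 q2"
    by (rule exec_WhileE) (use WhileTrue.hyps in auto)
  from WhileTrue.IH(1)[OF body] have "u1 = t" "q1 = p" "\<rho> = \<sigma>1" by simp_all
  with WhileTrue.IH(2)[of u2 q2 \<sigma>''] rest eqs show ?case by simp
qed

section \<open>Input and output\<close>

definition input_state :: "real \<Rightarrow> nat \<Rightarrow> real \<Rightarrow> nat \<Rightarrow> (nat \<Rightarrow> real) \<Rightarrow> state" where
  "input_state a m \<kappa> T x =
     \<lparr>ivars = (\<lambda>_. 0)(''T'' := int T, ''m'' := int m),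
      rvars = (\<lambda>_. 0)(''a'' := a, ''kappa'' := \<kappa>),
      iarrs = (\<lambda>_. []),
      rarrs = (\<lambda>_. [])(''X'' := map x [1..<Suc T])\<rparr>"

definition outputs :: "state \<Rightarrow> nat list \<Rightarrow> bool" where
  "outputs \<sigma> cps \<longleftrightarrow>
     ivars \<sigma> ''n'' = int (length cps) \<and> take (length cps) (iarrs \<sigma> ''out'') = map int cps"

end

theory Submission
  imports Defs "HOL-Library.Log_Nat" "HOL-Real_Asymp.Real_Asymp"
begin

text \<open>
  The layers grow geometrically, so there are \<open>O(T)\<close> seeded intervals, and those of one layer have
  total length \<open>O(T)\<close>, so all of them together have total length \<open>O(T log T)\<close>.  With partial sums, the
  best split of an interval is found in time linear in its length.  Both selection methods take the
  intervals over the threshold in the order of a fixed key: the negated squared gain, or the length.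
  A tournament tree delivers this order at logarithmic cost per interval.  Whether the next interval
  has been deleted is decided by searching it for declared change points, again in time linear in its
  length.  No pass over the intervals is made after a declaration, so the number of change points
  does not matter.
\<close>

section \<open>Symbolic execution with time and frame\<close>

text \<open>Deletion is lazy. Declaring a change point alters neither the gain nor the length of
  another interval, so the keys stay valid, and a deleted interval may remain in the tree until it
  surfaces at the root. Each candidate surfaces once, and its search is charged to it and not to a
  change point. The machine shapes the rest: it has no square root, no logarithm and no rounding.
  Gains are compared through their squares, rounded values are reached by counting upward, and the
  end of the layers is recognised by a length, since \<open>k < layers a T\<close> amounts to
  \<open>T * a ^ k > 1\<close>. The integer \<open>\<lceil>3 / (1 - a)\<rceil>\<close> is written
  into the program text. It comes from the geometric series of the layer counts and gives each array
  room for all intervals. All arrays are allocated at the start, in time O(T). What follows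
  allocates nothing, so the memory bound needs no bookkeeping of its own.\<close>

primrec imods :: "com \<Rightarrow> vname set" where
  "imods Skip = {}"
| "imods (ISet v e) = {v}"
| "imods (RSet v e) = {}"
| "imods (IStore A i e) = {}"
| "imods (RStore A i e) = {}"
| "imods (INew A e) = {}"
| "imods (RNew A e) = {}"
| "imods (Seq c c') = imods c \<union> imods c'"
| "imods (If b c c') = imods c \<union> imods c'"
| "imods (While b c) = imods c"

primrec rmods :: "com \<Rightarrow> vname set" where
  "rmods Skip = {}"
| "rmods (ISet v e) = {}"
| "rmods (RSet v e) = {v}"
| "rmods (IStore A i e) = {}"
| "rmods (RStore A i e) = {}"
| "rmods (INew A e) = {}"
| "rmods (RNew A e) = {}"
| "rmods (Seq c c') = rmods c \<union> rmods c'"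
| "rmods (If b c c') = rmods c \<union> rmods c'"
| "rmods (While b c) = rmods c"

primrec iamods :: "com \<Rightarrow> vname set" where
  "iamods Skip = {}"
| "iamods (ISet v e) = {}"
| "iamods (RSet v e) = {}"
| "iamods (IStore A i e) = {A}"
| "iamods (RStore A i e) = {}"
| "iamods (INew A e) = {A}"
| "iamods (RNew A e) = {}"
| "iamods (Seq c c') = iamods c \<union> iamods c'"
| "iamods (If b c c') = iamods c \<union> iamods c'"
| "iamods (While b c) = iamods c"

primrec ramods :: "com \<Rightarrow> vname set" where
  "ramods Skip = {}"
| "ramods (ISet v e) = {}"
| "ramods (RSet v e) = {}"
| "ramods (IStore A i e) = {}"
| "ramods (RStore A i e) = {A}"
| "ramods (INew A e) = {}"
| "ramods (RNew A e) = {A}"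
| "ramods (Seq c c') = ramods c \<union> ramods c'"
| "ramods (If b c c') = ramods c \<union> ramods c'"
| "ramods (While b c) = ramods c"

primrec noalloc :: "com \<Rightarrow> bool" where
  "noalloc Skip \<longleftrightarrow> True"
| "noalloc (ISet v e) \<longleftrightarrow> True"
| "noalloc (RSet v e) \<longleftrightarrow> True"
| "noalloc (IStore A i e) \<longleftrightarrow> True"
| "noalloc (RStore A i e) \<longleftrightarrow> True"
| "noalloc (INew A e) \<longleftrightarrow> False"
| "noalloc (RNew A e) \<longleftrightarrow> False"
| "noalloc (Seq c c') \<longleftrightarrow> noalloc c \<and> noalloc c'"
| "noalloc (If b c c') \<longleftrightarrow> noalloc c \<and> noalloc c'"
| "noalloc (While b c) \<longleftrightarrow> noalloc c"

definition same_lengths :: "state \<Rightarrow> state \<Rightarrow> bool" where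
  "same_lengths \<sigma> \<sigma>' \<longleftrightarrow>
     (\<forall>A. length (iarrs \<sigma>' A) = length (iarrs \<sigma> A)) \<and>
     (\<forall>A. length (rarrs \<sigma>' A) = length (rarrs \<sigma> A))"

text \<open>A syntactic overapproximation of the effect of a command. Loop invariants then mention
  only what the body changes; the rest is recovered from the frame.\<close>

definition frame :: "com \<Rightarrow> state \<Rightarrow> state \<Rightarrow> bool" where
  "frame c \<sigma> \<sigma>' \<longleftrightarrow>
     (\<forall>v. v \<notin> imods c \<longrightarrow> ivars \<sigma>' v = ivars \<sigma> v) \<and>
     (\<forall>v. v \<notin> rmods c \<longrightarrow> rvars \<sigma>' v = rvars \<sigma> v) \<and>
     (\<forall>A. A \<notin> iamods c \<longrightarrow> iarrs \<sigma>' A = iarrs \<sigma> A) \<and>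
     (\<forall>A. A \<notin> ramods c \<longrightarrow> rarrs \<sigma>' A = rarrs \<sigma> A) \<and>
     (noalloc c \<longrightarrow> same_lengths \<sigma> \<sigma>')"

lemma frame_refl: "frame c \<sigma> \<sigma>"
  by (simp add: frame_def same_lengths_def)

lemma frame_trans: "frame c \<sigma> \<sigma>' \<Longrightarrow> frame c \<sigma>' \<sigma>'' \<Longrightarrow> frame c \<sigma> \<sigma>''"
  by (simp add: frame_def same_lengths_def)

lemma frameD:
  assumes "frame c \<sigma> \<sigma>'"
  shows "v \<notin> imods c \<Longrightarrow> ivars \<sigma>' v = ivars \<sigma> v"
    and "v \<notin> rmods c \<Longrightarrow> rvars \<sigma>' v = rvars \<sigma> v"
    and "A \<notin> iamods c \<Longrightarrow> iarrs \<sigma>' A = iarrs \<sigma> A"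
    and "A \<notin> ramods c \<Longrightarrow> rarrs \<sigma>' A = rarrs \<sigma> A"
    and "noalloc c \<Longrightarrow> length (iarrs \<sigma>' A) = length (iarrs \<sigma> A)"
    and "noalloc c \<Longrightarrow> length (rarrs \<sigma>' A) = length (rarrs \<sigma> A)"
  using assms by (simp_all add: frame_def same_lengths_def)

lemma frame_mono:
  assumes "frame c \<sigma> \<sigma>'" and "imods c \<subseteq> imods c'" "rmods c \<subseteq> rmods c'"
    "iamods c \<subseteq> iamods c'" "ramods c \<subseteq> ramods c'" "noalloc c' \<Longrightarrow> noalloc c"
  shows "frame c' \<sigma> \<sigma>'"
  using assms unfolding frame_def by blast

lemma exec_frame: "exec B c \<sigma> t p \<sigma>' \<Longrightarrow> frame c \<sigma> \<sigma>'"
proof (induction rule: exec.induct)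
  case (Seq c \<sigma> t p \<sigma>' c' t' p' \<sigma>'')
  then show ?case
    by (auto intro!: frame_trans[of _ \<sigma> \<sigma>' \<sigma>''] intro: frame_mono)
next
  case (WhileTrue \<sigma> b c t p \<sigma>' t' p' \<sigma>'')
  then show ?case
    by (auto intro!: frame_trans[of _ \<sigma> \<sigma>' \<sigma>''] intro: frame_mono)
qed (auto simp: frame_def same_lengths_def)

section \<open>Memory accounting\<close>

lemma cells_same_lengths:
  assumes "same_lengths \<sigma> \<sigma>'"
  shows "cells \<sigma>' = cells \<sigma>"
proof -
  have "iarrs \<sigma>' A \<noteq> [] \<longleftrightarrow> iarrs \<sigma> A \<noteq> []" "rarrs \<sigma>' A \<noteq> [] \<longleftrightarrow> rarrs \<sigma> A \<noteq> []" for A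
    using assms unfolding same_lengths_def by (metis length_0_conv)+
  with assms show ?thesis
    unfolding cells_def same_lengths_def by simp
qed

text \<open>Stores keep the lengths of arrays, so without allocation the number of cells is constant
  along the run.\<close>

lemma exec_noalloc_memory:
  "exec B c \<sigma> t p \<sigma>' \<Longrightarrow> noalloc c \<Longrightarrow> p = cells \<sigma>"
proof (induction rule: exec.induct)
  case (Seq c \<sigma> t p \<sigma>' c' t' p' \<sigma>'')
  from exec_frame[OF Seq.hyps(1)] Seq.prems have "cells \<sigma>' = cells \<sigma>"
    by (intro cells_same_lengths) (simp add: frame_def)
  with Seq show ?case by simp
next
  case (WhileTrue \<sigma> b c t p \<sigma>' t' p' \<sigma>'')
  from exec_frame[OF WhileTrue.hyps(3)] WhileTrue.prems have "cells \<sigma>' = cells \<sigma>"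
    by (intro cells_same_lengths) (simp add: frame_def)
  with WhileTrue show ?case by simp
qed auto

text \<open>\<open>cells\<close> sums over all nonempty arrays, and a sum over an infinite set is 0
  by convention. Finiteness makes it a true count and gives monotonicity of the sums.\<close>

definition finite_arrays :: "state \<Rightarrow> bool" where
  "finite_arrays \<sigma> \<longleftrightarrow> finite {A. iarrs \<sigma> A \<noteq> []} \<and> finite {A. rarrs \<sigma> A \<noteq> []}"

text \<open>Only an inequality, because the overwritten array gives its old cells back.\<close>

lemma sum_length_update_le:
  assumes "finite {A. F A \<noteq> []}"
  shows "finite {A. (F(B := xs)) A \<noteq> []}"
    and "(\<Sum>A | (F(B := xs)) A \<noteq> []. length ((F(B := xs)) A)) \<le> (\<Sum>A | F A \<noteq> []. length (F A)) + length xs"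
proof -
  have sub: "{A. (F(B := xs)) A \<noteq> []} \<subseteq> insert B ({A. F A \<noteq> []} - {B})"
    by auto
  from sub assms show "finite {A. (F(B := xs)) A \<noteq> []}"
    by (meson finite_Diff finite_insert finite_subset)
  have "(\<Sum>A | (F(B := xs)) A \<noteq> []. length ((F(B := xs)) A))
      \<le> (\<Sum>A\<in>insert B ({A. F A \<noteq> []} - {B}). length ((F(B := xs)) A))"
    using sub assms by (intro sum_mono2) auto
  also have "\<dots> = length xs + (\<Sum>A\<in>{A. F A \<noteq> []} - {B}. length (F A))"
    using assms by (subst sum.insert) auto
  also have "(\<Sum>A\<in>{A. F A \<noteq> []} - {B}. length (F A)) \<le> (\<Sum>A | F A \<noteq> []. length (F A))"
    using assms by (intro sum_mono2) auto
  finally show "(\<Sum>A | (F(B := xs)) A \<noteq> []. length ((F(B := xs)) A))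
      \<le> (\<Sum>A | F A \<noteq> []. length (F A)) + length xs"
    by simp
qed

text \<open>An allocation of \<open>n\<close> cells costs at least \<open>n\<close> units of time, so space is bounded by time.\<close>

lemma exec_memory_le_time:
  "exec B c \<sigma> t p \<sigma>' \<Longrightarrow> finite_arrays \<sigma> \<Longrightarrow>
     finite_arrays \<sigma>' \<and> p \<le> cells \<sigma> + t \<and> cells \<sigma>' \<le> cells \<sigma> + t"
proof (induction rule: exec.induct)
  case (IStore \<sigma> i e A)
  let ?\<sigma>' = "\<sigma>\<lparr>iarrs := (iarrs \<sigma>)(A := (iarrs \<sigma> A)[nat (ival \<sigma> i) := ival \<sigma> e])\<rparr>"
  have "cells ?\<sigma>' = cells \<sigma>"
    by (intro cells_same_lengths) (simp add: same_lengths_def)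
  moreover have "finite_arrays ?\<sigma>'"
    using IStore sum_length_update_le(1) unfolding finite_arrays_def by fastforce
  ultimately show ?case by simp
next
  case (RStore \<sigma> i e A)
  let ?\<sigma>' = "\<sigma>\<lparr>rarrs := (rarrs \<sigma>)(A := (rarrs \<sigma> A)[nat (ival \<sigma> i) := rval \<sigma> e])\<rparr>"
  have "cells ?\<sigma>' = cells \<sigma>"
    by (intro cells_same_lengths) (simp add: same_lengths_def)
  moreover have "finite_arrays ?\<sigma>'"
    using RStore sum_length_update_le(1) unfolding finite_arrays_def by fastforce
  ultimately show ?case by simp
next
  case (INew \<sigma> e \<sigma>' A)
  from INew sum_length_update_le[of "iarrs \<sigma>" A "replicate (nat (ival \<sigma> e)) 0"]
  have "finite_arrays \<sigma>'" "cells \<sigma>' \<le> cells \<sigma> + nat (ival \<sigma> e)"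
    unfolding finite_arrays_def cells_def by simp_all
  then show ?case by simp
next
  case (RNew \<sigma> e \<sigma>' A)
  from RNew sum_length_update_le[of "rarrs \<sigma>" A "replicate (nat (ival \<sigma> e)) 0"]
  have "finite_arrays \<sigma>'" "cells \<sigma>' \<le> cells \<sigma> + nat (ival \<sigma> e)"
    unfolding finite_arrays_def cells_def by simp_all
  then show ?case by simp
qed (auto simp: finite_arrays_def cells_def)

text \<open>\<open>t\<close> is the time already spent and \<open>Q\<close> receives the accumulated
  time, so that sequencing is plain nesting. One existing run is the only run, since
  \<open>exec\<close> is deterministic. Memory is left out: it is recovered from
  \<open>noalloc\<close> and from the running time.\<close>

definition wp :: "nat \<Rightarrow> com \<Rightarrow> (nat \<Rightarrow> state \<Rightarrow> bool) \<Rightarrow> nat \<Rightarrow> state \<Rightarrow> bool" where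
  "wp B c Q t \<sigma> \<longleftrightarrow> (\<exists>t' p \<sigma>'. exec B c \<sigma> t' p \<sigma>' \<and> Q (t + t') \<sigma>')"

lemma wp_Skip [simp]: "wp B Skip Q t \<sigma> \<longleftrightarrow> Q (t + 1) \<sigma>"
proof -
  have "exec B Skip \<sigma> t' p \<sigma>' \<longleftrightarrow> t' = 1 \<and> p = cells \<sigma> \<and> \<sigma>' = \<sigma>" for t' p \<sigma>'
    by (rule iffI, erule exec_SkipE, simp) (clarify, rule exec.Skip)
  then show ?thesis by (simp add: wp_def)
qed

lemma wp_ISet [simp]: "wp B (ISet v e) Q t \<sigma> \<longleftrightarrow>
    isafe B \<sigma> e \<and> Q (t + (1 + icost e))
      (\<sigma>\<lparr>ivars := (ivars \<sigma>)(v := ival \<sigma> e)\<rparr>)"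
proof -
  have "exec B (ISet v e) \<sigma> t' p \<sigma>' \<longleftrightarrow> isafe B \<sigma> e \<and> t' = 1 + icost e \<and>
      p = cells \<sigma> \<and> \<sigma>' = \<sigma>\<lparr>ivars := (ivars \<sigma>)(v := ival \<sigma> e)\<rparr>" for t' p \<sigma>'
    by (rule iffI, erule exec_ISetE, simp) (clarify, rule exec.ISet; (assumption | rule refl))
  then show ?thesis by (simp add: wp_def)
qed

lemma wp_RSet [simp]: "wp B (RSet v e) Q t \<sigma> \<longleftrightarrow>
    rsafe B \<sigma> e \<and> Q (t + (1 + rcost e))
      (\<sigma>\<lparr>rvars := (rvars \<sigma>)(v := rval \<sigma> e)\<rparr>)"
proof -
  have "exec B (RSet v e) \<sigma> t' p \<sigma>' \<longleftrightarrow> rsafe B \<sigma> e \<and> t' = 1 + rcost e \<and>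
      p = cells \<sigma> \<and> \<sigma>' = \<sigma>\<lparr>rvars := (rvars \<sigma>)(v := rval \<sigma> e)\<rparr>" for t' p \<sigma>'
    by (rule iffI, erule exec_RSetE, simp) (clarify, rule exec.RSet; (assumption | rule refl))
  then show ?thesis by (simp add: wp_def)
qed

lemma wp_IStore [simp]: "wp B (IStore A i e) Q t \<sigma> \<longleftrightarrow>
    isafe B \<sigma> i \<and> isafe B \<sigma> e \<and> in_range (ival \<sigma> i) (iarrs \<sigma> A) \<and>
    Q (t + (1 + icost i + icost e))
      (\<sigma>\<lparr>iarrs := (iarrs \<sigma>)(A := (iarrs \<sigma> A)[nat (ival \<sigma> i) := ival \<sigma> e])\<rparr>)"
proof -
  have "exec B (IStore A i e) \<sigma> t' p \<sigma>' \<longleftrightarrow> isafe B \<sigma> i \<and> isafe B \<sigma> e \<and>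
      in_range (ival \<sigma> i) (iarrs \<sigma> A) \<and> t' = 1 + icost i + icost e \<and>
      p = cells \<sigma> \<and> \<sigma>' = \<sigma>\<lparr>iarrs := (iarrs \<sigma>)(A := (iarrs \<sigma> A)[nat (ival \<sigma> i) := ival \<sigma> e])\<rparr>" for t' p \<sigma>'
    by (rule iffI, erule exec_IStoreE, simp) (clarify, rule exec.IStore; (assumption | rule refl))
  then show ?thesis by (simp add: wp_def)
qed

lemma wp_RStore [simp]: "wp B (RStore A i e) Q t \<sigma> \<longleftrightarrow>
    isafe B \<sigma> i \<and> rsafe B \<sigma> e \<and> in_range (ival \<sigma> i) (rarrs \<sigma> A) \<and>
    Q (t + (1 + icost i + rcost e))
      (\<sigma>\<lparr>rarrs := (rarrs \<sigma>)(A := (rarrs \<sigma> A)[nat (ival \<sigma> i) := rval \<sigma> e])\<rparr>)"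
proof -
  have "exec B (RStore A i e) \<sigma> t' p \<sigma>' \<longleftrightarrow> isafe B \<sigma> i \<and> rsafe B \<sigma> e \<and>
      in_range (ival \<sigma> i) (rarrs \<sigma> A) \<and> t' = 1 + icost i + rcost e \<and>
      p = cells \<sigma> \<and> \<sigma>' = \<sigma>\<lparr>rarrs := (rarrs \<sigma>)(A := (rarrs \<sigma> A)[nat (ival \<sigma> i) := rval \<sigma> e])\<rparr>" for t' p \<sigma>'
    by (rule iffI, erule exec_RStoreE, simp) (clarify, rule exec.RStore; (assumption | rule refl))
  then show ?thesis by (simp add: wp_def)
qed

lemma wp_INew [simp]: "wp B (INew A e) Q t \<sigma> \<longleftrightarrow>
    isafe B \<sigma> e \<and> 0 \<le> ival \<sigma> e \<and> Q (t + (1 + icost e + nat (ival \<sigma> e)))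
      (\<sigma>\<lparr>iarrs := (iarrs \<sigma>)(A := replicate (nat (ival \<sigma> e)) 0)\<rparr>)"
proof -
  have "exec B (INew A e) \<sigma> t' p \<sigma>' \<longleftrightarrow> isafe B \<sigma> e \<and> 0 \<le> ival \<sigma> e \<and> t' = 1 + icost e + nat (ival \<sigma> e) \<and>
      p = max (cells \<sigma>) (cells (\<sigma>\<lparr>iarrs := (iarrs \<sigma>)(A := replicate (nat (ival \<sigma> e)) 0)\<rparr>)) \<and> \<sigma>' = \<sigma>\<lparr>iarrs := (iarrs \<sigma>)(A := replicate (nat (ival \<sigma> e)) 0)\<rparr>" for t' p \<sigma>'
    by (rule iffI, erule exec_INewE, simp) (clarify, rule exec.INew; (assumption | rule refl))
  then show ?thesis by (simp add: wp_def)
qed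

lemma wp_RNew [simp]: "wp B (RNew A e) Q t \<sigma> \<longleftrightarrow>
    isafe B \<sigma> e \<and> 0 \<le> ival \<sigma> e \<and> Q (t + (1 + icost e + nat (ival \<sigma> e)))
      (\<sigma>\<lparr>rarrs := (rarrs \<sigma>)(A := replicate (nat (ival \<sigma> e)) 0)\<rparr>)"
proof -
  have "exec B (RNew A e) \<sigma> t' p \<sigma>' \<longleftrightarrow> isafe B \<sigma> e \<and> 0 \<le> ival \<sigma> e \<and> t' = 1 + icost e + nat (ival \<sigma> e) \<and>
      p = max (cells \<sigma>) (cells (\<sigma>\<lparr>rarrs := (rarrs \<sigma>)(A := replicate (nat (ival \<sigma> e)) 0)\<rparr>)) \<and> \<sigma>' = \<sigma>\<lparr>rarrs := (rarrs \<sigma>)(A := replicate (nat (ival \<sigma> e)) 0)\<rparr>" for t' p \<sigma>'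
    by (rule iffI, erule exec_RNewE, simp) (clarify, rule exec.RNew; (assumption | rule refl))
  then show ?thesis by (simp add: wp_def)
qed

lemma wp_Seq [simp]: "wp B (Seq c c') Q t \<sigma> \<longleftrightarrow> wp B c (wp B c' Q) t \<sigma>"
proof -
  have "exec B (Seq c c') \<sigma> t' p \<sigma>'' \<longleftrightarrow>
      (\<exists>t1 p1 \<sigma>' t2 p2. exec B c \<sigma> t1 p1 \<sigma>' \<and> exec B c' \<sigma>' t2 p2 \<sigma>'' \<and>
         t' = t1 + t2 \<and> p = max p1 p2)" for t' p \<sigma>''
    by (rule iffI, erule exec_SeqE, blast) (clarify, erule (1) exec.Seq)
  then show ?thesis
    unfolding wp_def by (fastforce simp: add.assoc)
qed

lemma wp_If [simp]: "wp B (If b c c') Q t \<sigma> \<longleftrightarrow>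
    bsafe B \<sigma> b \<and> (bval \<sigma> b \<longrightarrow> wp B c Q (t + (1 + bcost b)) \<sigma>) \<and>
    (\<not> bval \<sigma> b \<longrightarrow> wp B c' Q (t + (1 + bcost b)) \<sigma>)"
proof -
  have *: "exec B (If b c c') \<sigma> t' p \<sigma>' \<longleftrightarrow> bsafe B \<sigma> b \<and>
      (\<exists>u. exec B (if bval \<sigma> b then c else c') \<sigma> u p \<sigma>' \<and> t' = 1 + bcost b + u)" for t' p \<sigma>'
    by (rule iffI, erule exec_IfE, simp_all)
      (auto intro: exec.IfTrue[of _ _ _ c, unfolded One_nat_def plus_nat.add_Suc add_0]
         exec.IfFalse[of _ _ _ c', unfolded One_nat_def plus_nat.add_Suc add_0] split: if_splits)
  show ?thesis
    unfolding wp_def * by (cases "bval \<sigma> b"; simp only: simp_thms if_True if_False) (metis add.assoc)+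
qed

text \<open>A specification is proved once from time 0 and used after any elapsed time. The frame of
  the command is handed to the continuation for free.\<close>

lemma wp_conseq:
  assumes "wp B c Q 0 \<sigma>" and "\<And>t' \<sigma>'. Q t' \<sigma>' \<Longrightarrow> frame c \<sigma> \<sigma>' \<Longrightarrow> Q' (t + t') \<sigma>'"
  shows "wp B c Q' t \<sigma>"
  using assms exec_frame unfolding wp_def by (metis add_0)

text \<open>
  \<open>g\<close> is a ghost parameter of the invariant.  The potential \<open>\<Phi>\<close> pays for the time of each
  iteration and thereby enforces termination.
\<close>

lemma wp_While_frame:
  assumes "I g \<sigma>" and "frame c \<sigma>\<^sub>0 \<sigma>"
    and safe: "\<And>g \<sigma>. I g \<sigma> \<Longrightarrow> frame c \<sigma>\<^sub>0 \<sigma> \<Longrightarrow> bsafe B \<sigma> b"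
    and body: "\<And>g \<sigma>. I g \<sigma> \<Longrightarrow> frame c \<sigma>\<^sub>0 \<sigma> \<Longrightarrow> bval \<sigma> b \<Longrightarrow>
      wp B c (\<lambda>t \<sigma>'. \<exists>g'. I g' \<sigma>' \<and> 1 + bcost b + t + \<Phi> g' \<le> \<Phi> g) 0 \<sigma>"
  shows "wp B (While b c) (\<lambda>t \<sigma>'. \<exists>g'. I g' \<sigma>' \<and> frame c \<sigma>\<^sub>0 \<sigma>' \<and> \<not> bval \<sigma>' b \<and>
      t + \<Phi> g' \<le> \<Phi> g + 1 + bcost b) 0 \<sigma>"
  using assms(1,2)
proof (induction "\<Phi> g" arbitrary: g \<sigma> rule: less_induct)
  case less
  note S = safe[OF less.prems]
  show ?case
  proof (cases "bval \<sigma> b")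
    case False
    with S less.prems show ?thesis
      unfolding wp_def
      by (intro exI[of _ "1 + bcost b"] exI[of _ "cells \<sigma>"] exI[of _ \<sigma>] conjI exI[of _ g]
          exec.WhileFalse) simp_all
  next
    case True
    from body[OF less.prems True] obtain t p \<sigma>' g'
      where 1: "exec B c \<sigma> t p \<sigma>'" "I g' \<sigma>'" "1 + bcost b + t + \<Phi> g' \<le> \<Phi> g"
      unfolding wp_def by auto
    from less.prems(2) exec_frame[OF 1(1)] have "frame c \<sigma>\<^sub>0 \<sigma>'"
      by (rule frame_trans)
    from less.hyps[OF _ 1(2) this] 1(3) obtain u q \<sigma>'' g''
      where 2: "exec B (While b c) \<sigma>' u q \<sigma>''" "I g'' \<sigma>''" "frame c \<sigma>\<^sub>0 \<sigma>''" "\<not> bval \<sigma>'' b"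
        "u + \<Phi> g'' \<le> \<Phi> g' + 1 + bcost b"
      unfolding wp_def by auto
    from exec.WhileTrue[OF S True 1(1) 2(1)] 1(3) 2(2-5) show ?thesis
      unfolding wp_def
      by (intro exI[of _ "1 + bcost b + t + u"] exI[of _ "max p q"] exI[of _ \<sigma>''] conjI exI[of _ g'']) simp_all
  qed
qed

text \<open>The frame is taken relative to the state at loop entry, so facts about unmodified
  variables at entry hold in every round.\<close>

lemma wp_While:
  assumes "I g \<sigma>"
    and "\<And>g' \<sigma>'. I g' \<sigma>' \<Longrightarrow> frame c \<sigma> \<sigma>' \<Longrightarrow> bsafe B \<sigma>' b"
    and "\<And>g' \<sigma>'. I g' \<sigma>' \<Longrightarrow> frame c \<sigma> \<sigma>' \<Longrightarrow> bval \<sigma>' b \<Longrightarrow>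
      wp B c (\<lambda>t \<sigma>''. \<exists>g''. I g'' \<sigma>'' \<and> 1 + bcost b + t + \<Phi> g'' \<le> \<Phi> g') 0 \<sigma>'"
    and "\<And>g' \<sigma>' t'. I g' \<sigma>' \<Longrightarrow> frame c \<sigma> \<sigma>' \<Longrightarrow> \<not> bval \<sigma>' b \<Longrightarrow>
      t' + \<Phi> g' \<le> t + \<Phi> g + 1 + bcost b \<Longrightarrow> Q t' \<sigma>'"
  shows "wp B (While b c) Q t \<sigma>"
  by (rule wp_conseq[OF wp_While_frame[where I = I and g = g and c = c and \<sigma>\<^sub>0 = \<sigma> and \<Phi> = \<Phi>]])
    (use assms frame_refl in auto)

section \<open>Seeded intervals\<close>

text \<open>Indices start at 0 as in the program, so \<open>i\<close> plays the part of
  \<open>i - 1\<close> in \<open>seeded_layer\<close>. A list keeps repeated intervals apart and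
  records the order of generation.\<close>

definition layer_list :: "real \<Rightarrow> nat \<Rightarrow> nat \<Rightarrow> interval list" where
  "layer_list a T k = map (\<lambda>i. (nat \<lfloor>real i * layer_shift a T k\<rfloor>,
     nat \<lceil>real i * layer_shift a T k + layer_length a T k\<rceil>)) [0..<layer_count a k]"

definition interval_list :: "real \<Rightarrow> nat \<Rightarrow> nat \<Rightarrow> interval list" where
  "interval_list a T K = concat (map (layer_list a T) [1..<Suc K])"

lemma length_layer_list [simp]: "length (layer_list a T k) = layer_count a k"
  by (simp add: layer_list_def)

lemma set_layer_list: "set (layer_list a T k) = seeded_layer a T k"
proof -
  have "{1..layer_count a k} = Suc ` {0..<layer_count a k}"
    by (simp add: atLeastLessThanSuc_atLeastAtMost)
  then show ?thesis
    unfolding seeded_layer_def UNION_singleton_eq_range layer_list_def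
    by (simp only: image_image) simp
qed

lemma set_interval_list: "set (interval_list a T K) = (\<Union>k\<in>{1..K}. seeded_layer a T k)"
  by (simp add: interval_list_def set_layer_list atLeastLessThanSuc_atLeastAtMost del: upt_Suc)

lemma interval_list_Suc: "interval_list a T (Suc K) = interval_list a T K @ layer_list a T (Suc K)"
  by (simp add: interval_list_def)

lemma interval_list_0 [simp]: "interval_list a T 0 = []"
  by (simp add: interval_list_def)

definition total_length :: "interval list \<Rightarrow> nat" where
  "total_length Is = (\<Sum>(l, r)\<leftarrow>Is. r - l)"

lemma total_length_append [simp]:
  "total_length (Is @ Js) = total_length Is + total_length Js"
  by (simp add: total_length_def)

lemma total_length_filter_le: "total_length (filter P Is) \<le> total_length Is"
  by (induction Is) (auto simp: total_length_def)

locale seeded =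
  fixes a :: real and T :: nat
  assumes a_pos: "0 < a" and a_less: "a < 1" and T_pos: "1 \<le> T"
begin

lemma layer_length_pos: "0 < layer_length a T k"
  using a_pos T_pos by (simp add: layer_length_def)

lemma layer_length_le: "layer_length a T k \<le> T"
  using a_pos a_less T_pos by (simp add: layer_length_def power_le_one mult_left_le)

lemma layer_length_Suc: "1 \<le> k \<Longrightarrow> layer_length a T (Suc k) = layer_length a T k * a"
  by (cases k) (simp_all add: layer_length_def)

text \<open>Exponentiation removes both the ceiling and the logarithm. The right-hand side is the
  guard of the loop over the layers in \<open>generate\<close>.\<close>

lemma less_layers_iff: "k < layers a T \<longleftrightarrow> 1 < layer_length a T (Suc k)"
proof -
  have "k < layers a T \<longleftrightarrow> real k < log (1 / a) T"
    unfolding layers_def by (simp add: less_ceiling_iff zless_nat_eq_int_zless)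
  also have "\<dots> \<longleftrightarrow> (1 / a) powr real k < T"
    using a_pos a_less T_pos by (subst less_log_iff) auto
  also have "(1 / a) powr real k = (1 / a) ^ k"
    using a_pos by (simp add: powr_realpow)
  also have "(1 / a) ^ k < T \<longleftrightarrow> 1 < layer_length a T (Suc k)"
    using a_pos by (simp add: layer_length_def field_simps)
  finally show ?thesis .
qed

lemma layers_le: "real (layers a T) \<le> log (1 / a) T + 1"
proof -
  have "0 \<le> log (1 / a) T"
    using a_pos a_less T_pos by simp
  then show ?thesis
    unfolding layers_def by linarith
qed

lemma inverse_power_ge_1: "1 \<le> (1 / a) ^ k"
  using a_pos a_less by (simp add: power_le_one)

lemma layer_count_eq: "int (layer_count a k) = 2 * \<lceil>(1 / a) ^ (k - 1)\<rceil> - 1"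
proof -
  have "1 \<le> \<lceil>(1 / a) ^ (k - 1)\<rceil>"
    using inverse_power_ge_1[of "k - 1"] by linarith
  then show ?thesis by (simp add: layer_count_def)
qed

lemma layer_count_le: "real (layer_count a k) \<le> 2 * (1 / a) ^ (k - 1) + 1"
proof -
  have "real (layer_count a k) = of_int (2 * \<lceil>(1 / a) ^ (k - 1)\<rceil> - 1)"
    by (metis layer_count_eq of_int_of_nat_eq)
  then show ?thesis by linarith
qed

lemma one_less_ceiling_inverse_power:
  assumes "1 < k"
  shows "1 < \<lceil>(1 / a) ^ (k - 1)\<rceil>"
proof -
  have "1 < (1 / a) ^ (k - 1)"
    using a_pos a_less assms by (intro one_less_power) auto
  then show ?thesis by linarith
qed

lemma layer_shift_eq:
  assumes "1 \<le> k"
  shows "layer_shift a T k = (if k = 1 then 0 else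
      (real T - layer_length a T k) / of_int (2 * \<lceil>(1 / a) ^ (k - 1)\<rceil> - 2))"
proof -
  have "real (layer_count a k) = of_int (2 * \<lceil>(1 / a) ^ (k - 1)\<rceil> - 1)"
    by (metis layer_count_eq of_int_of_nat_eq)
  then show ?thesis by (simp add: layer_shift_def)
qed

lemma layer_shift_nonneg: "0 \<le> layer_shift a T k"
proof (cases "k = 1")
  case False
  have "1 \<le> layer_count a k"
    using layer_count_eq[of k] inverse_power_ge_1[of "k - 1"] by linarith
  with False layer_length_le[of k] show ?thesis
    by (simp add: layer_shift_def)
qed (simp add: layer_shift_def)

text \<open>The last index is the extreme case: \<open>layer_count a k - 1\<close> shifts carry the
  first interval of a layer to one that ends exactly at \<open>T\<close>.\<close>

lemma shift_le:
  assumes "i < layer_count a k" and "1 \<le> k"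
  shows "real i * layer_shift a T k + layer_length a T k \<le> T"
proof (cases "k = 1")
  case True
  then show ?thesis using layer_length_le by (simp add: layer_shift_def)
next
  case False
  with assms one_less_ceiling_inverse_power[of k] layer_count_eq[of k]
  have n: "1 < layer_count a k" by linarith
  have "real i * layer_shift a T k \<le> (real (layer_count a k) - 1) * layer_shift a T k"
    using assms layer_shift_nonneg by (intro mult_right_mono) auto
  also have "\<dots> = T - layer_length a T k"
    using n False by (simp add: layer_shift_def)
  finally show ?thesis by simp
qed

text \<open>Outward rounding adds less than one unit at each end, hence the 2. The right end stays
  within \<open>T\<close> because \<open>T\<close> is an integer above the unrounded value.\<close>

lemma interval_bounds:
  assumes "i < layer_count a k" and "1 \<le> k"
    and "l = nat \<lfloor>real i * layer_shift a T k\<rfloor>"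
    and "r = nat \<lceil>real i * layer_shift a T k + layer_length a T k\<rceil>"
  shows "l < r" "r \<le> T" "real r - real l \<le> layer_length a T k + 2"
proof -
  define x where "x = real i * layer_shift a T k"
  have x: "0 \<le> x" unfolding x_def using layer_shift_nonneg by simp
  have l: "real l \<le> x" "x < real l + 1"
    using x assms(3) unfolding x_def[symmetric] by linarith+
  have r: "real r < x + layer_length a T k + 1" "x + layer_length a T k \<le> real r"
    using x layer_length_pos[of k] assms(4) unfolding x_def[symmetric] by linarith+
  show "l < r" using l r layer_length_pos[of k] by linarith
  show "r \<le> T" using r shift_le[OF assms(1,2)] unfolding x_def[symmetric] by linarith
  show "real r - real l \<le> layer_length a T k + 2" using l r by linarith
qed

lemma layer_list_bounds:
  assumes "(l, r) \<in> set (layer_list a T k)" and "1 \<le> k"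
  shows "l < r" "r \<le> T" "real r - real l \<le> layer_length a T k + 2"
  using assms interval_bounds[of _ k l r] by (auto simp: layer_list_def)

lemma interval_list_bounds:
  assumes "(l, r) \<in> set (interval_list a T K)"
  shows "l < r" "r \<le> T"
  using assms layer_list_bounds[of l r] by (auto simp: interval_list_def)

text \<open>Each count is at most \<open>3 * (1 / a) ^ (k - 1)\<close>, since the power is at least
  1. The geometric sum is governed by its last term, and \<open>3 * (T / a) / (1 / a - 1)\<close> is
  \<open>3 / (1 - a) * T\<close>.\<close>

lemma sum_layer_count_le:
  assumes "K \<le> layers a T"
  shows "(\<Sum>k=1..K. real (layer_count a k)) \<le> 3 / (1 - a) * T"
proof (cases K)
  case 0
  then show ?thesis using a_less by simp
next
  case (Suc K')
  have b: "1 / a \<noteq> 1" using a_less a_pos by simp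
  have "(\<Sum>k=1..K. real (layer_count a k)) \<le> (\<Sum>k=1..K. 3 * (1 / a) ^ (k - 1))"
  proof (rule sum_mono)
    fix k
    show "real (layer_count a k) \<le> 3 * (1 / a) ^ (k - 1)"
      using layer_count_le[of k] inverse_power_ge_1[of "k - 1"] by linarith
  qed
  also have "\<dots> = 3 * (\<Sum>k<K. (1 / a) ^ k)"
    unfolding sum_distrib_left
    by (rule sum.reindex_bij_witness[where i = Suc and j = "\<lambda>k. k - 1"]) auto
  also have "\<dots> = 3 * (((1 / a) ^ K - 1) / (1 / a - 1))"
    by (simp only: geometric_sum[OF b])
  also have "\<dots> \<le> 3 * ((T / a) / (1 / a - 1))"
  proof -
    \<comment> \<open>Layer \<open>K\<close> belongs to the collection, so its unrounded length
      exceeds 1; this bounds the largest power in the sum by \<open>T\<close>.\<close>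
    have "1 < layer_length a T (Suc K')"
      using assms Suc less_layers_iff[of K'] by simp
    then have "(1 / a) ^ K' < T"
      using a_pos by (simp add: layer_length_def field_simps)
    then have "(1 / a) ^ K' * (1 / a) \<le> T * (1 / a)"
      using a_pos by (intro mult_right_mono) auto
    then have "(1 / a) ^ K - 1 \<le> T / a"
      using Suc by (simp add: mult.commute)
    then show ?thesis
      using a_pos a_less by (intro mult_left_mono divide_right_mono) auto
  qed
  also have "\<dots> = 3 / (1 - a) * T"
    using a_pos a_less by (simp add: field_simps)
  finally show ?thesis .
qed

lemma length_interval_list: "length (interval_list a T K) = (\<Sum>k=1..K. layer_count a k)"
  by (induction K) (simp_all add: interval_list_Suc)

text \<open>The factor is rounded up because the program may contain only integer constants.\<close>

lemma length_interval_list_le: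
  assumes "K \<le> layers a T"
  shows "length (interval_list a T K) \<le> nat \<lceil>3 / (1 - a)\<rceil> * T"
proof -
  have "real (length (interval_list a T K)) \<le> 3 / (1 - a) * T"
    using sum_layer_count_le[OF assms] by (simp add: length_interval_list)
  also have "\<dots> \<le> real (nat \<lceil>3 / (1 - a)\<rceil>) * T"
    by (intro mult_right_mono) (use a_less in linarith, simp)
  finally show ?thesis
    by (metis of_nat_le_iff of_nat_mult)
qed

text \<open>Count and length vary inversely: \<open>3 * (1 / a) ^ (k - 1)\<close> intervals of
  length \<open>T * a ^ (k - 1)\<close> make \<open>3 * T\<close> in every layer. Rounding adds 2
  per interval.\<close>

lemma total_length_layer_list:
  assumes "1 \<le> k"
  shows "total_length (layer_list a T k) \<le> 3 * T + 2 * layer_count a k"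
proof -
  have "real (total_length (layer_list a T k))
      = (\<Sum>(l, r)\<leftarrow>layer_list a T k. real (r - l))"
    unfolding total_length_def sum_list_of_nat[symmetric] by (simp add: comp_def case_prod_unfold)
  also have "\<dots> \<le> (\<Sum>I\<leftarrow>layer_list a T k. layer_length a T k + 2)"
  proof (rule sum_list_mono)
    fix I assume "I \<in> set (layer_list a T k)"
    with layer_list_bounds[OF _ assms] show
      "(case I of (l, r) \<Rightarrow> real (r - l)) \<le> layer_length a T k + 2"
      by (cases I) (fastforce simp: of_nat_diff less_imp_le)
  qed
  also have "\<dots> = real (layer_count a k) * layer_length a T k + 2 * real (layer_count a k)"
    by (simp add: sum_list_triv algebra_simps)
  also have "real (layer_count a k) * layer_length a T k
      \<le> (3 * (1 / a) ^ (k - 1)) * layer_length a T k"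
  proof (intro mult_right_mono)
    show "real (layer_count a k) \<le> 3 * (1 / a) ^ (k - 1)"
      using layer_count_le[of k] inverse_power_ge_1[of "k - 1"] by linarith
  qed (use layer_length_pos in \<open>simp add: less_imp_le\<close>)
  also have "\<dots> = 3 * T"
    using a_pos by (simp add: layer_length_def field_simps)
  finally show ?thesis by linarith
qed

lemma total_length_interval_list:
  "total_length (interval_list a T K) \<le> 3 * T * K + 2 * length (interval_list a T K)"
proof (induction K)
  case 0
  then show ?case by (simp add: total_length_def)
next
  case (Suc K)
  with total_length_layer_list[of "Suc K"] show ?case
    by (simp add: interval_list_Suc)
qed

end

section \<open>Squared gains\<close>

text \<open>
  The square of the CUSUM statistic is a rational function of the partial sums, so the program can
  compare gains without square roots.
\<close>

definition squared_gain :: "(nat \<Rightarrow> real) \<Rightarrow> nat \<Rightarrow> nat \<Rightarrow> nat \<Rightarrow> real" where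
  "squared_gain x l r s =
     (let d = (real r - real l) * (sum x {1..s} - sum x {1..l})
            - (real s - real l) * (sum x {1..r} - sum x {1..l})
      in d * d / ((real r - real l) * (real s - real l) * (real r - real s)))"

text \<open>With \<open>A\<close> and \<open>Z\<close> the sums left and right of the split,
  \<open>u\<close> and \<open>v\<close> the two lengths and \<open>n = u + v\<close>, both weights
  have the denominator \<open>sqrt (n * u * v)\<close>, and
  \<open>v * A - u * Z = n * A - u * (A + Z)\<close> needs only partial sums.\<close>

lemma abs_cusum:
  assumes "l < s" "s < r"
  shows "\<bar>cusum x l r s\<bar> = sqrt (squared_gain x l r s)"
proof -
  define n u v where "n = real r - real l" and "u = real s - real l" and "v = real r - real s"
  have pos: "0 < n" "0 < u" "0 < v" and n: "n = u + v"
    using assms by (auto simp: n_def u_def v_def)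
  define A where "A = sum x {l + 1..s}"
  define Z where "Z = sum x {s + 1..r}"
  have A: "sum x {1..s} - sum x {1..l} = A"
    using assms sum.ub_add_nat[of 1 l x "s - l"] by (simp add: A_def)
  have Z: "sum x {1..r} - sum x {1..s} = Z"
    using assms sum.ub_add_nat[of 1 s x "r - s"] by (simp add: Z_def)
  from A Z have AZ: "sum x {1..r} - sum x {1..l} = A + Z" by simp
  have 1: "sqrt (v / (n * u)) = v / sqrt (n * u * v)"
    and 2: "sqrt (u / (n * v)) = u / sqrt (n * u * v)"
    using pos by (simp_all add: real_sqrt_divide real_sqrt_mult field_simps)
  have "cusum x l r s = v / sqrt (n * u * v) * A - u / sqrt (n * u * v) * Z"
    unfolding cusum_def Let_def n_def[symmetric] u_def[symmetric] v_def[symmetric]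
      A_def[symmetric] Z_def[symmetric] 1 2 ..
  also have "\<dots> = (n * A - u * (A + Z)) / sqrt (n * u * v)"
    by (simp add: n algebra_simps add_divide_distrib diff_divide_distrib)
  finally have "\<bar>cusum x l r s\<bar> = \<bar>n * A - u * (A + Z)\<bar> / sqrt (n * u * v)"
    using pos by simp
  also have "\<dots> = sqrt ((n * A - u * (A + Z)) * (n * A - u * (A + Z)) / (n * u * v))"
    by (simp add: real_sqrt_divide)
  finally show ?thesis
    unfolding squared_gain_def Let_def A AZ n_def[symmetric] u_def[symmetric] v_def[symmetric] .
qed

lemma squared_gain_nonneg:
  assumes "l < s" "s < r"
  shows "0 \<le> squared_gain x l r s"
  using assms unfolding squared_gain_def Let_def
  by (intro divide_nonneg_nonneg zero_le_square mult_nonneg_nonneg) auto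

lemma tie_rule_Min: "tie_rule Min"
  by (simp add: tie_rule_def)

text \<open>Strict before \<open>h\<close> and weak from \<open>h\<close> on is what a left-to-right
  scan with strict comparison establishes. The tie rule realised by the program is therefore
  \<open>Min\<close>.\<close>

lemma first_maximum:
  assumes h: "l < h" "h < r"
    and before: "\<And>t. l < t \<Longrightarrow> t < h \<Longrightarrow> squared_gain x l r t < squared_gain x l r h"
    and after: "\<And>t. h \<le> t \<Longrightarrow> t < r \<Longrightarrow> squared_gain x l r t \<le> squared_gain x l r h"
  shows "best_split Min x (l, r) = h" and "max_gain Min x (l, r) = sqrt (squared_gain x l r h)"
proof -
  have "h \<in> best_splits x (l, r)"
  proof -
    have "\<not> \<bar>cusum x l r h\<bar> < \<bar>cusum x l r t\<bar>" if "l < t" "t < r" for t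
      using that h before[of t] after[of t] by (cases "t < h") (auto simp: abs_cusum)
    with h show ?thesis by (auto simp: best_splits_def is_arg_max_def)
  qed
  moreover have "h \<le> t" if t: "t \<in> best_splits x (l, r)" for t
  proof (rule ccontr)
    assume "\<not> h \<le> t"
    moreover from t have lt: "l < t" "t < r" "\<not> \<bar>cusum x l r t\<bar> < \<bar>cusum x l r h\<bar>"
      using h by (auto simp: best_splits_def is_arg_max_def)
    ultimately show False using before[of t] h by (simp add: abs_cusum)
  qed
  moreover have "finite (best_splits x (l, r))"
    by (rule finite_subset[of _ "{l + 1..r - 1}"]) (auto simp: best_splits_def is_arg_max_def)
  ultimately show *: "best_split Min x (l, r) = h"
    unfolding best_split_def by (intro Min_eqI) auto
  show "max_gain Min x (l, r) = sqrt (squared_gain x l r h)"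
    using h by (simp add: max_gain_def * abs_cusum)
qed

text \<open>Squaring is not monotone on negative numbers, so a negative threshold, which every gain
  exceeds, is a case of its own.\<close>

lemma less_sqrt_iff: "\<kappa> < sqrt y \<longleftrightarrow> \<kappa> < 0 \<or> \<kappa> * \<kappa> < y" if "0 \<le> y" for \<kappa> y :: real
proof (cases "\<kappa> < 0")
  case True
  with that show ?thesis by (smt (verit) real_sqrt_ge_zero)
next
  case False
  then have "\<kappa> < sqrt y \<longleftrightarrow> sqrt (\<kappa> * \<kappa>) < sqrt y"
    by (simp only: real_sqrt_mult_self real_sqrt_mult abs_of_nonneg not_less)
  with False show ?thesis by (simp only: real_sqrt_less_iff simp_thms)
qed

section \<open>A tournament tree\<close>

notation Seq (infixr \<open>;;\<close> 60)

text \<open>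
  Node \<open>v\<close> has children \<open>2 v\<close> and \<open>2 v + 1\<close>, the root is node \<open>1\<close>, and leaf \<open>K + j\<close> holds \<open>j + 1\<close> if
  index \<open>j\<close> takes part and \<open>0\<close> otherwise.  \<open>e\<close> is the only node that may violate the invariant.
\<close>

definition beats :: "real list \<Rightarrow> int \<Rightarrow> int \<Rightarrow> bool" where
  "beats G u w \<longleftrightarrow> (w \<noteq> 0 \<longrightarrow> u \<noteq> 0 \<and> G ! nat (u - 1) \<le> G ! nat (w - 1))"

lemma beats_refl: "beats G u u"
  by (simp add: beats_def)

lemma beats_trans: "beats G u v \<Longrightarrow> beats G v w \<Longrightarrow> beats G u w"
  by (auto simp: beats_def)

definition node_ok :: "real list \<Rightarrow> int list \<Rightarrow> nat \<Rightarrow> bool" where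
  "node_ok G W v \<longleftrightarrow> (W ! v = W ! (2 * v) \<or> W ! v = W ! (2 * v + 1)) \<and>
     beats G (W ! v) (W ! (2 * v)) \<and> beats G (W ! v) (W ! (2 * v + 1))"

definition tree_ok :: "real list \<Rightarrow> nat \<Rightarrow> nat \<Rightarrow> int list \<Rightarrow> bool" where
  "tree_ok G K e W \<longleftrightarrow> length W = 2 * K \<and> (\<forall>v\<in>{1..<K} - {e}. node_ok G W v) \<and>
     (\<forall>v<2 * K. 0 \<le> W ! v \<and> W ! v \<le> int K) \<and>
     (\<forall>j<K. W ! (K + j) = 0 \<or> W ! (K + j) = int j + 1)"

definition live :: "nat \<Rightarrow> int list \<Rightarrow> nat set" where
  "live K W = {j. j < K \<and> W ! (K + j) \<noteq> 0}"

lemma finite_live [simp]: "finite (live K W)"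
  by (simp add: live_def)

lemma tree_ok_replicate: "tree_ok G K 0 (replicate (2 * K) 0)"
  by (auto simp: tree_ok_def node_ok_def beats_def)

lemma live_replicate: "live K (replicate (2 * K) 0) = {}"
  by (auto simp: live_def)

text \<open>Only its parent compares the value of a leaf. For \<open>K = 1\<close> the leaf is the
  root itself, and the exception is node 0, that is, none.\<close>

lemma tree_ok_leaf:
  assumes "tree_ok G K 0 W" "j < K" "u = 0 \<or> u = int j + 1"
  shows "tree_ok G K ((K + j) div 2) (W[K + j := u])"
  unfolding tree_ok_def
proof (intro conjI ballI allI impI)
  fix v assume v: "v \<in> {1..<K} - {(K + j) div 2}"
  then have "v \<noteq> K + j" "2 * v \<noteq> K + j" "2 * v + 1 \<noteq> K + j" by auto
  with v assms show "node_ok G (W[K + j := u]) v"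
    by (auto simp: tree_ok_def node_ok_def nth_list_update)
qed (use assms in \<open>auto simp: tree_ok_def nth_list_update\<close>)

text \<open>Taking over a winning child repairs \<open>v\<close>, and only the parent of
  \<open>v\<close> sees the new value. From the root the exception moves to 0, which is no inner
  node, so the tree is then sound.\<close>

lemma tree_ok_node:
  assumes W: "tree_ok G K v W" and v: "1 \<le> v" "v < K"
    and u: "u = W ! (2 * v) \<or> u = W ! (2 * v + 1)"
    and b: "beats G u (W ! (2 * v))" "beats G u (W ! (2 * v + 1))"
  shows "tree_ok G K (v div 2) (W[v := u])"
  unfolding tree_ok_def
proof (intro conjI ballI allI impI)
  fix v' assume v': "v' \<in> {1..<K} - {v div 2}"
  then have "2 * v' \<noteq> v" "2 * v' + 1 \<noteq> v" by auto
  with v' assms show "node_ok G (W[v := u]) v'"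
    by (cases "v' = v") (auto simp: tree_ok_def node_ok_def nth_list_update)
qed (use assms in \<open>auto simp: tree_ok_def nth_list_update\<close>)

text \<open>The comparisons along the path from \<open>v\<close> up to the root compose by
  transitivity.\<close>

lemma root_beats:
  assumes "tree_ok G K 0 W"
  shows "1 \<le> v \<Longrightarrow> v < 2 * K \<Longrightarrow> beats G (W ! 1) (W ! v)"
proof (induction v rule: less_induct)
  case (less v)
  show ?case
  proof (cases "v = 1")
    case False
    with less.prems have v: "v div 2 < v" "1 \<le> v div 2" "v div 2 < K" by auto
    with assms have "node_ok G W (v div 2)" by (auto simp: tree_ok_def)
    moreover have "v = 2 * (v div 2) \<or> v = 2 * (v div 2) + 1" by auto
    ultimately have "beats G (W ! (v div 2)) (W ! v)"
      unfolding node_ok_def by metis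
    with less.IH[of "v div 2"] v less.prems show ?thesis
      by (metis beats_trans less_trans)
  qed (simp add: beats_refl)
qed

text \<open>An inner node copies one of its children, and following the copies downward ends in a
  live leaf. Children have larger numbers, so \<open>2 * K - v\<close> decreases.\<close>

lemma node_value:
  assumes "tree_ok G K 0 W"
  shows "1 \<le> v \<Longrightarrow> v < 2 * K \<Longrightarrow> W ! v \<noteq> 0 \<Longrightarrow> \<exists>j\<in>live K W. W ! v = int j + 1"
proof (induction "2 * K - v" arbitrary: v rule: less_induct)
  case less
  show ?case
  proof (cases "v < K")
    case True
    with assms less.prems have "node_ok G W v" by (auto simp: tree_ok_def)
    with less.hyps[of "2 * v"] less.hyps[of "2 * v + 1"] less.prems True show ?thesis
      by (auto simp: node_ok_def)
  next
    case False
    then obtain j where "v = K + j" using le_Suc_ex not_less by blast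
    with assms less.prems show ?thesis by (force simp: tree_ok_def live_def)
  qed
qed

lemma root_minimal:
  assumes "tree_ok G K 0 W" "1 \<le> K" "W ! 1 \<noteq> 0"
  obtains j where "W ! 1 = int j + 1" "j \<in> live K W" "\<And>i. i \<in> live K W \<Longrightarrow> G ! j \<le> G ! i"
proof -
  from node_value[OF assms(1), of 1] assms obtain j where
    j: "j \<in> live K W" "W ! 1 = int j + 1" by auto
  have "G ! j \<le> G ! i" if "i \<in> live K W" for i
  proof -
    have "W ! (K + i) = int i + 1" "1 \<le> K + i" "K + i < 2 * K"
      using assms that by (auto simp: tree_ok_def live_def)
    with root_beats[OF assms(1), of "K + i"] j show ?thesis by (simp add: beats_def)
  qed
  with j that show ?thesis by blast
qed

text \<open>By \<open>beats\<close>, a \<open>0\<close> at the root tolerates only zeros below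
  it.\<close>

lemma root_empty:
  assumes "tree_ok G K 0 W" "1 \<le> K" "W ! 1 = 0"
  shows "live K W = {}"
  using root_beats[OF assms(1)] assms(2,3) by (fastforce simp: live_def beats_def)

text \<open>The test says that \<open>w\<close> is present and that \<open>u\<close> is absent or
  has the larger key. Negated conjunctions express the disjunction, and their short-circuit safety
  ensures that \<open>G\<close> is read only for nonzero entries.\<close>

definition up_body :: com where
  "up_body =
     ISet ''u'' (IArr ''W'' (IMul (IConst 2) (IVar ''v''))) ;;
     ISet ''w'' (IArr ''W'' (IAdd (IMul (IConst 2) (IVar ''v'')) (IConst 1))) ;;
     If (And (ILess (IConst 0) (IVar ''w''))
          (Not (And (ILess (IConst 0) (IVar ''u''))
            (Not (RLess (RArr ''G'' (ISub (IVar ''w'') (IConst 1)))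
                        (RArr ''G'' (ISub (IVar ''u'') (IConst 1))))))))
        (ISet ''u'' (IVar ''w'')) Skip ;;
     IStore ''W'' (IVar ''v'') (IVar ''u'') ;;
     ISet ''v'' (IDiv (IVar ''v'') (IConst 2))"

text \<open>\<open>e\<close> is \<open>j + 1\<close> for inserting candidate \<open>j\<close> and
  \<open>0\<close> for removing it; the path to the root is then repaired.\<close>

definition set_leaf :: "iexp \<Rightarrow> com" where
  "set_leaf e =
     ISet ''v'' (IAdd (IVar ''K'') (IVar ''j'')) ;;
     IStore ''W'' (IVar ''v'') e ;;
     ISet ''v'' (IDiv (IVar ''v'') (IConst 2)) ;;
     While (ILess (IConst 0) (IVar ''v'')) up_body"

lemma mods_up_body [simp]:
  "imods up_body = {''u'', ''w'', ''v''}" "rmods up_body = {}" "iamods up_body = {''W''}"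
  "ramods up_body = {}" "noalloc up_body"
  by (auto simp: up_body_def)

lemma mods_set_leaf [simp]:
  "imods (set_leaf e) = {''u'', ''w'', ''v''}" "rmods (set_leaf e) = {}"
  "iamods (set_leaf e) = {''W''}" "ramods (set_leaf e) = {}" "noalloc (set_leaf e)"
  by (auto simp: set_leaf_def)

text \<open>\<open>floorlog 2 v\<close> counts the nodes on the path from \<open>v\<close> to the
  root, which makes it the potential for the climb.\<close>

lemma floorlog_div2: "1 \<le> v \<Longrightarrow> floorlog 2 v = Suc (floorlog 2 (v div 2))"
  by (subst compute_floorlog) simp

lemma wp_up_body:
  assumes tree: "tree_ok (rarrs \<sigma> ''G'') K v (iarrs \<sigma> ''W'')" and G: "length (rarrs \<sigma> ''G'') = K"
    and v: "ivars \<sigma> ''v'' = int v" "1 \<le> v" "v < K"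
    and B: "2 * K + 2 \<le> B"
  shows "wp B up_body (\<lambda>t \<sigma>'. ivars \<sigma>' ''v'' = int (v div 2) \<and>
      tree_ok (rarrs \<sigma> ''G'') K (v div 2) (iarrs \<sigma>' ''W'') \<and>
      (\<forall>i\<ge>K. iarrs \<sigma>' ''W'' ! i = iarrs \<sigma> ''W'' ! i) \<and> t \<le> 60) 0 \<sigma>"
proof -
  define W where "W = iarrs \<sigma> ''W''"
  define G' where "G' = rarrs \<sigma> ''G''"
  define u w where "u = W ! (2 * v)" and "w = W ! Suc (2 * v)"
  from tree have W: "length W = 2 * K" and range: "\<And>v. v < 2 * K \<Longrightarrow> 0 \<le> W ! v \<and> W ! v \<le> int K"
    by (auto simp: tree_ok_def W_def)
  have u: "0 \<le> u" "u \<le> int K" and w: "0 \<le> w" "w \<le> int K"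
    using range[of "2 * v"] range[of "2 * v + 1"] v by (auto simp: u_def w_def)
  have nat: "nat (2 * int v) = 2 * v" "nat (2 * int v + 1) = Suc (2 * v)" by auto
  \<comment> \<open>The value that the conditional leaves in variable \<open>u\<close>: the winner
    of the two children.\<close>
  define z where "z = (if 0 < w \<and> \<not> (0 < u \<and> \<not> G' ! nat (w - 1) < G' ! nat (u - 1)) then w else u)"
  have z: "z = u \<or> z = w" "beats G' z u" "beats G' z w" "\<bar>z\<bar> \<le> int B"
    using u w B by (auto simp: z_def beats_def)
  have "tree_ok G' K (v div 2) (W[v := z])"
    using tree v z by (intro tree_ok_node) (auto simp: W_def G'_def u_def w_def)
  with z v B W u w G show ?thesis
    by (auto simp: up_body_def in_range_def nat W_def[symmetric] G'_def[symmetric] u_def[symmetric]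
        w_def[symmetric] z_def zdiv_int)
qed

text \<open>The assumption on \<open>e\<close> ranges over all states that agree on
  \<open>j\<close>, because \<open>e\<close> is evaluated after \<open>v\<close> has been
  overwritten.\<close>

lemma wp_set_leaf:
  assumes tree: "tree_ok (rarrs \<sigma> ''G'') K 0 (iarrs \<sigma> ''W'')" and G: "length (rarrs \<sigma> ''G'') = K"
    and j: "ivars \<sigma> ''j'' = int j" "ivars \<sigma> ''K'' = int K" "j < K"
    and e: "\<And>\<sigma>'. ivars \<sigma>' ''j'' = int j \<Longrightarrow> isafe B \<sigma>' e \<and> ival \<sigma>' e = u" "u = 0 \<or> u = int j + 1"
    and B: "2 * K + 2 \<le> B"
  shows "wp B (set_leaf e) (\<lambda>t \<sigma>'. tree_ok (rarrs \<sigma> ''G'') K 0 (iarrs \<sigma>' ''W'') \<and>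
      live K (iarrs \<sigma>' ''W'') = (if u = 0 then live K (iarrs \<sigma> ''W'') - {j}
        else insert j (live K (iarrs \<sigma> ''W''))) \<and>
      t \<le> 100 * floorlog 2 (2 * K) + 30 + icost e) 0 \<sigma>"
proof -
  define W where "W = (iarrs \<sigma> ''W'')[K + j := u]"
  have W: "tree_ok (rarrs \<sigma> ''G'') K ((K + j) div 2) W"
    unfolding W_def using tree j e by (intro tree_ok_leaf) auto
  have len: "length (iarrs \<sigma> ''W'') = 2 * K" using tree by (simp add: tree_ok_def)
  have log: "floorlog 2 ((K + j) div 2) \<le> floorlog 2 (2 * K)"
    using j by (intro floorlog_mono) auto
  have nat: "nat (int K + int j) = K + j" "(int K + int j) div 2 = int ((K + j) div 2)" by auto
  define Q where "Q = (\<lambda>t (\<sigma>' :: state). tree_ok (rarrs \<sigma> ''G'') K 0 (iarrs \<sigma>' ''W'') \<and>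
      live K (iarrs \<sigma>' ''W'') = (if u = 0 then live K (iarrs \<sigma> ''W'') - {j}
        else insert j (live K (iarrs \<sigma> ''W''))) \<and>
      t \<le> 100 * floorlog 2 (2 * K) + 30 + icost e)"
  have "wp B (set_leaf e) Q 0 \<sigma>"
    unfolding set_leaf_def
    using B j
    apply (simp add: in_range_def len e(1) nat flip: W_def)
    apply (rule conjI, linarith)
    \<comment> \<open>The climb writes only nodes below \<open>K\<close>, so the live set is settled
      by the leaf. Each level costs at most 60 plus the guard, which 100 covers.\<close>
    apply (rule wp_While[where g = "(K + j) div 2" and \<Phi> = "\<lambda>v. 100 * floorlog 2 v" and
        I = "\<lambda>v \<sigma>'. ivars \<sigma>' ''v'' = int v \<and> v < K \<and> 
           tree_ok (rarrs \<sigma> ''G'') K v (iarrs \<sigma>' ''W'') \<and> (\<forall>i\<ge>K. iarrs \<sigma>' ''W'' ! i = W ! i)"])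
    subgoal using j W by (simp add: W_def)
    subgoal using B by simp
    subgoal for v \<sigma>'
      apply (rule wp_conseq[OF wp_up_body[where v = v and K = K]])
            apply (auto simp: frameD(4)[where A = "''G''"] G B floorlog_div2)
      done
    subgoal for v \<sigma>' t'
      using log len j e(2) by (auto simp: Q_def W_def live_def nth_list_update)
    done
  then show ?thesis unfolding Q_def .
qed

section \<open>Generating the intervals over the threshold\<close>

text \<open>
  \<open>Q\<close> holds the partial sums of \<open>X\<close>.  Candidate \<open>j\<close> is the interval \<open>(L[j], R[j]]\<close> with best split
  \<open>S[j]\<close> and key \<open>G[j]\<close>.  \<open>W\<close> is the tournament tree, and \<open>D\<close> marks the declared change points.
\<close>

definition scan_body :: com where
  "scan_body =
     RSet ''d'' (RSub
       (RMul (RInt (ISub (IVar ''r'') (IVar ''l'')))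
             (RSub (RArr ''Q'' (IVar ''s'')) (RArr ''Q'' (IVar ''l''))))
       (RMul (RInt (ISub (IVar ''s'') (IVar ''l'')))
             (RSub (RArr ''Q'' (IVar ''r'')) (RArr ''Q'' (IVar ''l''))))) ;;
     RSet ''e'' (RDiv (RMul (RVar ''d'') (RVar ''d''))
       (RMul (RMul (RInt (ISub (IVar ''r'') (IVar ''l''))) (RInt (ISub (IVar ''s'') (IVar ''l''))))
             (RInt (ISub (IVar ''r'') (IVar ''s''))))) ;;
     If (RLess (RVar ''g'') (RVar ''e''))
       (RSet ''g'' (RVar ''e'') ;; ISet ''h'' (IVar ''s'')) Skip ;;
     ISet ''s'' (IAdd (IVar ''s'') (IConst 1))"

text \<open>The start value -1 lies below every squared gain, so the first split is always
  recorded.\<close>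

definition scan :: com where
  "scan =
     ISet ''s'' (IAdd (IVar ''l'') (IConst 1)) ;;
     RSet ''g'' (RInt (IConst (- 1))) ;;
     While (ILess (IVar ''s'') (IVar ''r'')) scan_body"

definition key_exp :: "selection \<Rightarrow> rexp" where
  "key_exp sel = (case sel of
     Greedy \<Rightarrow> RSub (RInt (IConst 0)) (RVar ''g'')
   | Narrowest_Over_Threshold \<Rightarrow> RInt (ISub (IVar ''r'') (IVar ''l'')))"

text \<open>The guard is the disjunction of \<open>less_sqrt_iff\<close> in De Morgan form.\<close>

definition store :: "selection \<Rightarrow> com" where
  "store sel =
     If (Not (And (Not (RLess (RVar ''kappa'') (RInt (IConst 0))))
                  (Not (RLess (RMul (RVar ''kappa'') (RVar ''kappa'')) (RVar ''g'')))))
       (IStore ''L'' (IVar ''j'') (IVar ''l'') ;;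
        IStore ''R'' (IVar ''j'') (IVar ''r'') ;;
        IStore ''S'' (IVar ''j'') (IVar ''h'') ;;
        RStore ''G'' (IVar ''j'') (key_exp sel) ;;
        ISet ''j'' (IAdd (IVar ''j'') (IConst 1))) Skip"

definition process :: "selection \<Rightarrow> com" where
  "process sel =
     If (ILess (IVar ''r'') (IAdd (IVar ''l'') (IVar ''m''))) Skip (scan ;; store sel)"

text \<open>
  The language has no rounding, so floors and ceilings are found by counting.  Within a layer \<open>l\<close> is
  never reset, so all its increments together cost \<open>O(T)\<close>.
\<close>

definition endpoints :: com where
  "endpoints =
     RSet ''y'' (RMul (RInt (IVar ''i'')) (RVar ''z'')) ;;
     While (Not (RLess (RVar ''y'') (RInt (IAdd (IVar ''l'') (IConst 1)))))
       (ISet ''l'' (IAdd (IVar ''l'') (IConst 1))) ;;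
     ISet ''r'' (IVar ''l'') ;;
     While (RLess (RInt (IVar ''r'')) (RAdd (RVar ''y'') (RVar ''len'')))
       (ISet ''r'' (IAdd (IVar ''r'') (IConst 1)))"

text \<open>\<open>c\<close> counts up to the ceiling of \<open>p = (1 / a) ^ (k - 1)\<close>. The
  layer has \<open>2 * c - 1\<close> intervals, so the counting costs no more than a constant per
  interval of the layer.\<close>

definition layer_setup :: com where
  "layer_setup =
     ISet ''c'' (IConst 0) ;;
     While (RLess (RInt (IVar ''c'')) (RVar ''p'')) (ISet ''c'' (IAdd (IVar ''c'') (IConst 1))) ;;
     If (ILess (IConst 1) (IVar ''c''))
       (RSet ''z'' (RDiv (RSub (RInt (IVar ''T'')) (RVar ''len''))
                         (RInt (ISub (IMul (IConst 2) (IVar ''c'')) (IConst 2)))))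
       (RSet ''z'' (RInt (IConst 0)))"

definition layer_body :: "selection \<Rightarrow> com" where
  "layer_body sel =
     endpoints ;; process sel ;; ISet ''i'' (IAdd (IVar ''i'') (IConst 1))"

definition layer :: "selection \<Rightarrow> com" where
  "layer sel =
     layer_setup ;;
     ISet ''i'' (IConst 0) ;; ISet ''l'' (IConst 0) ;;
     While (ILess (IVar ''i'') (ISub (IMul (IConst 2) (IVar ''c'')) (IConst 1))) (layer_body sel)"

definition generate_body :: "selection \<Rightarrow> com" where
  "generate_body sel =
     layer sel ;;
     RSet ''len'' (RMul (RVar ''len'') (RVar ''a'')) ;;
     RSet ''p'' (RDiv (RVar ''p'') (RVar ''a''))"

definition generate :: "selection \<Rightarrow> com" where
  "generate sel =
     ISet ''j'' (IConst 0) ;; RSet ''len'' (RInt (IVar ''T'')) ;; RSet ''p'' (RInt (IConst 1)) ;;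
     While (RLess (RInt (IConst 1)) (RVar ''len'')) (generate_body sel)"

section \<open>Frames of the generating commands\<close>

lemma mods_scan_body [simp]:
  "imods scan_body = {''s'', ''h''}" "rmods scan_body = {''d'', ''e'', ''g''}"
  "iamods scan_body = {}" "ramods scan_body = {}" "noalloc scan_body"
  by (auto simp: scan_body_def)

lemma mods_scan [simp]:
  "imods scan = {''s'', ''h''}" "rmods scan = {''d'', ''e'', ''g''}"
  "iamods scan = {}" "ramods scan = {}" "noalloc scan"
  by (auto simp: scan_def)

lemma mods_store [simp]:
  "imods (store sel) = {''j''}" "rmods (store sel) = {}"
  "iamods (store sel) = {''L'', ''R'', ''S''}" "ramods (store sel) = {''G''}" "noalloc (store sel)"
  by (auto simp: store_def)

lemma mods_process [simp]:
  "imods (process sel) = {''s'', ''h'', ''j''}" "rmods (process sel) = {''d'', ''e'', ''g''}"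
  "iamods (process sel) = {''L'', ''R'', ''S''}" "ramods (process sel) = {''G''}"
  "noalloc (process sel)"
  by (auto simp: process_def)

lemma mods_endpoints [simp]:
  "imods endpoints = {''l'', ''r''}" "rmods endpoints = {''y''}"
  "iamods endpoints = {}" "ramods endpoints = {}" "noalloc endpoints"
  by (auto simp: endpoints_def)

lemma mods_layer_setup [simp]:
  "imods layer_setup = {''c''}" "rmods layer_setup = {''z''}"
  "iamods layer_setup = {}" "ramods layer_setup = {}" "noalloc layer_setup"
  by (auto simp: layer_setup_def)

lemma mods_layer_body [simp]:
  "imods (layer_body sel) = {''s'', ''h'', ''j'', ''l'', ''r'', ''i''}"
  "rmods (layer_body sel) = {''d'', ''e'', ''g'', ''y''}"
  "iamods (layer_body sel) = {''L'', ''R'', ''S''}" "ramods (layer_body sel) = {''G''}"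
  "noalloc (layer_body sel)"
  by (auto simp: layer_body_def)

lemma mods_layer [simp]:
  "imods (layer sel) = {''s'', ''h'', ''j'', ''l'', ''r'', ''i'', ''c''}"
  "rmods (layer sel) = {''d'', ''e'', ''g'', ''y'', ''z''}"
  "iamods (layer sel) = {''L'', ''R'', ''S''}" "ramods (layer sel) = {''G''}"
  "noalloc (layer sel)"
  by (auto simp: layer_def)

lemma mods_generate_body [simp]:
  "imods (generate_body sel) = {''s'', ''h'', ''j'', ''l'', ''r'', ''i'', ''c''}"
  "rmods (generate_body sel) = {''d'', ''e'', ''g'', ''y'', ''z'', ''len'', ''p''}"
  "iamods (generate_body sel) = {''L'', ''R'', ''S''}" "ramods (generate_body sel) = {''G''}"
  "noalloc (generate_body sel)"
  by (auto simp: generate_body_def)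

lemma mods_generate [simp]:
  "imods (generate sel) = {''s'', ''h'', ''j'', ''l'', ''r'', ''i'', ''c''}"
  "rmods (generate sel) = {''d'', ''e'', ''g'', ''y'', ''z'', ''len'', ''p''}"
  "iamods (generate sel) = {''L'', ''R'', ''S''}" "ramods (generate sel) = {''G''}"
  "noalloc (generate sel)"
  by (auto simp: generate_def)

text \<open>\<open>K\<close> bounds the number of seeded intervals, hence of candidates.
  \<open>B\<close> leaves room for node numbers up to \<open>2 * K\<close>, for positions up to
  \<open>T + 1\<close> and for the sum \<open>l + m\<close>.\<close>

locale segmentation = seeded a T for a :: real and T :: nat +
  fixes m K B :: nat and sel :: selection and \<kappa> :: real and x :: "nat \<Rightarrow> real"
  assumes m: "2 \<le> m" and K: "K = nat \<lceil>3 / (1 - a)\<rceil> * T" and B: "4 * K + 4 * T + m + 4 \<le> B"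
begin

lemma K_pos: "1 \<le> K"
proof -
  have "0 < 3 / (1 - a)" using a_less by simp
  then have "1 \<le> nat \<lceil>3 / (1 - a)\<rceil>" by linarith
  with T_pos show ?thesis unfolding K by (metis One_nat_def mult_le_mono nat_1_eq_mult_iff)
qed

text \<open>What holds from the partial sums on and survives every later command: the parameters,
  the partial sums, and the lengths, but not the contents, of the working arrays.\<close>

definition env :: "state \<Rightarrow> bool" where
  "env \<sigma> \<longleftrightarrow> ivars \<sigma> ''T'' = int T \<and> ivars \<sigma> ''m'' = int m \<and> ivars \<sigma> ''K'' = int K \<and>
     rvars \<sigma> ''a'' = a \<and> rvars \<sigma> ''kappa'' = \<kappa> \<and>
     rarrs \<sigma> ''Q'' = map (\<lambda>i. sum x {1..i}) [0..<Suc T] \<and>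
     length (iarrs \<sigma> ''L'') = K \<and> length (iarrs \<sigma> ''R'') = K \<and> length (iarrs \<sigma> ''S'') = K \<and>
     length (rarrs \<sigma> ''G'') = K \<and> length (iarrs \<sigma> ''W'') = 2 * K \<and>
     length (iarrs \<sigma> ''D'') = Suc T \<and> length (iarrs \<sigma> ''out'') = K"

lemma env_frame:
  assumes "env \<sigma>" "frame c \<sigma> \<sigma>'" "noalloc c" "''T'' \<notin> imods c" "''m'' \<notin> imods c" "''K'' \<notin> imods c"
    "''a'' \<notin> rmods c" "''kappa'' \<notin> rmods c" "''Q'' \<notin> ramods c"
  shows "env \<sigma>'"
  using assms frameD[OF assms(2)] by (simp add: env_def del: upt_Suc)

section \<open>Scanning one interval and storing it\<close>

lemma wp_scan_body:
  assumes env: "env \<sigma>" and lr: "ivars \<sigma> ''l'' = int l" "ivars \<sigma> ''r'' = int r" "ivars \<sigma> ''s'' = int s"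
    and bounds: "l < s" "s < r" "r \<le> T"
  shows "wp B scan_body (\<lambda>t \<sigma>'. ivars \<sigma>' ''s'' = int (Suc s) \<and> t \<le> 80 \<and>
      (if rvars \<sigma> ''g'' < squared_gain x l r s
       then ivars \<sigma>' ''h'' = int s \<and> rvars \<sigma>' ''g'' = squared_gain x l r s
       else ivars \<sigma>' ''h'' = ivars \<sigma> ''h'' \<and> rvars \<sigma>' ''g'' = rvars \<sigma> ''g'')) 0 \<sigma>"
proof -
  have "sum x {1..s} - sum x {1..l} = sum x {Suc 0..s} - sum x {Suc 0..l}" by simp
  with env lr bounds B show ?thesis
    by (simp add: scan_body_def env_def in_range_def squared_gain_def Let_def nth_map del: upt_Suc)
qed

lemma wp_scan:
  assumes env: "env \<sigma>" and lr: "ivars \<sigma> ''l'' = int l" "ivars \<sigma> ''r'' = int r"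
    and bounds: "Suc l < r" "r \<le> T"
  shows "wp B scan (\<lambda>t \<sigma>'. t \<le> 100 * (r - l) \<and> (\<exists>h. ivars \<sigma>' ''h'' = int h \<and> l < h \<and> h < r \<and>
      rvars \<sigma>' ''g'' = squared_gain x l r h \<and>
      best_split Min x (l, r) = h \<and> max_gain Min x (l, r) = sqrt (squared_gain x l r h))) 0 \<sigma>"
proof -
  define Q where "Q = (\<lambda>t (\<sigma>' :: state). t \<le> 100 * (r - l) \<and>
      (\<exists>h. ivars \<sigma>' ''h'' = int h \<and> l < h \<and> h < r \<and>
      rvars \<sigma>' ''g'' = squared_gain x l r h \<and>
      best_split Min x (l, r) = h \<and> max_gain Min x (l, r) = sqrt (squared_gain x l r h)))"
  \<comment> \<open>\<open>h\<close> is the leftmost maximiser among the splits before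
    \<open>s\<close>. At \<open>s = Suc l\<close> none has been seen, and \<open>g\<close> still has
    its start value.\<close>
  define I where "I = (\<lambda>s (\<sigma>' :: state). ivars \<sigma>' ''s'' = int s \<and> l < s \<and> s \<le> r \<and>
      (if s = Suc l then rvars \<sigma>' ''g'' = - 1 else
       \<exists>h. ivars \<sigma>' ''h'' = int h \<and> l < h \<and> h < s \<and> rvars \<sigma>' ''g'' = squared_gain x l r h \<and>
         (\<forall>t. l < t \<and> t < h \<longrightarrow> squared_gain x l r t < squared_gain x l r h) \<and>
         (\<forall>t. h \<le> t \<and> t < s \<longrightarrow> squared_gain x l r t \<le> squared_gain x l r h)))"
  have "wp B scan Q 0 \<sigma>"
    unfolding scan_def
    using lr bounds B
    apply simp
    apply (rule wp_While[where g = "Suc l" and \<Phi> = "\<lambda>s. 90 * (r - s)" and I = I])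
    subgoal by (simp add: I_def)
    subgoal for s \<sigma>' by (simp add: I_def frameD)
    subgoal premises prems for s \<sigma>'
    proof -
      from prems have s: "ivars \<sigma>' ''s'' = int s" "l < s" "s < r"
        by (auto simp: I_def frameD)
      have env': "env \<sigma>'"
        by (rule env_frame[OF _ \<open>frame _ _ \<sigma>'\<close>]) (use env in \<open>simp_all add: env_def\<close>)
      have lr': "ivars \<sigma>' ''l'' = int l" "ivars \<sigma>' ''r'' = int r"
        using prems by (simp_all add: frameD)
      show ?thesis
      proof (rule wp_conseq[OF wp_scan_body[OF env' lr' s bounds(2)]], intro exI[of _ "Suc s"], elim conjE, intro conjI)
        fix t'' :: nat and \<sigma>'' :: state
        assume g: "if rvars \<sigma>' ''g'' < squared_gain x l r s
          then ivars \<sigma>'' ''h'' = int s \<and> rvars \<sigma>'' ''g'' = squared_gain x l r s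
          else ivars \<sigma>'' ''h'' = ivars \<sigma>' ''h'' \<and> rvars \<sigma>'' ''g'' = rvars \<sigma>' ''g''"
          and s'': "ivars \<sigma>'' ''s'' = int (Suc s)" and t'': "t'' \<le> 80"
        show "I (Suc s) \<sigma>''"
        proof (cases "s = Suc l")
          case True
          with \<open>I s \<sigma>'\<close> squared_gain_nonneg[OF s(2,3), of x]
          have "rvars \<sigma>' ''g'' < squared_gain x l r s" by (simp add: I_def)
          with g have "ivars \<sigma>'' ''h'' = int s" "rvars \<sigma>'' ''g'' = squared_gain x l r s" by auto
          with s'' s True show ?thesis
            by (auto simp: I_def less_Suc_eq intro!: exI[of _ s])
        next
          case False
          with \<open>I s \<sigma>'\<close> obtain h where h: "ivars \<sigma>' ''h'' = int h" "l < h" "h < s"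
            "rvars \<sigma>' ''g'' = squared_gain x l r h"
            "\<forall>t. l < t \<and> t < h \<longrightarrow> squared_gain x l r t < squared_gain x l r h"
            "\<forall>t. h \<le> t \<and> t < s \<longrightarrow> squared_gain x l r t \<le> squared_gain x l r h"
            by (auto simp: I_def)
          show ?thesis
          proof (cases "squared_gain x l r h < squared_gain x l r s")
            case True
            have "squared_gain x l r t < squared_gain x l r s" if "l < t" "t < s" for t
              using h(5,6)[rule_format, of t] that True by (cases "t < h") auto
            with True g h s'' s show ?thesis by (auto simp: I_def less_Suc_eq)
          next
            case False
            with g h s'' s show ?thesis by (auto simp: I_def less_Suc_eq)
          qed
        qed
        show "1 + bcost (ILess (IVar ''s'') (IVar ''r'')) + (0 + t'') + 90 * (r - Suc s) \<le> 90 * (r - s)"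
          using t'' s by (simp add: Suc_diff_Suc flip: Suc_diff_Suc)
      qed
    qed
    subgoal premises prems for s \<sigma>' t'
    proof -
      have "s = r" using prems by (auto simp: I_def frameD)
      with \<open>I s \<sigma>'\<close> bounds obtain h where h: "ivars \<sigma>' ''h'' = int h" "l < h" "h < r"
        "rvars \<sigma>' ''g'' = squared_gain x l r h"
        "\<forall>t. l < t \<and> t < h \<longrightarrow> squared_gain x l r t < squared_gain x l r h"
        "\<forall>t. h \<le> t \<and> t < r \<longrightarrow> squared_gain x l r t \<le> squared_gain x l r h"
        by (auto simp: I_def)
      from first_maximum[OF h(2,3), of x] h(5,6) have
        "best_split Min x (l, r) = h" "max_gain Min x (l, r) = sqrt (squared_gain x l r h)"
        by auto
      moreover have "t' \<le> 100 * (r - l)" using prems bounds by simp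
      ultimately show ?thesis unfolding Q_def using h by blast
    qed
    done
  then show ?thesis unfolding Q_def .
qed

definition good :: "interval \<Rightarrow> bool" where
  "good I \<longleftrightarrow> fst I + m \<le> snd I \<and> \<kappa> < max_gain Min x I"

definition key :: "interval \<Rightarrow> real" where
  "key I = (case sel of
     Greedy \<Rightarrow> - squared_gain x (fst I) (snd I) (best_split Min x I)
   | Narrowest_Over_Threshold \<Rightarrow> real (snd I - fst I))"

definition stored :: "state \<Rightarrow> interval list \<Rightarrow> bool" where
  "stored \<sigma> Is \<longleftrightarrow> (\<forall>i<length Is. iarrs \<sigma> ''L'' ! i = int (fst (Is ! i)) \<and>
     iarrs \<sigma> ''R'' ! i = int (snd (Is ! i)) \<and>
     iarrs \<sigma> ''S'' ! i = int (best_split Min x (Is ! i)) \<and> rarrs \<sigma> ''G'' ! i = key (Is ! i))"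

lemma stored_frame:
  assumes "stored \<sigma> Is" "frame c \<sigma> \<sigma>'" "''L'' \<notin> iamods c" "''R'' \<notin> iamods c" "''S'' \<notin> iamods c"
    "''G'' \<notin> ramods c"
  shows "stored \<sigma>' Is"
  using assms frameD(3,4)[OF assms(2)] by (simp add: stored_def)

text \<open>\<open>P\<close> is a ghost list of all intervals generated so far. The arrays hold only
  its good members, so \<open>length P < K\<close> guarantees a free cell.\<close>

lemma wp_store:
  assumes env: "env \<sigma>" and lr: "ivars \<sigma> ''l'' = int l" "ivars \<sigma> ''r'' = int r" "ivars \<sigma> ''h'' = int h"
    and bounds: "l < h" "h < r" "r \<le> T" "l + m \<le> r"
    and h: "rvars \<sigma> ''g'' = squared_gain x l r h"
      "best_split Min x (l, r) = h" "max_gain Min x (l, r) = sqrt (squared_gain x l r h)"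
    and Is: "stored \<sigma> (filter good P)" "ivars \<sigma> ''j'' = int (length (filter good P))"
      "length P < K"
  shows "wp B (store sel) (\<lambda>t \<sigma>'. t \<le> 60 \<and> stored \<sigma>' (filter good (P @ [(l, r)])) \<and>
    ivars \<sigma>' ''j'' = int (length (filter good (P @ [(l, r)])))) 0 \<sigma>"
proof -
  have good: "good (l, r) \<longleftrightarrow> \<kappa> < 0 \<or> \<kappa> * \<kappa> < squared_gain x l r h"
    using squared_gain_nonneg[OF bounds(1,2), of x] bounds h by (simp add: good_def less_sqrt_iff)
  have len: "length (filter good P) < K" using Is(3) length_filter_le le_less_trans by blast
  \<comment> \<open>The key is evaluated after three stores, hence the quantification over
    states.\<close>
  have key: "rcost (key_exp sel) \<le> 10" "rsafe B \<sigma>' (key_exp sel) \<and> rval \<sigma>' (key_exp sel) = key (l, r)"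
    if "ivars \<sigma>' ''l'' = int l" "ivars \<sigma>' ''r'' = int r" "rvars \<sigma>' ''g'' = rvars \<sigma> ''g''" for \<sigma>'
    using bounds h B that by (auto simp: key_exp_def key_def of_nat_diff split: selection.split)
  show ?thesis
  proof (cases "good (l, r)")
    case True
    then show ?thesis
      using good env lr h(1) Is len bounds B h(2) key(1)[of \<sigma>]
      by (simp add: store_def env_def in_range_def key(2) stored_def nth_append nth_list_update less_Suc_eq)
  next
    case False
    then show ?thesis
      using good env lr h(1) Is len by (simp add: store_def env_def)
  qed
qed

lemma wp_process:
  assumes env: "env \<sigma>" and lr: "ivars \<sigma> ''l'' = int l" "ivars \<sigma> ''r'' = int r"
    and bounds: "l < r" "r \<le> T"
    and Is: "stored \<sigma> (filter good P)" "ivars \<sigma> ''j'' = int (length (filter good P))"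
      "length P < K"
  shows "wp B (process sel) (\<lambda>t \<sigma>'. t \<le> 100 * (r - l) + 70 \<and> stored \<sigma>' (filter good (P @ [(l, r)])) \<and>
    ivars \<sigma>' ''j'' = int (length (filter good (P @ [(l, r)])))) 0 \<sigma>"
proof (cases "l + m \<le> r")
  case False
  with env lr bounds B Is show ?thesis
    by (simp add: process_def env_def good_def)
next
  case True
  define Q where "Q = (\<lambda>t \<sigma>'. t \<le> 100 * (r - l) + 70 \<and> stored \<sigma>' (filter good (P @ [(l, r)])) \<and>
    ivars \<sigma>' ''j'' = int (length (filter good (P @ [(l, r)]))))"
  from True m have r: "Suc l < r" by simp
  have "wp B (process sel) Q 0 \<sigma>"
    using env lr bounds B True
    apply (simp add: process_def env_def del: upt_Suc)
    apply (rule wp_conseq[OF wp_scan[OF env lr r bounds(2)]])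
    subgoal premises prems for t' \<sigma>'
    proof -
      from prems obtain h where h: "ivars \<sigma>' ''h'' = int h" "l < h" "h < r"
        "rvars \<sigma>' ''g'' = squared_gain x l r h" "best_split Min x (l, r) = h"
        "max_gain Min x (l, r) = sqrt (squared_gain x l r h)" and t': "t' \<le> 100 * (r - l)"
        by blast
      note fr = \<open>frame scan \<sigma> \<sigma>'\<close>
      have "env \<sigma>'" by (rule env_frame[OF env fr]) simp_all
      moreover have "stored \<sigma>' (filter good P)" by (rule stored_frame[OF Is(1) fr]) simp_all
      moreover have "ivars \<sigma>' ''l'' = int l" "ivars \<sigma>' ''r'' = int r"
        "ivars \<sigma>' ''j'' = int (length (filter good P))"
        using lr Is(2) by (simp_all add: frameD[OF fr])
      ultimately show ?thesis
        using h bounds True Is(3) t' by (intro wp_conseq[OF wp_store]) (auto simp: Q_def)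
    qed
    done
  then show ?thesis unfolding Q_def .
qed

end

text \<open>The common form of the loops that round: the guard is known only through the number
  \<open>N\<close> at which it first fails. One round costs \<open>1 + bcost b\<close> for the guard
  and 4 for the increment.\<close>

lemma wp_count:
  assumes v: "ivars \<sigma> v = int n" "n \<le> N" and B: "Suc N \<le> B" "1 \<le> B"
    and b: "\<And>n. n \<le> N \<Longrightarrow> bsafe B (\<sigma>\<lparr>ivars := (ivars \<sigma>)(v := int n)\<rparr>) b"
      "\<And>n. n \<le> N \<Longrightarrow> bval (\<sigma>\<lparr>ivars := (ivars \<sigma>)(v := int n)\<rparr>) b \<longleftrightarrow> n < N"
    and Q: "\<And>t'. t' \<le> t + (bcost b + 5) * (N - n) + bcost b + 1 \<Longrightarrow>
      Q t' (\<sigma>\<lparr>ivars := (ivars \<sigma>)(v := int N)\<rparr>)"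
  shows "wp B (While b (ISet v (IAdd (IVar v) (IConst 1)))) Q t \<sigma>"
proof (rule wp_While[where g = n and \<Phi> = "\<lambda>n. (bcost b + 5) * (N - n)" and
    I = "\<lambda>n \<sigma>'. n \<le> N \<and> \<sigma>' = \<sigma>\<lparr>ivars := (ivars \<sigma>)(v := int n)\<rparr>"])
  show "n \<le> N \<and> \<sigma> = \<sigma>\<lparr>ivars := (ivars \<sigma>)(v := int n)\<rparr>"
    using v by (simp flip: v(1))
next
  fix n' and \<sigma>' :: state
  assume *: "n' \<le> N \<and> \<sigma>' = \<sigma>\<lparr>ivars := (ivars \<sigma>)(v := int n')\<rparr>"
  then show "bsafe B \<sigma>' b" using b by simp
  assume "bval \<sigma>' b"
  with * b have n': "n' < N" by simp
  then have "(bcost b + 5) * (N - n') = (bcost b + 5) + (bcost b + 5) * (N - Suc n')"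
    by (simp flip: mult_Suc_right add: Suc_diff_Suc)
  with * n' B show "wp B (ISet v (IAdd (IVar v) (IConst 1)))
      (\<lambda>t \<sigma>''. \<exists>n''. (n'' \<le> N \<and> \<sigma>'' = \<sigma>\<lparr>ivars := (ivars \<sigma>)(v := int n'')\<rparr>) \<and>
        1 + bcost b + t + (bcost b + 5) * (N - n'') \<le> (bcost b + 5) * (N - n')) 0 \<sigma>'"
    by (auto intro!: exI[of _ "Suc n'"] simp: add.commute)
next
  fix n' t' and \<sigma>' :: state
  assume *: "n' \<le> N \<and> \<sigma>' = \<sigma>\<lparr>ivars := (ivars \<sigma>)(v := int n')\<rparr>" and "\<not> bval \<sigma>' b"
    and t': "t' + (bcost b + 5) * (N - n') \<le> t + (bcost b + 5) * (N - n) + 1 + bcost b"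
  then have "n' = N" using b(2)[of n'] by auto
  with * t' Q[of t'] show "Q t' \<sigma>'" by simp
qed

section \<open>The loops over the intervals of a layer and over the layers\<close>

context segmentation
begin

text \<open>\<open>l\<^sub>0\<close> is where the previous interval left the counter, or 0 at the
  start of a layer. As it does not exceed \<open>i * z\<close>, counting upward from it reaches the
  floor; the count for the ceiling then starts at \<open>l\<close>.\<close>

lemma wp_endpoints:
  assumes i: "ivars \<sigma> ''i'' = int i" "i \<le> K" and z: "rvars \<sigma> ''z'' = z" and len: "rvars \<sigma> ''len'' = len" "0 < len"
    and l0: "ivars \<sigma> ''l'' = int l\<^sub>0" "real l\<^sub>0 \<le> real i * z"
    and l: "l = nat \<lfloor>real i * z\<rfloor>" and r: "r = nat \<lceil>real i * z + len\<rceil>" and T: "l < r" "r \<le> T"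
  shows "wp B endpoints (\<lambda>t \<sigma>'. ivars \<sigma>' ''l'' = int l \<and> ivars \<sigma>' ''r'' = int r \<and>
    t \<le> 20 * (l - l\<^sub>0) + 20 * (r - l) + 40) 0 \<sigma>"
proof -
  define Q where "Q = (\<lambda>t (\<sigma>' :: state). ivars \<sigma>' ''l'' = int l \<and> ivars \<sigma>' ''r'' = int r \<and>
    t \<le> 20 * (l - l\<^sub>0) + 20 * (r - l) + 40)"
  define y where "y = real i * z"
  have y: "0 \<le> y" "real l\<^sub>0 \<le> y" using l0 by (auto simp: y_def)
  have ly: "real l \<le> y" "y < real l + 1"
    using y l unfolding y_def[symmetric] by linarith+
  have ry: "real r - 1 < y + len" "y + len \<le> real r"
    using y len r unfolding y_def[symmetric] by linarith+
  \<comment> \<open>Each guard compares reals and first fails at the rounded value, as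
    \<open>wp_count\<close> requires.\<close>
  have "y < real n + 1 \<longleftrightarrow> n = l" if "n \<le> l" for n using that ly by auto
  moreover have "real n < y + len \<longleftrightarrow> n < r" if "n \<le> r" for n using that ry by auto
  moreover have "l\<^sub>0 \<le> l" using y ly by linarith
  ultimately have "wp B endpoints Q 0 \<sigma>"
    unfolding endpoints_def
    using B i T l0
    by (auto simp: z len Q_def simp flip: y_def
        intro!: wp_count[of _ "''l''" "l\<^sub>0" l] wp_count[of _ "''r''" l r])
  then show ?thesis unfolding Q_def .
qed

lemma layer_count_le_K:
  assumes "1 \<le> k" "k \<le> layers a T"
  shows "layer_count a k \<le> K"
proof -
  have "layer_count a k \<le> length (interval_list a T (layers a T))"
    unfolding length_interval_list using assms by (intro member_le_sum) auto
  also have "\<dots> \<le> K" unfolding K by (intro length_interval_list_le) simp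
  finally show ?thesis .
qed

lemma wp_layer_setup:
  assumes env: "env \<sigma>" and len: "rvars \<sigma> ''len'' = layer_length a T k"
    and p: "rvars \<sigma> ''p'' = (1 / a) ^ (k - 1)" and k: "1 \<le> k" "k \<le> layers a T"
  shows "wp B layer_setup (\<lambda>t \<sigma>'. 2 * ivars \<sigma>' ''c'' - 1 = int (layer_count a k) \<and>
    rvars \<sigma>' ''z'' = layer_shift a T k \<and> t \<le> 20 * layer_count a k + 60) 0 \<sigma>"
proof -
  define Q where "Q = (\<lambda>t (\<sigma>' :: state). 2 * ivars \<sigma>' ''c'' - 1 = int (layer_count a k) \<and>
    rvars \<sigma>' ''z'' = layer_shift a T k \<and> t \<le> 20 * layer_count a k + 60)"
  define c where "c = nat \<lceil>(1 / a) ^ (k - 1)\<rceil>"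
  have c: "\<lceil>(1 / a) ^ (k - 1)\<rceil> = int c" "1 \<le> c"
    using inverse_power_ge_1[of "k - 1"] unfolding c_def by linarith+
  then have c_iff: "real n < (1 / a) ^ (k - 1) \<longleftrightarrow> n < c" for n
    by (metis less_ceiling_iff of_int_of_nat_eq of_nat_less_iff)
  have n: "int (layer_count a k) = 2 * int c - 1" "layer_count a k = 2 * c - 1"
    using layer_count_eq[of k] c by linarith+
  \<comment> \<open>The program keeps no layer index and recognises the first layer, whose shift is
    0, by its count.\<close>
  have "k = 1 \<longleftrightarrow> c = 1"
  proof
    show "k = 1 \<Longrightarrow> c = 1" by (simp add: c_def)
    show "c = 1 \<Longrightarrow> k = 1"
      using one_less_ceiling_inverse_power[of k] c k by linarith
  qed
  with layer_shift_eq[OF k(1)] c have shift: "layer_shift a T k =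
      (if 1 < c then (real T - layer_length a T k) / (2 * real c - 2) else 0)"
    by auto
  have T: "ivars \<sigma> ''T'' = int T" using env by (simp add: env_def)
  have "wp B layer_setup Q 0 \<sigma>"
    unfolding layer_setup_def
    using B layer_count_le_K[OF k] n c
    apply simp
    apply (rule wp_count[of _ "''c''" 0 c])
    subgoal by simp
    subgoal by simp
    subgoal by simp
    subgoal by simp
    subgoal by simp
    subgoal by (simp add: p c_iff[unfolded One_nat_def])
    subgoal by (auto simp: Q_def len T shift)
    done
  then show ?thesis unfolding Q_def .
qed

lemma nth_layer_list:
  assumes "i < layer_count a k"
  shows "layer_list a T k ! i = (nat \<lfloor>real i * layer_shift a T k\<rfloor>,
     nat \<lceil>real i * layer_shift a T k + layer_length a T k\<rceil>)"
  using assms by (simp add: layer_list_def)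

lemma wp_layer_body:
  assumes env: "env \<sigma>" and len: "rvars \<sigma> ''len'' = layer_length a T k"
    and z: "rvars \<sigma> ''z'' = layer_shift a T k" and k: "1 \<le> k" "k \<le> layers a T"
    and i: "ivars \<sigma> ''i'' = int i" "i < layer_count a k"
    and l0: "ivars \<sigma> ''l'' = int l\<^sub>0" "real l\<^sub>0 \<le> real i * layer_shift a T k"
    and lr: "layer_list a T k ! i = (l, r)"
    and Is: "stored \<sigma> (filter good P)" "ivars \<sigma> ''j'' = int (length (filter good P))"
      "length P < K"
  shows "wp B (layer_body sel) (\<lambda>t \<sigma>'. t \<le> 20 * (l - l\<^sub>0) + 120 * (r - l) + 120 \<and>
    l\<^sub>0 \<le> l \<and> ivars \<sigma>' ''l'' = int l \<and> ivars \<sigma>' ''i'' = int (Suc i) \<and>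
    stored \<sigma>' (filter good (P @ [(l, r)])) \<and>
    ivars \<sigma>' ''j'' = int (length (filter good (P @ [(l, r)])))) 0 \<sigma>"
proof -
  define Q where "Q = (\<lambda>t \<sigma>'. t \<le> 20 * (l - l\<^sub>0) + 120 * (r - l) + 120 \<and>
    l\<^sub>0 \<le> l \<and> ivars \<sigma>' ''l'' = int l \<and> ivars \<sigma>' ''i'' = int (Suc i) \<and>
    stored \<sigma>' (filter good (P @ [(l, r)])) \<and>
    ivars \<sigma>' ''j'' = int (length (filter good (P @ [(l, r)]))))"
  from lr nth_layer_list[OF i(2)] have l: "l = nat \<lfloor>real i * layer_shift a T k\<rfloor>"
    and r: "r = nat \<lceil>real i * layer_shift a T k + layer_length a T k\<rceil>" by auto
  note bounds = interval_bounds(1,2)[OF i(2) k(1) l r]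
  have l0l: "l\<^sub>0 \<le> l" using l0(2) l by linarith
  have iK: "i \<le> K" using layer_count_le_K[OF k] i by simp
  have "wp B (layer_body sel) Q 0 \<sigma>"
    unfolding layer_body_def wp_Seq
  proof (rule wp_conseq[OF wp_endpoints[OF i(1) iK z len layer_length_pos l0 l r bounds]], elim conjE)
    fix t1 :: nat and \<sigma>1 :: state
    assume fr: "frame endpoints \<sigma> \<sigma>1" and 1: "ivars \<sigma>1 ''l'' = int l" "ivars \<sigma>1 ''r'' = int r"
      and t1: "t1 \<le> 20 * (l - l\<^sub>0) + 20 * (r - l) + 40"
    have "env \<sigma>1" by (rule env_frame[OF env fr]) simp_all
    moreover have "stored \<sigma>1 (filter good P)" by (rule stored_frame[OF Is(1) fr]) simp_all
    moreover have "ivars \<sigma>1 ''j'' = int (length (filter good P))" using Is(2) by (simp add: frameD[OF fr])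
    ultimately show "wp B (process sel) (wp B (ISet ''i'' (IAdd (IVar ''i'') (IConst 1))) Q) (0 + t1) \<sigma>1"
    proof (rule wp_conseq[OF wp_process[OF _ 1 bounds _ _ Is(3)]], elim conjE)
      fix t2 :: nat and \<sigma>2 :: state
      assume fr2: "frame (process sel) \<sigma>1 \<sigma>2" and 2: "stored \<sigma>2 (filter good (P @ [(l, r)]))"
        "ivars \<sigma>2 ''j'' = int (length (filter good (P @ [(l, r)])))"
        and t2: "t2 \<le> 100 * (r - l) + 70"
      have "ivars \<sigma>2 ''i'' = int i" "ivars \<sigma>2 ''l'' = int l"
        using i 1 by (simp_all add: frameD[OF fr2] frameD[OF fr])
      with 2 t1 t2 l0l iK B bounds
      show "wp B (ISet ''i'' (IAdd (IVar ''i'') (IConst 1))) Q (0 + t1 + t2) \<sigma>2"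
        by (simp add: Q_def stored_def)
    qed
  qed
  then show ?thesis unfolding Q_def .
qed

text \<open>\<open>20 * T\<close> pays for moving the left end through the layer, 120 per unit of
  length for the right end (20) and the scan (100), and 200 per interval for the rest, including the
  count in \<open>layer_setup\<close>.\<close>

definition layer_cost :: "nat \<Rightarrow> nat" where
  "layer_cost k = 20 * T + 120 * total_length (layer_list a T k) + 200 * layer_count a k"

lemma wp_layer:
  assumes env: "env \<sigma>" and len: "rvars \<sigma> ''len'' = layer_length a T k"
    and p: "rvars \<sigma> ''p'' = (1 / a) ^ (k - 1)" and k: "1 \<le> k" "k \<le> layers a T"
    and Is: "stored \<sigma> (filter good P)" "ivars \<sigma> ''j'' = int (length (filter good P))"
      "length P + layer_count a k \<le> K"
  shows "wp B (layer sel) (\<lambda>t \<sigma>'. t \<le> layer_cost k + 100 \<and>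
    stored \<sigma>' (filter good (P @ layer_list a T k)) \<and>
    ivars \<sigma>' ''j'' = int (length (filter good (P @ layer_list a T k)))) 0 \<sigma>"
proof -
  define Q where "Q = (\<lambda>t \<sigma>'. t \<le> layer_cost k + 100 \<and>
    stored \<sigma>' (filter good (P @ layer_list a T k)) \<and>
    ivars \<sigma>' ''j'' = int (length (filter good (P @ layer_list a T k))))"
  define n where "n = layer_count a k"
  define LL where "LL = layer_list a T k"
  have LL: "length LL = n" by (simp add: LL_def n_def)
  define I where "I = (\<lambda>(i, l) \<sigma>'. ivars \<sigma>' ''i'' = int i \<and> i \<le> n \<and> ivars \<sigma>' ''l'' = int l \<and>
    l \<le> T \<and> real l \<le> real i * layer_shift a T k \<and> stored \<sigma>' (filter good (P @ take i LL)) \<and>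
    ivars \<sigma>' ''j'' = int (length (filter good (P @ take i LL))))"
  \<comment> \<open>The ghost pair consists of the next index and the current left end.
    \<open>T - l\<close> saves for the increments still to come, the middle term for the lengths of
    the intervals still to be generated.\<close>
  define \<Phi> where "\<Phi> = (\<lambda>(i, l). 20 * (T - l) + 120 * total_length (drop i LL) + 150 * (n - i))"
  have nK: "n \<le> K" unfolding n_def by (rule layer_count_le_K[OF k])
  have "wp B (layer sel) Q 0 \<sigma>"
    unfolding layer_def wp_Seq
  proof (rule wp_conseq[OF wp_layer_setup[OF env len p k]], elim conjE)
    fix t1 :: nat and \<sigma>1 :: state
    assume fr: "frame layer_setup \<sigma> \<sigma>1" and c: "2 * ivars \<sigma>1 ''c'' - 1 = int (layer_count a k)"
      and z: "rvars \<sigma>1 ''z'' = layer_shift a T k" and t1: "t1 \<le> 20 * layer_count a k + 60"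
    have env1: "env \<sigma>1" by (rule env_frame[OF env fr]) simp_all
    have stored1: "stored \<sigma>1 (filter good P)" by (rule stored_frame[OF Is(1) fr]) simp_all
    have j1: "ivars \<sigma>1 ''j'' = int (length (filter good P))" using Is(2) by (simp add: frameD[OF fr])
    have len1: "rvars \<sigma>1 ''len'' = layer_length a T k" using len by (simp add: frameD[OF fr])
    define \<sigma>2 where "\<sigma>2 = \<sigma>1\<lparr>ivars := (ivars \<sigma>1)(''i'' := 0, ''l'' := 0)\<rparr>"
    \<comment> \<open>The four \<open>Suc\<close> are the time of the two assignments before the
      loop, in the form in which symbolic execution leaves it. Such chains at later loops have the
      same origin.\<close>
    have "wp B (While (ILess (IVar ''i'') (ISub (IMul (IConst 2) (IVar ''c'')) (IConst 1))) (layer_body sel))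
        Q (Suc (Suc (Suc (Suc t1)))) \<sigma>2"
    proof (rule wp_While[where I = I and g = "(0, 0)" and \<Phi> = \<Phi>])
      show "I (0, 0) \<sigma>2"
        using stored1 j1 by (simp add: I_def \<sigma>2_def stored_def)
    next
      fix g and \<sigma>3 :: state
      assume I: "I g \<sigma>3" and fr3: "frame (layer_body sel) \<sigma>2 \<sigma>3"
      obtain i l\<^sub>0 where g: "g = (i, l\<^sub>0)" by (cases g)
      note I = I[unfolded I_def g prod.case]
      have c3: "2 * ivars \<sigma>3 ''c'' - 1 = int n" using c by (simp add: frameD[OF fr3] \<sigma>2_def n_def)
      with I nK B show "bsafe B \<sigma>3 (ILess (IVar ''i'') (ISub (IMul (IConst 2) (IVar ''c'')) (IConst 1)))"
        by simp
      assume "bval \<sigma>3 (ILess (IVar ''i'') (ISub (IMul (IConst 2) (IVar ''c'')) (IConst 1)))"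
      with c3 I have i: "i < n" by simp
      obtain l r where lr: "LL ! i = (l, r)" by (cases "LL ! i")
      then have in_LL: "(l, r) \<in> set LL" using i LL by (metis nth_mem)
      note bounds = layer_list_bounds(1,2)[OF in_LL[unfolded LL_def] k(1)]
      have env3: "env \<sigma>3"
        by (rule env_frame[OF _ fr3]) (use env1 in \<open>simp_all add: env_def \<sigma>2_def\<close>)
      have len3: "rvars \<sigma>3 ''len'' = layer_length a T k" "rvars \<sigma>3 ''z'' = layer_shift a T k"
        using len1 z by (simp_all add: frameD[OF fr3] \<sigma>2_def)
      have PK: "length (P @ take i LL) < K" using Is(3) i LL by (simp add: n_def)
      have take: "P @ take (Suc i) LL = (P @ take i LL) @ [(l, r)]"
        using i LL lr by (simp add: take_Suc_conv_app_nth)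
      have drop: "total_length (drop i LL) = (r - l) + total_length (drop (Suc i) LL)"
        using i LL lr by (simp add: Cons_nth_drop_Suc[symmetric] total_length_def)
      have l_eq: "l = nat \<lfloor>real i * layer_shift a T k\<rfloor>"
        using lr i nth_layer_list[of i k] by (simp add: LL_def n_def)
      \<comment> \<open>The next interval counts on from \<open>l\<close>. It cannot start too far
        right, since the shift is nonnegative.\<close>
      have l_le: "real l \<le> real (Suc i) * layer_shift a T k"
      proof -
        have "real l \<le> real i * layer_shift a T k"
          using l_eq layer_shift_nonneg[of k] by (simp add: of_nat_floor)
        also have "\<dots> \<le> real (Suc i) * layer_shift a T k"
          using layer_shift_nonneg[of k] by (intro mult_right_mono) auto
        finally show ?thesis .
      qed
      from I have "wp B (layer_body sel) (\<lambda>t \<sigma>'. t \<le> 20 * (l - l\<^sub>0) + 120 * (r - l) + 120 \<and>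
        l\<^sub>0 \<le> l \<and> ivars \<sigma>' ''l'' = int l \<and> ivars \<sigma>' ''i'' = int (Suc i) \<and>
        stored \<sigma>' (filter good ((P @ take i LL) @ [(l, r)])) \<and>
        ivars \<sigma>' ''j'' = int (length (filter good ((P @ take i LL) @ [(l, r)])))) 0 \<sigma>3"
        using i lr by (intro wp_layer_body[OF env3 len3 k _ _ _ _ _ _ _ PK]) (auto simp: n_def LL_def)
      then show "wp B (layer_body sel) (\<lambda>t \<sigma>'. \<exists>g'. I g' \<sigma>' \<and>
          1 + bcost (ILess (IVar ''i'') (ISub (IMul (IConst 2) (IVar ''c'')) (IConst 1))) + t + \<Phi> g' \<le> \<Phi> g) 0 \<sigma>3"
      proof (rule wp_conseq, elim conjE)
        fix t4 :: nat and \<sigma>4 :: state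
        assume t4: "t4 \<le> 20 * (l - l\<^sub>0) + 120 * (r - l) + 120" and "l\<^sub>0 \<le> l"
          and 4: "ivars \<sigma>4 ''l'' = int l" "ivars \<sigma>4 ''i'' = int (Suc i)"
          "stored \<sigma>4 (filter good ((P @ take i LL) @ [(l, r)]))"
          "ivars \<sigma>4 ''j'' = int (length (filter good ((P @ take i LL) @ [(l, r)])))"
        have "I (Suc i, l) \<sigma>4"
          using 4 i bounds l_le by (simp only: I_def prod.case take) auto
        moreover have "20 + t4 + \<Phi> (Suc i, l) \<le> \<Phi> g"
        proof -
          have "n - i = Suc (n - Suc i)" using i by simp
          with t4 \<open>l\<^sub>0 \<le> l\<close> bounds show ?thesis
            by (simp add: \<Phi>_def g drop)
        qed
        ultimately show "\<exists>g'. I g' \<sigma>4 \<and> 1 +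
            bcost (ILess (IVar ''i'') (ISub (IMul (IConst 2) (IVar ''c'')) (IConst 1))) + (0 + t4) + \<Phi> g' \<le> \<Phi> g"
          by (intro exI[of _ "(Suc i, l)"]) simp
      qed
    next
      fix g t' and \<sigma>3 :: state
      assume I: "I g \<sigma>3" and fr3: "frame (layer_body sel) \<sigma>2 \<sigma>3"
        and nb: "\<not> bval \<sigma>3 (ILess (IVar ''i'') (ISub (IMul (IConst 2) (IVar ''c'')) (IConst 1)))"
        and t': "t' + \<Phi> g \<le> Suc (Suc (Suc (Suc t1))) + \<Phi> (0, 0) + 1 + bcost (ILess (IVar ''i'') (ISub (IMul (IConst 2) (IVar ''c'')) (IConst 1)))"
      obtain i l\<^sub>0 where g: "g = (i, l\<^sub>0)" by (cases g)
      note I = I[unfolded I_def g prod.case]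
      have "2 * ivars \<sigma>3 ''c'' - 1 = int n" using c by (simp add: frameD[OF fr3] \<sigma>2_def n_def)
      with I nb have "i = n" by simp
      with I LL have "stored \<sigma>3 (filter good (P @ LL))" "ivars \<sigma>3 ''j'' = int (length (filter good (P @ LL)))"
        by auto
      moreover have "t' \<le> layer_cost k + 100"
        using t' t1 by (simp add: \<Phi>_def layer_cost_def LL_def n_def)
      ultimately show "Q t' \<sigma>3" by (simp add: Q_def LL_def)
    qed
    then show "wp B (ISet ''i'' (IConst 0)) (wp B (ISet ''l'' (IConst 0))
        (wp B (While (ILess (IVar ''i'') (ISub (IMul (IConst 2) (IVar ''c'')) (IConst 1))) (layer_body sel)) Q))
        (0 + t1) \<sigma>1"
      using B by (simp add: \<sigma>2_def)
  qed
  then show ?thesis unfolding Q_def .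
qed

definition generate_cost :: nat where
  "generate_cost = (\<Sum>k=1..layers a T. layer_cost k + 120) + 20"

lemma wp_generate:
  assumes env: "env \<sigma>"
  shows "wp B (generate sel) (\<lambda>t \<sigma>'. t \<le> generate_cost \<and>
    stored \<sigma>' (filter good (interval_list a T (layers a T))) \<and>
    ivars \<sigma>' ''j'' = int (length (filter good (interval_list a T (layers a T))))) 0 \<sigma>"
proof -
  define Q where "Q = (\<lambda>t \<sigma>'. t \<le> generate_cost \<and>
    stored \<sigma>' (filter good (interval_list a T (layers a T))) \<and>
    ivars \<sigma>' ''j'' = int (length (filter good (interval_list a T (layers a T)))))"
  \<comment> \<open>\<open>k\<close> layers are complete, so \<open>len\<close> and \<open>p\<close>
    already belong to layer \<open>Suc k\<close>.\<close>
  define I where "I = (\<lambda>k \<sigma>'. k \<le> layers a T \<and> rvars \<sigma>' ''len'' = layer_length a T (Suc k) \<and>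
    rvars \<sigma>' ''p'' = (1 / a) ^ k \<and> stored \<sigma>' (filter good (interval_list a T k)) \<and>
    ivars \<sigma>' ''j'' = int (length (filter good (interval_list a T k))))"
  define \<Phi> where "\<Phi> = (\<lambda>k. \<Sum>k'\<in>{k<..layers a T}. layer_cost k' + 120)"
  let ?b = "RLess (RInt (IConst 1)) (RVar ''len'')"
  define \<sigma>1 where "\<sigma>1 = \<sigma>\<lparr>ivars := (ivars \<sigma>)(''j'' := 0),
    rvars := (rvars \<sigma>)(''len'' := real T, ''p'' := 1)\<rparr>"
  have T: "ivars \<sigma> ''T'' = int T" using env by (simp add: env_def)
  have env1: "env \<sigma>1" using env by (simp add: env_def \<sigma>1_def)
  have "wp B (While ?b (generate_body sel)) Q (Suc (Suc (Suc (Suc (Suc (Suc (Suc (Suc 0)))))))) \<sigma>1"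
  proof (rule wp_While[where I = I and g = 0 and \<Phi> = \<Phi>])
    show "I 0 \<sigma>1"
      by (simp add: I_def \<sigma>1_def layer_length_def stored_def)
  next
    fix k and \<sigma>2 :: state
    assume I: "I k \<sigma>2" and fr: "frame (generate_body sel) \<sigma>1 \<sigma>2"
    show "bsafe B \<sigma>2 ?b" using B by simp
    assume "bval \<sigma>2 ?b"
    with I have k: "k < layers a T" by (simp add: I_def less_layers_iff)
    have env2: "env \<sigma>2" by (rule env_frame[OF env1 fr]) simp_all
    \<comment> \<open>The arrays have room for the next layer even if all its intervals are over the
      threshold.\<close>
    have "length (interval_list a T k) + layer_count a (Suc k) = length (interval_list a T (Suc k))"
      by (simp add: interval_list_Suc)
    also have "\<dots> \<le> K" unfolding K using k by (intro length_interval_list_le) simp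
    finally have "wp B (layer sel) (\<lambda>t \<sigma>'. t \<le> layer_cost (Suc k) + 100 \<and>
      stored \<sigma>' (filter good (interval_list a T k @ layer_list a T (Suc k))) \<and>
      ivars \<sigma>' ''j'' = int (length (filter good (interval_list a T k @ layer_list a T (Suc k))))) 0 \<sigma>2"
      using I k by (intro wp_layer[OF env2]) (auto simp: I_def)
    then show "wp B (generate_body sel) (\<lambda>t \<sigma>'. \<exists>k'. I k' \<sigma>' \<and> 1 + bcost ?b + t + \<Phi> k' \<le> \<Phi> k) 0 \<sigma>2"
      unfolding generate_body_def wp_Seq interval_list_Suc[symmetric]
    proof (rule wp_conseq, elim conjE)
      fix t3 and \<sigma>3 :: state
      assume t3: "t3 \<le> layer_cost (Suc k) + 100" and
        3: "stored \<sigma>3 (filter good (interval_list a T (Suc k)))"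
        "ivars \<sigma>3 ''j'' = int (length (filter good (interval_list a T (Suc k))))"
        and fr3: "frame (layer sel) \<sigma>2 \<sigma>3"
      have "{k<..layers a T} = insert (Suc k) {Suc k<..layers a T}" using k by auto
      then have \<Phi>: "\<Phi> k = layer_cost (Suc k) + 120 + \<Phi> (Suc k)" by (simp add: \<Phi>_def)
      have "rvars \<sigma>3 ''len'' = layer_length a T (Suc k)" "rvars \<sigma>3 ''p'' = (1 / a) ^ k"
        "rvars \<sigma>3 ''a'' = a"
        using I env2 by (simp_all add: frameD[OF fr3] I_def env_def)
      then show "wp B (RSet ''len'' (RMul (RVar ''len'') (RVar ''a'')))
         (wp B (RSet ''p'' (RDiv (RVar ''p'') (RVar ''a'')))
           (\<lambda>t \<sigma>'. \<exists>k'. I k' \<sigma>' \<and> 1 + bcost ?b + t + \<Phi> k' \<le> \<Phi> k)) (0 + t3) \<sigma>3"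
        using 3 t3 k a_pos layer_length_Suc[of "Suc k"]
        by (auto simp: I_def \<Phi> stored_def intro!: exI[of _ "Suc k"])
    qed
  next
    fix k t' and \<sigma>2 :: state
    assume I: "I k \<sigma>2" and "\<not> bval \<sigma>2 ?b" and t': "t' + \<Phi> k \<le> (Suc (Suc (Suc (Suc (Suc (Suc (Suc (Suc 0)))))))) + \<Phi> 0 + 1 + bcost ?b"
    then have "k = layers a T" by (auto simp: I_def less_layers_iff[symmetric])
    moreover have "{0<..layers a T} = {1..layers a T}" by auto
    ultimately show "Q t' \<sigma>2"
      using I t' by (simp add: Q_def I_def \<Phi>_def generate_cost_def)
  qed
  then have "wp B (generate sel) Q 0 \<sigma>"
    using B by (simp add: generate_def T \<sigma>1_def)
  then show ?thesis unfolding Q_def .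
qed

end

section \<open>Selecting the change points\<close>

definition insert_body :: com where
  "insert_body =
     set_leaf (IAdd (IVar ''j'') (IConst 1)) ;; ISet ''j'' (IAdd (IVar ''j'') (IConst 1))"

definition insert_all :: com where
  "insert_all =
     ISet ''N'' (IVar ''j'') ;; ISet ''j'' (IConst 0) ;;
     While (ILess (IVar ''j'') (IVar ''N'')) insert_body"

definition search_body :: com where
  "search_body =
     If (ILess (IConst 0) (IArr ''D'' (IVar ''s''))) (ISet ''b'' (IConst 1)) Skip ;;
     ISet ''s'' (IAdd (IVar ''s'') (IConst 1))"

definition search :: com where
  "search =
     ISet ''b'' (IConst 0) ;; ISet ''s'' (IAdd (IVar ''l'') (IConst 1)) ;;
     While (Not (ILess (IVar ''r'') (IVar ''s''))) search_body"

definition declare_cp :: com where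
  "declare_cp =
     If (ILess (IVar ''b'') (IConst 1))
       (IStore ''D'' (IArr ''S'' (IVar ''j'')) (IConst 1) ;;
        IStore ''out'' (IVar ''n'') (IArr ''S'' (IVar ''j'')) ;;
        ISet ''n'' (IAdd (IVar ''n'') (IConst 1))) Skip"

definition select_body :: com where
  "select_body =
     ISet ''j'' (ISub (IArr ''W'' (IConst 1)) (IConst 1)) ;;
     ISet ''l'' (IArr ''L'' (IVar ''j'')) ;;
     ISet ''r'' (IArr ''R'' (IVar ''j'')) ;;
     search ;; declare_cp ;; set_leaf (IConst 0)"

definition select_all :: com where
  "select_all =
     ISet ''n'' (IConst 0) ;; While (ILess (IConst 0) (IArr ''W'' (IConst 1))) select_body"

section \<open>Frames of the selecting commands\<close>

lemma mods_insert_body [simp]: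
  "imods insert_body = {''u'', ''w'', ''v'', ''j''}" "rmods insert_body = {}"
  "iamods insert_body = {''W''}" "ramods insert_body = {}" "noalloc insert_body"
  by (auto simp: insert_body_def)

lemma mods_insert_all [simp]:
  "imods insert_all = {''u'', ''w'', ''v'', ''j'', ''N''}" "rmods insert_all = {}"
  "iamods insert_all = {''W''}" "ramods insert_all = {}" "noalloc insert_all"
  by (auto simp: insert_all_def)

lemma mods_search_body [simp]:
  "imods search_body = {''b'', ''s''}" "rmods search_body = {}"
  "iamods search_body = {}" "ramods search_body = {}" "noalloc search_body"
  by (auto simp: search_body_def)

lemma mods_search [simp]:
  "imods search = {''b'', ''s''}" "rmods search = {}"
  "iamods search = {}" "ramods search = {}" "noalloc search"
  by (auto simp: search_def)

lemma mods_declare_cp [simp]: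
  "imods declare_cp = {''n''}" "rmods declare_cp = {}"
  "iamods declare_cp = {''D'', ''out''}" "ramods declare_cp = {}" "noalloc declare_cp"
  by (auto simp: declare_cp_def)

lemma mods_select_body [simp]:
  "imods select_body = {''u'', ''w'', ''v'', ''j'', ''l'', ''r'', ''b'', ''s'', ''n''}"
  "rmods select_body = {}" "iamods select_body = {''W'', ''D'', ''out''}"
  "ramods select_body = {}" "noalloc select_body"
  by (auto simp: select_body_def)

lemma mods_select_all [simp]:
  "imods select_all = {''u'', ''w'', ''v'', ''j'', ''l'', ''r'', ''b'', ''s'', ''n''}"
  "rmods select_all = {}" "iamods select_all = {''W'', ''D'', ''out''}"
  "ramods select_all = {}" "noalloc select_all"
  by (auto simp: select_all_def)

section \<open>Lazy deletion as a run of the selection method\<close>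

context segmentation
begin

definition candidates :: "interval list" where
  "candidates = filter good (interval_list a T (layers a T))"

lemma length_interval_list_K: "length (interval_list a T (layers a T)) \<le> K"
  unfolding K by (rule length_interval_list_le) simp

lemma length_candidates: "length candidates \<le> K"
  unfolding candidates_def using length_interval_list_K length_filter_le le_trans by blast

lemma set_candidates: "set candidates = {I \<in> seeded_intervals a m T. \<kappa> < max_gain Min x I}"
  by (auto simp: candidates_def seeded_intervals_def set_interval_list good_def)

lemma seeded_interval_bounds:
  assumes "(l, r) \<in> seeded_intervals a m T"
  shows "l + m \<le> r" "r \<le> T"
  using assms interval_list_bounds[of l r "layers a T"]
  by (auto simp: seeded_intervals_def set_interval_list)

text \<open>The set of splits is finite and nonempty, so a maximiser exists and \<open>Min\<close>
  picks one. For kept intervals, \<open>m \<ge> 2\<close> provides the hypothesis.\<close>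

lemma best_split_bounds:
  assumes "Suc l < r"
  shows "l < best_split Min x (l, r)" "best_split Min x (l, r) < r"
    "max_gain Min x (l, r) = sqrt (squared_gain x l r (best_split Min x (l, r)))"
proof -
  let ?f = "\<lambda>s. \<bar>cusum x l r s\<bar>"
  have fin: "finite {l + 1..r - 1}" and ne: "{l + 1..r - 1} \<noteq> {}" using assms by auto
  then have "Max (?f ` {l + 1..r - 1}) \<in> ?f ` {l + 1..r - 1}"
    by (intro Max_in) auto
  then obtain s where s: "s \<in> {l + 1..r - 1}" "Max (?f ` {l + 1..r - 1}) = ?f s"
    by (rule imageE)
  have "?f t \<le> ?f s" if "t \<in> {l + 1..r - 1}" for t
    unfolding s(2)[symmetric] using fin that by (intro Max_ge) auto
  with s(1) have "s \<in> best_splits x (l, r)"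
    by (simp add: best_splits_def is_arg_max_def not_less)
  moreover have sub: "best_splits x (l, r) \<subseteq> {l + 1..r - 1}"
    by (auto simp: best_splits_def is_arg_max_def)
  ultimately have "best_split Min x (l, r) \<in> {l + 1..r - 1}"
    unfolding best_split_def using fin Min_in finite_subset by blast
  then show *: "l < best_split Min x (l, r)" "best_split Min x (l, r) < r" by auto
  then show "max_gain Min x (l, r) = sqrt (squared_gain x l r (best_split Min x (l, r)))"
    by (simp add: max_gain_def abs_cusum)
qed

lemma split_in_interval:
  assumes "I \<in> seeded_intervals a m T"
  shows "fst I < best_split Min x I" "best_split Min x I < snd I"
  using assms m best_split_bounds[of "fst I" "snd I"] seeded_interval_bounds[of "fst I" "snd I"] by auto

text \<open>The square root is strictly increasing, so comparing squared gains is comparing gains;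
  the negation makes the largest gain the smallest key.\<close>

lemma key_le_iff:
  assumes "I \<in> seeded_intervals a m T" "J \<in> seeded_intervals a m T"
  shows "key I \<le> key J \<longleftrightarrow> (case sel of Greedy \<Rightarrow> max_gain Min x J \<le> max_gain Min x I
    | Narrowest_Over_Threshold \<Rightarrow> snd I - fst I \<le> snd J - fst J)"
  using assms m best_split_bounds(3)[of "fst I" "snd I"] best_split_bounds(3)[of "fst J" "snd J"]
    seeded_interval_bounds[of "fst I" "snd I"] seeded_interval_bounds[of "fst J" "snd J"]
  by (auto simp: key_def split: selection.split)

abbreviation selects_from :: "interval set \<Rightarrow> nat list \<Rightarrow> bool" where
  "selects_from \<equiv> selects sel \<kappa> (max_gain Min x) (best_split Min x)"

text \<open>Closed form of the successive deletions. It can be tested for one interval without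
  maintaining the set.\<close>

definition remaining :: "nat list \<Rightarrow> interval set" where
  "remaining cps = {I \<in> seeded_intervals a m T. \<forall>s\<in>set cps. s \<notin> {fst I<..snd I}}"

lemma remaining_snoc: "remaining (cps @ [s]) = delete_containing s (remaining cps)"
  by (auto simp: remaining_def delete_containing_def)

text \<open>
  After the change points \<open>cps\<close> have been declared, every remaining interval over the threshold has
  an index in \<open>A\<close>, and \<open>cps\<close> can be completed to a run of the selection.
\<close>

definition selection_invariant :: "nat list \<Rightarrow> nat set \<Rightarrow> bool" where
  "selection_invariant cps A \<longleftrightarrow> A \<subseteq> {..<length candidates} \<and>
     (\<forall>I\<in>remaining cps. \<kappa> < max_gain Min x I \<longrightarrow> (\<exists>i\<in>A. candidates ! i = I)) \<and>
     (\<forall>cps'. selects_from (remaining cps) cps' \<longrightarrow>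
        selects_from (seeded_intervals a m T) (cps @ cps'))"

lemma selection_invariant_init: "selection_invariant [] {..<length candidates}"
proof -
  have "\<exists>i<length candidates. candidates ! i = I"
    if "I \<in> seeded_intervals a m T" "\<kappa> < max_gain Min x I" for I
    using that set_candidates in_set_conv_nth[of I candidates] by auto
  then show ?thesis by (auto simp: selection_invariant_def remaining_def)
qed

text \<open>Index \<open>j\<close> can stand only for the interval \<open>candidates ! j\<close>,
  and the invariant asks for indices of remaining intervals only.\<close>

lemma selection_invariant_skip:
  assumes "selection_invariant cps A" "candidates ! j \<notin> remaining cps"
  shows "selection_invariant cps (A - {j})"
  using assms unfolding selection_invariant_def by blast

text \<open>Every remaining interval over the threshold has an index in \<open>A\<close>, so a key
  minimal over \<open>A\<close> is minimal among all of them. Indices of deleted intervals in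
  \<open>A\<close> do no harm: they only add competitors that the chosen one also beats.\<close>

lemma selection_invariant_declare:
  assumes inv: "selection_invariant cps A" and j: "j \<in> A" "candidates ! j \<in> remaining cps"
    and min: "\<And>i. i \<in> A \<Longrightarrow> key (candidates ! j) \<le> key (candidates ! i)"
  shows "selection_invariant (cps @ [best_split Min x (candidates ! j)]) (A - {j})"
proof -
  define I where "I = candidates ! j"
  have I: "I \<in> seeded_intervals a m T" "\<kappa> < max_gain Min x I"
    using inv j set_candidates nth_mem[of j candidates] by (auto simp: selection_invariant_def I_def)
  have *: "key I \<le> key J" if "J \<in> remaining cps" "\<kappa> < max_gain Min x J" for J
    using that inv min unfolding selection_invariant_def I_def by metis
  have rem: "J \<in> remaining cps \<Longrightarrow> J \<in> seeded_intervals a m T" for J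
    by (simp add: remaining_def)
  have "selectable sel \<kappa> (max_gain Min x) (remaining cps) I"
  proof (cases sel)
    case Greedy
    \<comment> \<open>Intervals that do not exceed the threshold have no index, but they lose as
      well, since the gain of \<open>I\<close> exceeds \<open>\<kappa>\<close>.\<close>
    have "\<not> max_gain Min x I < max_gain Min x J" if "J \<in> remaining cps" for J
      using *[OF that] I key_le_iff[OF I(1) rem[OF that]] by (auto simp: Greedy)
    then show ?thesis
      using I j by (auto simp: selectable_def Greedy is_arg_max_def I_def)
  next
    case Narrowest_Over_Threshold
    have "snd I - fst I \<le> snd J - fst J" if "J \<in> remaining cps" "\<kappa> < max_gain Min x J" for J
      using *[OF that] key_le_iff[OF I(1) rem[OF that(1)]] by (simp add: Narrowest_Over_Threshold)
    then show ?thesis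
      using I j by (fastforce simp: selectable_def Narrowest_Over_Threshold is_arg_min_def I_def
          case_prod_unfold not_less)
  qed
  then have "selects_from (seeded_intervals a m T) ((cps @ [best_split Min x I]) @ cps')"
    if "selects_from (remaining (cps @ [best_split Min x I])) cps'" for cps'
    using that inv unfolding remaining_snoc selection_invariant_def
    by (auto dest: selects.declare_split)
  \<comment> \<open>The best split lies in \<open>I\<close>, so the declaration deletes
    \<open>I\<close> and index \<open>j\<close> may be dropped. Other copies of \<open>I\<close>
    become outdated and are skipped later.\<close>
  moreover have "I \<notin> remaining (cps @ [best_split Min x I])"
    using split_in_interval[OF I(1)] by (auto simp: remaining_def)
  moreover have "remaining (cps @ [best_split Min x I]) \<subseteq> remaining cps"
    by (auto simp: remaining_def)
  ultimately show ?thesis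
    using inv unfolding selection_invariant_def I_def by blast
qed

text \<open>Without indices no remaining interval exceeds the threshold, so the empty run completes
  \<open>cps\<close>.\<close>

lemma selection_invariant_empty:
  assumes "selection_invariant cps {}"
  shows "seeded_binary_segmentation Min a m sel \<kappa> T x cps"
proof -
  have "selects_from (remaining cps) []"
    using assms by (intro selects.stop) (auto simp: selection_invariant_def)
  with assms show ?thesis
    unfolding selection_invariant_def seeded_binary_segmentation_def by fastforce
qed

section \<open>The loops that fill the tree and empty it\<close>

lemma wp_insert_all:
  assumes env: "env \<sigma>" and W: "iarrs \<sigma> ''W'' = replicate (2 * K) 0"
    and j: "ivars \<sigma> ''j'' = int N" "N \<le> K"
  shows "wp B insert_all (\<lambda>t \<sigma>'. t \<le> (100 * floorlog 2 (2 * K) + 60) * N + 20 \<and>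
    tree_ok (rarrs \<sigma> ''G'') K 0 (iarrs \<sigma>' ''W'') \<and> live K (iarrs \<sigma>' ''W'') = {..<N}) 0 \<sigma>"
proof -
  define Q where "Q = (\<lambda>t (\<sigma>' :: state). t \<le> (100 * floorlog 2 (2 * K) + 60) * N + 20 \<and>
    tree_ok (rarrs \<sigma> ''G'') K 0 (iarrs \<sigma>' ''W'') \<and> live K (iarrs \<sigma>' ''W'') = {..<N})"
  define I where "I = (\<lambda>j (\<sigma>' :: state). ivars \<sigma>' ''j'' = int j \<and> j \<le> N \<and>
    tree_ok (rarrs \<sigma> ''G'') K 0 (iarrs \<sigma>' ''W'') \<and> live K (iarrs \<sigma>' ''W'') = {..<j})"
  define C where "C = 100 * floorlog 2 (2 * K) + 60"
  let ?b = "ILess (IVar ''j'') (IVar ''N'')"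
  define \<sigma>1 where "\<sigma>1 = \<sigma>\<lparr>ivars := (ivars \<sigma>)(''N'' := int N, ''j'' := 0)\<rparr>"
  have env1: "env \<sigma>1" using env by (simp add: env_def \<sigma>1_def)
  have "wp B (While ?b insert_body) Q (Suc (Suc (Suc (Suc 0)))) \<sigma>1"
  proof (rule wp_While[where I = I and g = 0 and \<Phi> = "\<lambda>j. C * (N - j)"])
    show "I 0 \<sigma>1"
      by (simp add: I_def \<sigma>1_def W tree_ok_replicate live_replicate)
  next
    fix j and \<sigma>2 :: state
    assume I: "I j \<sigma>2" and fr: "frame insert_body \<sigma>1 \<sigma>2"
    have N2: "ivars \<sigma>2 ''N'' = int N" by (simp add: frameD[OF fr] \<sigma>1_def)
    with I j B show "bsafe B \<sigma>2 ?b" by (simp add: I_def)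
    assume "bval \<sigma>2 ?b"
    with I N2 have jN: "j < N" by (simp add: I_def)
    then have C: "C * (N - j) = C + C * (N - Suc j)"
      by (simp flip: mult_Suc_right add: Suc_diff_Suc)
    have env2: "env \<sigma>2" by (rule env_frame[OF env1 fr]) simp_all
    have G2: "rarrs \<sigma>2 ''G'' = rarrs \<sigma> ''G''" by (simp add: frameD[OF fr] \<sigma>1_def)
    have "wp B (set_leaf (IAdd (IVar ''j'') (IConst 1))) (\<lambda>t \<sigma>'. tree_ok (rarrs \<sigma>2 ''G'') K 0 (iarrs \<sigma>' ''W'') \<and>
      live K (iarrs \<sigma>' ''W'') = (if int j + 1 = 0 then live K (iarrs \<sigma>2 ''W'') - {j}
        else insert j (live K (iarrs \<sigma>2 ''W''))) \<and>
      t \<le> 100 * floorlog 2 (2 * K) + 30 + icost (IAdd (IVar ''j'') (IConst 1))) 0 \<sigma>2"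
      using I env2 jN j B G2 by (intro wp_set_leaf) (auto simp: I_def env_def)
    then show "wp B insert_body (\<lambda>t \<sigma>'. \<exists>j'. I j' \<sigma>' \<and> 1 + bcost ?b + t + C * (N - j') \<le> C * (N - j)) 0 \<sigma>2"
      unfolding insert_body_def wp_Seq
    proof (rule wp_conseq, elim conjE)
      fix t3 and \<sigma>3 :: state
      assume 3: "tree_ok (rarrs \<sigma>2 ''G'') K 0 (iarrs \<sigma>3 ''W'')"
        "live K (iarrs \<sigma>3 ''W'') = (if int j + 1 = 0 then live K (iarrs \<sigma>2 ''W'') - {j}
          else insert j (live K (iarrs \<sigma>2 ''W'')))"
        "t3 \<le> 100 * floorlog 2 (2 * K) + 30 + icost (IAdd (IVar ''j'') (IConst 1))"
        and fr3: "frame (set_leaf (IAdd (IVar ''j'') (IConst 1))) \<sigma>2 \<sigma>3"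
      have "ivars \<sigma>3 ''j'' = int j" using I by (simp add: frameD[OF fr3] I_def)
      moreover have "live K (iarrs \<sigma>3 ''W'') = {..<Suc j}"
        using 3(2) I by (auto simp: I_def)
      ultimately have "I (Suc j) (\<sigma>3\<lparr>ivars := (ivars \<sigma>3)(''j'' := ivars \<sigma>3 ''j'' + 1)\<rparr>)"
        using 3(1) jN G2 by (simp add: I_def)
      moreover have "10 + t3 + C * (N - Suc j) \<le> C * (N - j)"
        using 3(3) unfolding C by (simp add: C_def)
      ultimately show "wp B (ISet ''j'' (IAdd (IVar ''j'') (IConst 1)))
          (\<lambda>t \<sigma>'. \<exists>j'. I j' \<sigma>' \<and> 1 + bcost ?b + t + C * (N - j') \<le> C * (N - j)) (0 + t3) \<sigma>3"
        using jN j B \<open>ivars \<sigma>3 ''j'' = int j\<close>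
        by (intro wp_ISet[THEN iffD2] conjI exI[of _ "Suc j"]) simp_all
    qed
  next
    fix j t' and \<sigma>2 :: state
    assume I: "I j \<sigma>2" and fr: "frame insert_body \<sigma>1 \<sigma>2" and "\<not> bval \<sigma>2 ?b"
      and t': "t' + C * (N - j) \<le> Suc (Suc (Suc (Suc 0))) + C * (N - 0) + 1 + bcost ?b"
    moreover have "ivars \<sigma>2 ''N'' = int N" by (simp add: frameD[OF fr] \<sigma>1_def)
    ultimately show "Q t' \<sigma>2"
      by (auto simp: Q_def I_def C_def)
  qed
  then have "wp B insert_all Q 0 \<sigma>"
    using B j by (simp add: insert_all_def \<sigma>1_def)
  then show ?thesis unfolding Q_def .
qed

definition marks :: "state \<Rightarrow> nat list \<Rightarrow> bool" where
  "marks \<sigma> cps \<longleftrightarrow> (\<forall>s\<le>T. iarrs \<sigma> ''D'' ! s = (if s \<in> set cps then 1 else 0))"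

lemma wp_search:
  assumes env: "env \<sigma>" and lr: "ivars \<sigma> ''l'' = int l" "ivars \<sigma> ''r'' = int r"
    and bounds: "l < r" "r \<le> T" and D: "marks \<sigma> cps"
  shows "wp B search (\<lambda>t \<sigma>'. t \<le> 30 * (r - l) + 20 \<and>
    ivars \<sigma>' ''b'' = (if \<exists>s\<in>set cps. s \<in> {l<..r} then 1 else 0)) 0 \<sigma>"
proof -
  define Q where "Q = (\<lambda>t (\<sigma>' :: state). t \<le> 30 * (r - l) + 20 \<and>
    ivars \<sigma>' ''b'' = (if \<exists>s\<in>set cps. s \<in> {l<..r} then 1 else 0))"
  \<comment> \<open>The flag before position \<open>s\<close> is tested. The bound is strict, so the
    answer for the whole interval is \<open>F (Suc r)\<close>.\<close>
  define F where "F = (\<lambda>s. \<exists>s'\<in>set cps. s' \<in> {l<..<s})"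
  have F_Suc: "F (Suc s) \<longleftrightarrow> s \<in> set cps \<or> F s" if "l < s" for s
    using that by (auto simp: F_def less_Suc_eq)
  have F_r: "F (Suc r) \<longleftrightarrow> (\<exists>s\<in>set cps. s \<in> {l<..r})"
    by (auto simp: F_def less_Suc_eq_le)
  define I where "I = (\<lambda>s (\<sigma>' :: state). ivars \<sigma>' ''s'' = int s \<and> l < s \<and> s \<le> Suc r \<and>
    ivars \<sigma>' ''b'' = (if F s then 1 else 0))"
  let ?b = "Not (ILess (IVar ''r'') (IVar ''s''))"
  define \<sigma>1 where "\<sigma>1 = \<sigma>\<lparr>ivars := (ivars \<sigma>)(''b'' := 0, ''s'' := int l + 1)\<rparr>"
  have lenD: "length (iarrs \<sigma> ''D'') = Suc T" using env by (simp add: env_def)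
  have "wp B (While ?b search_body) Q (Suc (Suc (Suc (Suc (Suc (Suc 0)))))) \<sigma>1"
  proof (rule wp_While[where I = I and g = "Suc l" and \<Phi> = "\<lambda>s. 30 * (Suc r - s)"])
    show "I (Suc l) \<sigma>1"
      using bounds by (auto simp: I_def \<sigma>1_def F_def)
  next
    fix s and \<sigma>2 :: state
    assume I: "I s \<sigma>2" and fr: "frame search_body \<sigma>1 \<sigma>2"
    have r2: "ivars \<sigma>2 ''r'' = int r" using lr by (simp add: frameD[OF fr] \<sigma>1_def)
    with I bounds B show "bsafe B \<sigma>2 ?b" by (simp add: I_def)
    assume "bval \<sigma>2 ?b"
    with I r2 have s: "s \<le> r" by (simp add: I_def)
    have D2: "iarrs \<sigma>2 ''D'' = iarrs \<sigma> ''D''" by (simp add: frameD[OF fr] \<sigma>1_def)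
    have Ds: "iarrs \<sigma> ''D'' ! s = (if s \<in> set cps then 1 else 0)"
      using D s bounds by (simp add: marks_def)
    have "Suc r - s = Suc (Suc r - Suc s)" using s by simp
    then show "wp B search_body (\<lambda>t \<sigma>'. \<exists>s'. I s' \<sigma>' \<and> 1 + bcost ?b + t + 30 * (Suc r - s') \<le> 30 * (Suc r - s)) 0 \<sigma>2"
      using I s bounds B D2 Ds lenD
      by (cases "s \<in> set cps")
        (auto simp: search_body_def I_def in_range_def F_Suc intro!: exI[of _ "Suc s"])
  next
    fix s t' and \<sigma>2 :: state
    assume I: "I s \<sigma>2" and fr: "frame search_body \<sigma>1 \<sigma>2" and nb: "\<not> bval \<sigma>2 ?b"
      and t': "t' + 30 * (Suc r - s) \<le> Suc (Suc (Suc (Suc (Suc (Suc 0))))) + 30 * (Suc r - Suc l) + 1 + bcost ?b"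
    have "ivars \<sigma>2 ''r'' = int r" using lr by (simp add: frameD[OF fr] \<sigma>1_def)
    with I nb have "s = Suc r" by (simp add: I_def)
    with I t' show "Q t' \<sigma>2"
      by (simp add: Q_def I_def F_r[symmetric] del: greaterThanAtMost_iff)
  qed
  then have "wp B search Q 0 \<sigma>"
    using B bounds lr by (simp add: search_def \<sigma>1_def)
  then show ?thesis unfolding Q_def .
qed


definition written :: "state \<Rightarrow> nat list \<Rightarrow> bool" where
  "written \<sigma> cps \<longleftrightarrow> marks \<sigma> cps \<and> outputs \<sigma> cps"

lemma wp_declare_cp:
  assumes env: "env \<sigma>" and stored: "stored \<sigma> candidates" and j: "ivars \<sigma> ''j'' = int j" "j < length candidates"
    and cps: "written \<sigma> cps" "length cps < K"
    and b: "ivars \<sigma> ''b'' = (if candidates ! j \<in> remaining cps then 0 else 1)"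
  shows "wp B declare_cp (\<lambda>t \<sigma>'. t \<le> 20 \<and> written \<sigma>'
    (if candidates ! j \<in> remaining cps then cps @ [best_split Min x (candidates ! j)] else cps)) 0 \<sigma>"
proof -
  define s where "s = best_split Min x (candidates ! j)"
  obtain l r where lr: "candidates ! j = (l, r)" by (cases "candidates ! j")
  have "candidates ! j \<in> seeded_intervals a m T"
    using nth_mem[OF j(2)] set_candidates by simp
  then have sT: "s < T"
    using split_in_interval(2)[of "candidates ! j"] seeded_interval_bounds(2)[of l r] lr by (simp add: s_def)
  have jK: "j < K" using j length_candidates by simp
  have S: "iarrs \<sigma> ''S'' ! j = int s"
    using stored j by (simp add: stored_def s_def)
  show ?thesis
  proof (cases "candidates ! j \<in> remaining cps")
    case False
    with b cps B show ?thesis by (simp add: declare_cp_def)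
  next
    case True
    then have "ivars \<sigma> ''b'' = 0" using b by simp
    moreover have "take (Suc (length cps)) ((iarrs \<sigma> ''out'')[length cps := int s]) = map int cps @ [int s]"
      using env cps by (simp add: env_def written_def outputs_def take_Suc_conv_app_nth)
    ultimately show ?thesis
      using True env j jK sT S cps B
      by (auto simp: declare_cp_def env_def in_range_def written_def outputs_def marks_def
          nth_list_update simp flip: s_def)
  qed
qed

text \<open>The price of removing candidate \<open>j\<close> once, declared or not: a search along
  its length and one climb in the tree.\<close>

definition select_cost :: "nat \<Rightarrow> nat" where
  "select_cost j = 30 * (snd (candidates ! j) - fst (candidates ! j)) + 100 * floorlog 2 (2 * K) + 100"

text \<open>Each round removes one live index and declares at most one change point. The bound on
  \<open>length cps + card (live K (iarrs \<sigma> ''W''))\<close> is thus kept, and it ensures that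
  \<open>out\<close> never overflows.\<close>

lemma wp_select_body:
  assumes env: "env \<sigma>" and stored: "stored \<sigma> candidates"
    and tree: "tree_ok (rarrs \<sigma> ''G'') K 0 (iarrs \<sigma> ''W'')"
    and inv: "selection_invariant cps (live K (iarrs \<sigma> ''W''))"
    and cps: "written \<sigma> cps" "length cps + card (live K (iarrs \<sigma> ''W'')) \<le> K"
    and root: "iarrs \<sigma> ''W'' ! 1 \<noteq> 0"
  shows "wp B select_body (\<lambda>t \<sigma>'. \<exists>cps'. \<exists>j\<in>live K (iarrs \<sigma> ''W''). t + 10 \<le> select_cost j \<and>
    live K (iarrs \<sigma>' ''W'') = live K (iarrs \<sigma> ''W'') - {j} \<and>
    tree_ok (rarrs \<sigma>' ''G'') K 0 (iarrs \<sigma>' ''W'') \<and>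
    selection_invariant cps' (live K (iarrs \<sigma>' ''W'')) \<and> written \<sigma>' cps' \<and>
    length cps' + card (live K (iarrs \<sigma>' ''W'')) \<le> K) 0 \<sigma>"
proof -
  define A where "A = live K (iarrs \<sigma> ''W'')"
  define Q where "Q = (\<lambda>t \<sigma>'. \<exists>cps'. \<exists>j\<in>A. t + 10 \<le> select_cost j \<and>
    live K (iarrs \<sigma>' ''W'') = A - {j} \<and> tree_ok (rarrs \<sigma>' ''G'') K 0 (iarrs \<sigma>' ''W'') \<and>
    selection_invariant cps' (live K (iarrs \<sigma>' ''W'')) \<and> written \<sigma>' cps' \<and>
    length cps' + card (live K (iarrs \<sigma>' ''W'')) \<le> K)"
  from root_minimal[OF tree K_pos root] obtain j where W1: "iarrs \<sigma> ''W'' ! 1 = int j + 1"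
    and jA: "j \<in> A" and minG: "\<And>i. i \<in> A \<Longrightarrow> rarrs \<sigma> ''G'' ! j \<le> rarrs \<sigma> ''G'' ! i"
    unfolding A_def by blast
  have A: "A \<subseteq> {..<length candidates}" using inv by (simp add: selection_invariant_def A_def)
  with jA have j: "j < length candidates" by auto
  have jK: "j < K" using j length_candidates by simp
  obtain l r where lr: "candidates ! j = (l, r)" by (cases "candidates ! j")
  have seeded: "candidates ! j \<in> seeded_intervals a m T"
    using nth_mem[OF j] set_candidates by simp
  then have bounds: "l < r" "r \<le> T"
    using seeded_interval_bounds[of l r] lr m by auto
  have min: "key (candidates ! j) \<le> key (candidates ! i)" if "i \<in> A" for i
  proof -
    have "rarrs \<sigma> ''G'' ! i = key (candidates ! i)" "rarrs \<sigma> ''G'' ! j = key (candidates ! j)"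
      using stored that A j by (auto simp: stored_def)
    with minG[OF that] show ?thesis by simp
  qed
  have card: "card A = Suc (card (A - {j}))"
    using jA unfolding A_def by (intro card.remove) auto
  have lenW: "length (iarrs \<sigma> ''W'') = 2 * K" using env by (simp add: env_def)
  define \<sigma>1 where "\<sigma>1 = \<sigma>\<lparr>ivars := (ivars \<sigma>)(''j'' := int j, ''l'' := int l, ''r'' := int r)\<rparr>"
  have env1: "env \<sigma>1" using env by (simp add: env_def \<sigma>1_def)
  have marks1: "marks \<sigma>1 cps" using cps by (simp add: written_def marks_def \<sigma>1_def)
  have lr1: "ivars \<sigma>1 ''l'' = int l" "ivars \<sigma>1 ''r'' = int r" by (simp_all add: \<sigma>1_def)
  define cps' where "cps' = (if candidates ! j \<in> remaining cps
    then cps @ [best_split Min x (candidates ! j)] else cps)"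
  have inv': "selection_invariant cps' (A - {j})"
    using selection_invariant_declare[OF inv[folded A_def] jA _ min]
      selection_invariant_skip[OF inv[folded A_def], of j] by (simp add: cps'_def)
  have len': "length cps' + card (A - {j}) \<le> K"
    using cps(2) card by (simp add: cps'_def A_def)
  have "wp B (search ;; declare_cp ;; set_leaf (IConst 0)) Q (Suc (Suc (Suc (Suc (Suc (Suc (Suc (Suc (Suc (Suc (Suc 0))))))))))) \<sigma>1"
    unfolding wp_Seq
  proof (rule wp_conseq[OF wp_search[OF env1 lr1 bounds marks1]], elim conjE)
    fix t2 :: nat and \<sigma>2 :: state
    assume t2: "t2 \<le> 30 * (r - l) + 20" and fr2: "frame search \<sigma>1 \<sigma>2"
      and b: "ivars \<sigma>2 ''b'' = (if \<exists>s\<in>set cps. s \<in> {l<..r} then 1 else 0)"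
    have env2: "env \<sigma>2" by (rule env_frame[OF env1 fr2]) simp_all
    have stored2: "stored \<sigma>2 candidates"
      by (rule stored_frame[OF _ fr2]) (use stored in \<open>simp_all add: stored_def \<sigma>1_def\<close>)
    have j2: "ivars \<sigma>2 ''j'' = int j" by (simp add: frameD[OF fr2] \<sigma>1_def)
    have written2: "written \<sigma>2 cps"
      using cps by (simp add: written_def marks_def outputs_def frameD[OF fr2] \<sigma>1_def)
    have b2: "ivars \<sigma>2 ''b'' = (if candidates ! j \<in> remaining cps then 0 else 1)"
      using b seeded lr by (auto simp: remaining_def)
    have lenK: "length cps < K" using cps(2) card by (simp add: A_def)
    show "wp B declare_cp (wp B (set_leaf (IConst 0)) Q) ((Suc (Suc (Suc (Suc (Suc (Suc (Suc (Suc (Suc (Suc (Suc 0))))))))))) + t2) \<sigma>2"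
    proof (rule wp_conseq[OF wp_declare_cp[OF env2 stored2 j2 j written2 lenK b2]], fold cps'_def, elim conjE)
      fix t3 :: nat and \<sigma>3 :: state
      assume t3: "t3 \<le> 20" and written3: "written \<sigma>3 cps'" and fr3: "frame declare_cp \<sigma>2 \<sigma>3"
      have same: "rarrs \<sigma>3 ''G'' = rarrs \<sigma> ''G''" "iarrs \<sigma>3 ''W'' = iarrs \<sigma> ''W''"
        "ivars \<sigma>3 ''j'' = int j" "ivars \<sigma>3 ''K'' = int K"
        using env by (simp_all add: frameD[OF fr3] frameD[OF fr2] \<sigma>1_def env_def)
      have "wp B (set_leaf (IConst 0)) (\<lambda>t \<sigma>'. tree_ok (rarrs \<sigma>3 ''G'') K 0 (iarrs \<sigma>' ''W'') \<and>
        live K (iarrs \<sigma>' ''W'') = (if (0 :: int) = 0 then live K (iarrs \<sigma>3 ''W'') - {j}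
          else insert j (live K (iarrs \<sigma>3 ''W''))) \<and>
        t \<le> 100 * floorlog 2 (2 * K) + 30 + icost (IConst 0)) 0 \<sigma>3"
        by (rule wp_set_leaf) (use tree env same jK B in \<open>simp_all add: env_def\<close>)
      then show "wp B (set_leaf (IConst 0)) Q ((Suc (Suc (Suc (Suc (Suc (Suc (Suc (Suc (Suc (Suc (Suc 0))))))))))) + t2 + t3) \<sigma>3"
      proof (rule wp_conseq, elim conjE)
        fix t4 :: nat and \<sigma>4 :: state
        assume t4: "t4 \<le> 100 * floorlog 2 (2 * K) + 30 + icost (IConst 0)"
          and tree4: "tree_ok (rarrs \<sigma>3 ''G'') K 0 (iarrs \<sigma>4 ''W'')"
          and live4: "live K (iarrs \<sigma>4 ''W'') = (if (0 :: int) = 0 then live K (iarrs \<sigma>3 ''W'') - {j}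
            else insert j (live K (iarrs \<sigma>3 ''W'')))"
          and fr4: "frame (set_leaf (IConst 0)) \<sigma>3 \<sigma>4"
        have "written \<sigma>4 cps'"
          using written3 by (simp add: written_def marks_def outputs_def frameD[OF fr4])
        moreover have "live K (iarrs \<sigma>4 ''W'') = A - {j}" using live4 same by (simp add: A_def)
        moreover have "rarrs \<sigma>4 ''G'' = rarrs \<sigma>3 ''G''" by (simp add: frameD[OF fr4])
        moreover have "(Suc (Suc (Suc (Suc (Suc (Suc (Suc (Suc (Suc (Suc (Suc 0))))))))))) + t2 + t3 + t4 + 10 \<le> select_cost j"
          using t2 t3 t4 by (simp add: select_cost_def lr)
        ultimately show "Q ((Suc (Suc (Suc (Suc (Suc (Suc (Suc (Suc (Suc (Suc (Suc 0))))))))))) + t2 + t3 + t4) \<sigma>4"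
          unfolding Q_def using tree4 inv' len' jA by (intro exI[of _ cps'] bexI[of _ j]) auto
      qed
    qed
  qed
  then have "wp B select_body Q 0 \<sigma>"
    using env stored j jK lr lenW K_pos W1 bounds B
    by (simp add: select_body_def env_def stored_def in_range_def \<sigma>1_def)
  then show ?thesis unfolding Q_def A_def .
qed

lemma wp_select_all:
  assumes env: "env \<sigma>" and stored: "stored \<sigma> candidates"
    and tree: "tree_ok (rarrs \<sigma> ''G'') K 0 (iarrs \<sigma> ''W'')"
    and live: "live K (iarrs \<sigma> ''W'') = {..<length candidates}" and D: "marks \<sigma> []"
  shows "wp B select_all (\<lambda>t \<sigma>'. t \<le> (\<Sum>j<length candidates. select_cost j) + 20 \<and>
    (\<exists>cps. outputs \<sigma>' cps \<and> seeded_binary_segmentation Min a m sel \<kappa> T x cps)) 0 \<sigma>"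
proof -
  define Q where "Q = (\<lambda>t (\<sigma>' :: state). t \<le> (\<Sum>j<length candidates. select_cost j) + 20 \<and>
    (\<exists>cps. outputs \<sigma>' cps \<and> seeded_binary_segmentation Min a m sel \<kappa> T x cps))"
  define I where "I = (\<lambda>A \<sigma>'. live K (iarrs \<sigma>' ''W'') = A \<and> A \<subseteq> {..<length candidates} \<and>
    tree_ok (rarrs \<sigma>' ''G'') K 0 (iarrs \<sigma>' ''W'') \<and>
    (\<exists>cps. selection_invariant cps A \<and> written \<sigma>' cps \<and> length cps + card A \<le> K))"
  \<comment> \<open>The ghost set is the live set. Each candidate leaves it exactly once and takes
    its own price along.\<close>
  define \<Phi> where "\<Phi> = (\<lambda>A. \<Sum>j\<in>A. select_cost j)"
  let ?b = "ILess (IConst 0) (IArr ''W'' (IConst 1))"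
  define \<sigma>1 where "\<sigma>1 = \<sigma>\<lparr>ivars := (ivars \<sigma>)(''n'' := 0)\<rparr>"
  have env1: "env \<sigma>1" using env by (simp add: env_def \<sigma>1_def)
  have stored1: "stored \<sigma>1 candidates" using stored by (simp add: stored_def \<sigma>1_def)
  have "wp B (While ?b select_body) Q (Suc (Suc 0)) \<sigma>1"
  proof (rule wp_While[where I = I and g = "{..<length candidates}" and \<Phi> = \<Phi>])
    have "written \<sigma>1 []"
      using D by (simp add: written_def outputs_def marks_def \<sigma>1_def)
    then show "I {..<length candidates} \<sigma>1"
      unfolding I_def using live tree selection_invariant_init length_candidates
      by (intro conjI exI[of _ "[]"]) (simp_all add: \<sigma>1_def)
  next
    fix A and \<sigma>2 :: state
    assume I: "I A \<sigma>2" and fr: "frame select_body \<sigma>1 \<sigma>2"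
    from I have tree2: "tree_ok (rarrs \<sigma>2 ''G'') K 0 (iarrs \<sigma>2 ''W'')" by (simp add: I_def)
    have "0 \<le> iarrs \<sigma>2 ''W'' ! 1" "iarrs \<sigma>2 ''W'' ! 1 \<le> int K" "length (iarrs \<sigma>2 ''W'') = 2 * K"
      using tree2 K_pos by (auto simp: tree_ok_def)
    then show "bsafe B \<sigma>2 ?b" using K_pos B by (simp add: in_range_def)
    assume "bval \<sigma>2 ?b"
    then have root: "iarrs \<sigma>2 ''W'' ! 1 \<noteq> 0" by simp
    have env2: "env \<sigma>2" by (rule env_frame[OF env1 fr]) simp_all
    have stored2: "stored \<sigma>2 candidates" by (rule stored_frame[OF stored1 fr]) simp_all
    from I obtain cps where A: "live K (iarrs \<sigma>2 ''W'') = A"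
      and cps: "selection_invariant cps (live K (iarrs \<sigma>2 ''W''))" "written \<sigma>2 cps"
      "length cps + card (live K (iarrs \<sigma>2 ''W'')) \<le> K"
      by (auto simp: I_def)
    show "wp B select_body (\<lambda>t \<sigma>'. \<exists>A'. I A' \<sigma>' \<and> 1 + bcost ?b + t + \<Phi> A' \<le> \<Phi> A) 0 \<sigma>2"
    proof (rule wp_conseq[OF wp_select_body[OF env2 stored2 tree2 cps root]], unfold A, elim exE bexE conjE)
      fix t3 j cps' and \<sigma>3 :: state
      assume j: "j \<in> A" "t3 + 10 \<le> select_cost j" and 3: "live K (iarrs \<sigma>3 ''W'') = A - {j}"
        "tree_ok (rarrs \<sigma>3 ''G'') K 0 (iarrs \<sigma>3 ''W'')"
        "selection_invariant cps' (live K (iarrs \<sigma>3 ''W''))" "written \<sigma>3 cps'"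
        "length cps' + card (live K (iarrs \<sigma>3 ''W'')) \<le> K"
      have "finite A" using A by auto
      then have "\<Phi> A = select_cost j + \<Phi> (A - {j})"
        unfolding \<Phi>_def using j by (intro sum.remove)
      moreover have "I (A - {j}) \<sigma>3" using 3 I by (auto simp: I_def)
      ultimately show "\<exists>A'. I A' \<sigma>3 \<and> 1 + bcost ?b + (0 + t3) + \<Phi> A' \<le> \<Phi> A"
        using j by (intro exI[of _ "A - {j}"]) simp
    qed
  next
    fix A t' and \<sigma>2 :: state
    assume I: "I A \<sigma>2" and nb: "\<not> bval \<sigma>2 ?b"
      and t': "t' + \<Phi> A \<le> (Suc (Suc 0)) + \<Phi> {..<length candidates} + 1 + bcost ?b"
    from I have tree2: "tree_ok (rarrs \<sigma>2 ''G'') K 0 (iarrs \<sigma>2 ''W'')" by (simp add: I_def)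
    then have "0 \<le> iarrs \<sigma>2 ''W'' ! 1"
      using K_pos by (auto simp: tree_ok_def)
    with nb have "iarrs \<sigma>2 ''W'' ! 1 = 0" by simp
    from root_empty[OF tree2 K_pos this] I have "A = {}" by (simp add: I_def)
    with I t' show "Q t' \<sigma>2"
      by (auto simp: Q_def I_def \<Phi>_def written_def intro: selection_invariant_empty)
  qed
  then have "wp B select_all Q 0 \<sigma>"
    using B by (simp add: select_all_def \<sigma>1_def)
  then show ?thesis unfolding Q_def .
qed

end

section \<open>The complete program\<close>

text \<open>The ceiling cannot be computed without rounding at constant cost, but for fixed
  \<open>a\<close> it is a constant of the program.\<close>

definition allocate :: "real \<Rightarrow> com" where
  "allocate a =
     ISet ''K'' (IMul (IConst \<lceil>3 / (1 - a)\<rceil>) (IVar ''T'')) ;;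
     RNew ''Q'' (IAdd (IVar ''T'') (IConst 1)) ;;
     INew ''D'' (IAdd (IVar ''T'') (IConst 1)) ;;
     INew ''L'' (IVar ''K'') ;; INew ''R'' (IVar ''K'') ;; INew ''S'' (IVar ''K'') ;;
     RNew ''G'' (IVar ''K'') ;; INew ''out'' (IVar ''K'') ;;
     INew ''W'' (IMul (IConst 2) (IVar ''K''))"

definition partial_sums_body :: com where
  "partial_sums_body =
     RStore ''Q'' (IAdd (IVar ''i'') (IConst 1)) (RAdd (RArr ''Q'' (IVar ''i'')) (RArr ''X'' (IVar ''i''))) ;;
     ISet ''i'' (IAdd (IVar ''i'') (IConst 1))"

definition partial_sums :: com where
  "partial_sums =
     ISet ''i'' (IConst 0) ;; While (ILess (IVar ''i'') (IVar ''T'')) partial_sums_body"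

definition segment :: "selection \<Rightarrow> com" where
  "segment sel = partial_sums ;; generate sel ;; insert_all ;; select_all"

lemma mods_partial_sums_body [simp]:
  "imods partial_sums_body = {''i''}" "rmods partial_sums_body = {}"
  "iamods partial_sums_body = {}" "ramods partial_sums_body = {''Q''}" "noalloc partial_sums_body"
  by (auto simp: partial_sums_body_def)

lemma mods_partial_sums [simp]:
  "imods partial_sums = {''i''}" "rmods partial_sums = {}"
  "iamods partial_sums = {}" "ramods partial_sums = {''Q''}" "noalloc partial_sums"
  by (auto simp: partial_sums_def)

lemma noalloc_segment: "noalloc (segment sel)"
  by (simp add: segment_def)

section \<open>Allocation, partial sums and the composition of the phases\<close>

context segmentation
begin

definition allocated :: "state \<Rightarrow> bool" where
  "allocated \<sigma> \<longleftrightarrow> ivars \<sigma> ''T'' = int T \<and> ivars \<sigma> ''m'' = int m \<and> ivars \<sigma> ''K'' = int K \<and>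
     rvars \<sigma> ''a'' = a \<and> rvars \<sigma> ''kappa'' = \<kappa> \<and>
     rarrs \<sigma> ''X'' = map x [1..<Suc T] \<and> rarrs \<sigma> ''Q'' = replicate (Suc T) 0 \<and>
     length (iarrs \<sigma> ''L'') = K \<and> length (iarrs \<sigma> ''R'') = K \<and> length (iarrs \<sigma> ''S'') = K \<and>
     length (rarrs \<sigma> ''G'') = K \<and> iarrs \<sigma> ''W'' = replicate (2 * K) 0 \<and>
     iarrs \<sigma> ''D'' = replicate (Suc T) 0 \<and> length (iarrs \<sigma> ''out'') = K"

lemma wp_allocate:
  "wp B (allocate a) (\<lambda>t \<sigma>'. t \<le> 2 * T + 7 * K + 60 \<and> allocated \<sigma>') 0 (input_state a m \<kappa> T x)"
proof -
  define C where "C = nat \<lceil>3 / (1 - a)\<rceil>"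
  have "0 < 3 / (1 - a)" using a_less by simp
  then have C: "\<lceil>3 / (1 - a)\<rceil> = int C" unfolding C_def by linarith
  have K: "K = C * T" using K by (simp add: C_def)
  \<comment> \<open>The constant in the program text must obey the integer bound too;
    \<open>T \<ge> 1\<close> puts it below \<open>K\<close>.\<close>
  then have "C \<le> K" using T_pos by (cases T) auto
  moreover have "int C * int T = int K" by (simp add: K)
  moreover have "nat (int T + 1) = Suc T" "nat (2 * int K) = 2 * K" by auto
  ultimately show ?thesis
    unfolding allocate_def C using B
    by (simp add: input_state_def allocated_def del: upt_Suc of_nat_mult)
qed

lemma wp_partial_sums:
  assumes "allocated \<sigma>"
  shows "wp B partial_sums (\<lambda>t \<sigma>'. t \<le> 30 * T + 20 \<and> env \<sigma>') 0 \<sigma>"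
proof -
  define I where "I = (\<lambda>i (\<sigma>' :: state). ivars \<sigma>' ''i'' = int i \<and> i \<le> T \<and>
    (\<forall>k\<le>i. rarrs \<sigma>' ''Q'' ! k = sum x {1..k}))"
  define Q where "Q = (\<lambda>t \<sigma>'. t \<le> 30 * T + 20 \<and> env \<sigma>')"
  let ?b = "ILess (IVar ''i'') (IVar ''T'')"
  define \<sigma>1 where "\<sigma>1 = \<sigma>\<lparr>ivars := (ivars \<sigma>)(''i'' := 0)\<rparr>"
  have "wp B (While ?b partial_sums_body) Q (Suc (Suc 0)) \<sigma>1"
  proof (rule wp_While[where I = I and g = 0 and \<Phi> = "\<lambda>i. 30 * (T - i)"])
    \<comment> \<open>Fresh arrays hold zeros, which is the empty partial sum at index 0.\<close>
    show "I 0 \<sigma>1" using assms by (simp add: I_def \<sigma>1_def allocated_def)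
  next
    fix i and \<sigma>2 :: state
    assume I: "I i \<sigma>2" and fr: "frame partial_sums_body \<sigma>1 \<sigma>2"
    have 2: "ivars \<sigma>2 ''T'' = int T" "length (rarrs \<sigma>2 ''Q'') = Suc T" "rarrs \<sigma>2 ''X'' = map x [1..<Suc T]"
      using assms by (simp_all add: frameD[OF fr] \<sigma>1_def allocated_def)
    with I B show "bsafe B \<sigma>2 ?b" by (simp add: I_def)
    assume "bval \<sigma>2 ?b"
    with I 2 have i: "i < T" by (simp add: I_def)
    have X: "map x [1..<Suc T] ! i = x (Suc i)" using i by (simp del: upt_Suc)
    have "nat (int i + 1) = Suc i" by simp
    moreover have "T - i = Suc (T - Suc i)" using i by simp
    ultimately show "wp B partial_sums_body
        (\<lambda>t \<sigma>'. \<exists>i'. I i' \<sigma>' \<and> 1 + bcost ?b + t + 30 * (T - i') \<le> 30 * (T - i)) 0 \<sigma>2"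
      using I 2 i B X
      by (auto simp: partial_sums_body_def in_range_def I_def nth_list_update le_Suc_eq
          simp del: upt_Suc intro!: exI[of _ "Suc i"])
  next
    fix i t' and \<sigma>2 :: state
    assume I: "I i \<sigma>2" and fr: "frame partial_sums_body \<sigma>1 \<sigma>2" and nb: "\<not> bval \<sigma>2 ?b"
      and t': "t' + 30 * (T - i) \<le> Suc (Suc 0) + 30 * (T - 0) + 1 + bcost ?b"
    have "ivars \<sigma>2 ''T'' = int T" using assms by (simp add: frameD[OF fr] \<sigma>1_def allocated_def)
    with I nb have "i = T" by (simp add: I_def)
    moreover have "length (rarrs \<sigma>2 ''Q'') = Suc T"
      using assms by (simp add: frameD[OF fr] \<sigma>1_def allocated_def)
    ultimately have "rarrs \<sigma>2 ''Q'' = map (\<lambda>i. sum x {1..i}) [0..<Suc T]"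
      using I by (intro nth_equalityI) (auto simp: I_def simp del: upt_Suc)
    moreover have "t' \<le> 30 * T + 20" using t' by simp
    ultimately show "Q t' \<sigma>2"
      using assms by (simp add: Q_def env_def frameD[OF fr] \<sigma>1_def allocated_def del: upt_Suc)
  qed
  then have "wp B partial_sums Q 0 \<sigma>"
    using B by (simp add: partial_sums_def \<sigma>1_def)
  then show ?thesis unfolding Q_def .
qed

lemma wp_segment:
  assumes "allocated \<sigma>"
  shows "wp B (segment sel) (\<lambda>t \<sigma>'. t \<le> 30 * T + generate_cost +
      (100 * floorlog 2 (2 * K) + 60) * length candidates +
      (\<Sum>j<length candidates. select_cost j) + 60 \<and>
    (\<exists>cps. outputs \<sigma>' cps \<and> seeded_binary_segmentation Min a m sel \<kappa> T x cps)) 0 \<sigma>"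
  unfolding segment_def wp_Seq
proof (rule wp_conseq[OF wp_partial_sums[OF assms]], elim conjE)
  fix t1 and \<sigma>1 :: state
  assume t1: "t1 \<le> 30 * T + 20" and env1: "env \<sigma>1" and fr1: "frame partial_sums \<sigma> \<sigma>1"
  let ?Q = "\<lambda>t \<sigma>'. t \<le> 30 * T + generate_cost +
      (100 * floorlog 2 (2 * K) + 60) * length candidates +
      (\<Sum>j<length candidates. select_cost j) + 60 \<and>
    (\<exists>cps. outputs \<sigma>' cps \<and> seeded_binary_segmentation Min a m sel \<kappa> T x cps)"
  show "wp B (generate sel) (wp B insert_all (wp B select_all ?Q)) (0 + t1) \<sigma>1"
  proof (rule wp_conseq[OF wp_generate[OF env1]], fold candidates_def, elim conjE)
    fix t2 and \<sigma>2 :: state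
    assume t2: "t2 \<le> generate_cost" and stored2: "stored \<sigma>2 candidates"
      and j2: "ivars \<sigma>2 ''j'' = int (length candidates)" and fr2: "frame (generate sel) \<sigma>1 \<sigma>2"
    have env2: "env \<sigma>2" by (rule env_frame[OF env1 fr2]) simp_all
    have W2: "iarrs \<sigma>2 ''W'' = replicate (2 * K) 0"
      using assms by (simp add: frameD[OF fr1] frameD[OF fr2] allocated_def)
    show "wp B insert_all (wp B select_all ?Q) (0 + t1 + t2) \<sigma>2"
    proof (rule wp_conseq[OF wp_insert_all[OF env2 W2 j2 length_candidates]], elim conjE)
      fix t3 and \<sigma>3 :: state
      assume t3: "t3 \<le> (100 * floorlog 2 (2 * K) + 60) * length candidates + 20"
        and 3: "tree_ok (rarrs \<sigma>2 ''G'') K 0 (iarrs \<sigma>3 ''W'')"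
        "live K (iarrs \<sigma>3 ''W'') = {..<length candidates}"
        and fr3: "frame insert_all \<sigma>2 \<sigma>3"
      have env3: "env \<sigma>3" by (rule env_frame[OF env2 fr3]) simp_all
      have stored3: "stored \<sigma>3 candidates" by (rule stored_frame[OF stored2 fr3]) simp_all
      have tree3: "tree_ok (rarrs \<sigma>3 ''G'') K 0 (iarrs \<sigma>3 ''W'')"
        using 3 by (simp add: frameD[OF fr3])
      have D3: "marks \<sigma>3 []"
        using assms by (simp add: marks_def frameD[OF fr1] frameD[OF fr2] frameD[OF fr3] allocated_def
            del: replicate_Suc)
      show "wp B select_all ?Q (0 + t1 + t2 + t3) \<sigma>3"
        by (rule wp_conseq[OF wp_select_all[OF env3 stored3 tree3 3(2) D3]]) (use t1 t2 t3 in auto)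
    qed
  qed
qed

end

definition capacity :: "real \<Rightarrow> nat \<Rightarrow> nat" where
  "capacity a T = nat \<lceil>3 / (1 - a)\<rceil> * T"

text \<open>1000 is a round number above all coefficients that are collected in
  \<open>total_time_le\<close>.\<close>

definition time_bound :: "real \<Rightarrow> nat \<Rightarrow> nat" where
  "time_bound a T = 1000 * (T * layers a T + capacity a T * floorlog 2 (2 * capacity a T)
     + T + capacity a T + layers a T + 1)"

section \<open>Total time and memory\<close>

context segmentation
begin

lemma sum_layer_cost: "(\<Sum>k=1..n. layer_cost k + 120) =
    20 * T * n + 120 * total_length (interval_list a T n) + 200 * length (interval_list a T n) + 120 * n"
  by (induction n) (simp_all add: layer_cost_def interval_list_Suc total_length_def)

lemma sum_select_cost: "(\<Sum>j<length candidates. select_cost j) =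
    30 * total_length candidates + (100 * floorlog 2 (2 * K) + 100) * length candidates"
proof -
  have "(\<Sum>j<length candidates. snd (candidates ! j) - fst (candidates ! j)) = total_length candidates"
    by (simp add: total_length_def sum_list_sum_nth atLeast0LessThan case_prod_unfold)
  then show ?thesis
    unfolding select_cost_def sum.distrib sum_distrib_left[symmetric]
    by (simp add: add_mult_distrib)
qed

lemma total_time_le:
  "(2 * T + 7 * K + 60) + (30 * T + generate_cost + (100 * floorlog 2 (2 * K) + 60) * length candidates +
      (\<Sum>j<length candidates. select_cost j) + 60) \<le> time_bound a T"
proof -
  define L F where "L = layers a T" and "F = floorlog 2 (2 * K)"
  define Is where "Is = interval_list a T L"
  have K': "capacity a T = K" using K by (simp add: capacity_def)
  have len: "length Is \<le> K" unfolding Is_def L_def by (rule length_interval_list_K)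
  have "total_length Is \<le> 3 * T * L + 2 * length Is"
    unfolding Is_def by (rule total_length_interval_list)
  with len have tl: "total_length Is \<le> 3 * (T * L) + 2 * K" by simp
  have tc: "total_length candidates \<le> total_length Is"
    unfolding candidates_def Is_def L_def by (rule total_length_filter_le)
  have gen: "generate_cost = 20 * (T * L) + 120 * total_length Is + 200 * length Is + 120 * L + 20"
    unfolding generate_cost_def sum_layer_cost L_def[symmetric] Is_def[symmetric] by simp
  \<comment> \<open>Used with 60 for filling the tree and with 100 for emptying it.\<close>
  have FK: "(100 * F + c) * length candidates \<le> 100 * (K * F) + c * K" for c
  proof -
    have "(100 * F + c) * length candidates \<le> (100 * F + c) * K"
      using length_candidates by (intro mult_le_mono2)
    then show ?thesis by (simp add: algebra_simps)
  qed
  show ?thesis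
    unfolding time_bound_def K' sum_select_cost gen L_def[symmetric] F_def[symmetric]
    using tl tc len FK[of 60] FK[of 100] by (simp add: algebra_simps)
qed

lemma cells_input_state: "cells (input_state a m \<kappa> T x) = T" "finite_arrays (input_state a m \<kappa> T x)"
proof -
  have "{A. ((\<lambda>_. [])(''X'' := map x [1..<Suc T])) A \<noteq> []} = {''X''}"
    using T_pos by (auto simp del: upt_Suc)
  then show "cells (input_state a m \<kappa> T x) = T" "finite_arrays (input_state a m \<kappa> T x)"
    by (simp_all add: cells_def finite_arrays_def input_state_def del: upt_Suc)
qed

text \<open>Memory: the input occupies \<open>T\<close> cells, and the allocation phase adds at most
  its own running time. The rest allocates nothing and stays at the number of cells reached
  then.\<close>

lemma exec_program:
  "\<exists>t p \<sigma> cps. exec B (allocate a ;; segment sel) (input_state a m \<kappa> T x) t p \<sigma> \<and>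
     t \<le> time_bound a T \<and> p \<le> 3 * T + 7 * capacity a T + 60 \<and> outputs \<sigma> cps \<and>
     seeded_binary_segmentation Min a m sel \<kappa> T x cps"
proof -
  from wp_allocate obtain t p \<sigma> where 1: "exec B (allocate a) (input_state a m \<kappa> T x) t p \<sigma>"
    "t \<le> 2 * T + 7 * K + 60" "allocated \<sigma>"
    unfolding wp_def by auto
  from wp_segment[OF 1(3)] obtain t' p' \<sigma>' cps where 2: "exec B (segment sel) \<sigma> t' p' \<sigma>'"
    "t' \<le> 30 * T + generate_cost + (100 * floorlog 2 (2 * K) + 60) * length candidates +
      (\<Sum>j<length candidates. select_cost j) + 60"
    "outputs \<sigma>' cps" "seeded_binary_segmentation Min a m sel \<kappa> T x cps"
    unfolding wp_def by auto
  have "p' = cells \<sigma>"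
    by (rule exec_noalloc_memory[OF 2(1) noalloc_segment])
  moreover from exec_memory_le_time[OF 1(1)] 1(2) have "p \<le> 3 * T + 7 * K + 60" "cells \<sigma> \<le> 3 * T + 7 * K + 60"
    by (simp_all add: cells_input_state)
  ultimately have "max p p' \<le> 3 * T + 7 * capacity a T + 60"
    using K by (simp add: capacity_def)
  moreover have "t + t' \<le> time_bound a T"
    using total_time_le 1(2) 2(2) by linarith
  ultimately show ?thesis
    using exec.Seq[OF 1(1) 2(1)] 2(3,4) by blast
qed

end

text \<open>\<open>layers\<close> and \<open>floorlog\<close> are replaced by logarithms plus 1,
  which gives a closed form \<open>f\<close> in \<open>ln T\<close>. Its dominant terms are
  \<open>T * ln T / b\<close> and \<open>C * T * ln T / ln 2\<close>, where
  \<open>b = ln (1 / a)\<close> is positive because \<open>a < 1\<close>.\<close>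

lemma time_bound_bigo:
  assumes "0 < a" "a < 1"
  shows "(\<lambda>T. real (time_bound a T)) \<in> O(\<lambda>T. real T * ln (real T))"
proof -
  define C where "C = real (nat \<lceil>3 / (1 - a)\<rceil>)"
  define b where "b = ln (1 / a)"
  have b: "0 < b" using assms by (simp add: b_def)
  have "0 < 3 / (1 - a)" using assms by simp
  then have C: "0 < C" unfolding C_def by simp
  define f where "f = (\<lambda>T. 1000 * (T * (ln T / b + 1) + C * T * ((ln (2 * C) + ln T) / ln 2 + 1)
      + T + C * T + (ln T / b + 1) + 1))"
  have "real (time_bound a T) \<le> f (real T)" if T: "1 \<le> T" for T
  proof -
    interpret seeded a T using assms T by unfold_locales auto
    have K: "real (capacity a T) = C * T" by (simp add: capacity_def C_def)
    have L: "real (layers a T) \<le> ln T / b + 1"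
      using layers_le by (simp add: log_def b_def)
    have "0 < real (capacity a T)" unfolding K using C T by simp
    then have "0 < 2 * capacity a T" by simp
    then have "real (floorlog 2 (2 * capacity a T)) \<le> log 2 (real (2 * capacity a T)) + 1"
      unfolding floorlog_def by (simp del: of_nat_mult)
    also have "log 2 (real (2 * capacity a T)) = (ln (2 * C) + ln T) / ln 2"
      using C T by (simp add: K log_def ln_mult)
    finally have F: "real (floorlog 2 (2 * capacity a T)) \<le> (ln (2 * C) + ln T) / ln 2 + 1" .
    have "real (time_bound a T) = 1000 * (T * real (layers a T)
        + C * T * real (floorlog 2 (2 * capacity a T)) + T + C * T + real (layers a T) + 1)"
      by (simp add: time_bound_def K)
    also have "\<dots> \<le> f T"
      unfolding f_def using L F C by (intro mult_left_mono add_mono order.refl) auto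
    finally show ?thesis .
  qed
  then have "(\<lambda>T. real (time_bound a T)) \<in> O(\<lambda>T. f (real T))"
    by (intro landau_o.big_mono eventually_mono[OF eventually_ge_at_top[of 1]]) force
  also have "(\<lambda>T. f (real T)) \<in> O(\<lambda>T. real T * ln (real T))"
    unfolding f_def using b C by real_asymp
  finally show ?thesis .
qed

theorem theorem1:
  fixes a :: real and m :: nat and sel :: selection
  assumes "1 / 2 \<le> a" and "a < 1" and "2 \<le> m"
  shows "\<exists>(prog :: com) (\<rho> :: nat set \<Rightarrow> nat) (time :: nat \<Rightarrow> nat) (memory :: nat \<Rightarrow> nat)
            (B :: nat \<Rightarrow> nat) (d :: nat).
    tie_rule \<rho> \<and>
    (\<lambda>T. real (time T)) \<in> O(\<lambda>T. real T * ln (real T)) \<and>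
    (\<lambda>T. real (memory T)) \<in> O(\<lambda>T. real T) \<and>
    (\<lambda>T. real (B T)) \<in> O(\<lambda>T. real T ^ d) \<and>
    (\<forall>T N \<tau> f (M :: 'w measure) \<epsilon> \<omega> \<kappa>.
       1 \<le> T \<longrightarrow> gaussian_change_point_model M T N \<tau> f \<epsilon> \<longrightarrow> \<omega> \<in> space M \<longrightarrow>
       (\<exists>t p \<sigma> cps.
          exec (B T) prog (input_state a m \<kappa> T (\<lambda>i. f i + \<epsilon> i \<omega>)) t p \<sigma> \<and>
          t \<le> time T \<and> p \<le> memory T \<and>
          outputs \<sigma> cps \<and>
          seeded_binary_segmentation \<rho> a m sel \<kappa> T (\<lambda>i. f i + \<epsilon> i \<omega>) cps))"
\<comment> \<open>The integer bound is linear in \<open>T\<close>, hence degree 1.\<close>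
proof (rule exI[of _ "allocate a ;; segment sel"], rule exI[of _ Min], rule exI[of _ "time_bound a"],
    rule exI[of _ "\<lambda>T. 3 * T + 7 * capacity a T + 60"],
    rule exI[of _ "\<lambda>T. 4 * capacity a T + 4 * T + m + 4"], rule exI[of _ 1], intro conjI allI impI)
  let ?B = "\<lambda>T. 4 * capacity a T + 4 * T + m + 4"
  define C where "C = real (nat \<lceil>3 / (1 - a)\<rceil>)"
  have K: "real (capacity a T) = C * real T" for T by (simp add: capacity_def C_def)
  show "tie_rule Min" by (rule tie_rule_Min)
  show "(\<lambda>T. real (time_bound a T)) \<in> O(\<lambda>T. real T * ln (real T))"
    using assms by (intro time_bound_bigo) auto
  show "(\<lambda>T. real (3 * T + 7 * capacity a T + 60)) \<in> O(\<lambda>T. real T)"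
  proof -
    have "(\<lambda>T. real (3 * T + 7 * capacity a T + 60)) = (\<lambda>T. 3 * real T + 7 * (C * real T) + 60)"
      by (simp add: K)
    also have "\<dots> \<in> O(\<lambda>T. real T)" by real_asymp
    finally show ?thesis .
  qed
  show "(\<lambda>T. real (?B T)) \<in> O(\<lambda>T. real T ^ 1)"
  proof -
    have "(\<lambda>T. real (?B T)) = (\<lambda>T. 4 * (C * real T) + 4 * real T + real m + 4)"
      by (simp add: K)
    also have "\<dots> \<in> O(\<lambda>T. real T ^ 1)" by real_asymp
    finally show ?thesis .
  qed
  fix T N :: nat and \<tau> :: "nat \<Rightarrow> nat" and f :: "nat \<Rightarrow> real" and M :: "'w measure"
    and \<epsilon> :: "nat \<Rightarrow> 'w \<Rightarrow> real" and \<omega> :: 'w and \<kappa> :: real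
  assume "1 \<le> T"
  \<comment> \<open>The data and the threshold enter only here, after the program and all bounds
    have been chosen from \<open>a\<close>, \<open>m\<close> and \<open>sel\<close>.\<close>
  then interpret segmentation a T m "capacity a T" "?B T" sel \<kappa> "\<lambda>i. f i + \<epsilon> i \<omega>"
    using assms by unfold_locales (auto simp: capacity_def)
  show "\<exists>t p \<sigma> cps. exec (?B T) (allocate a ;; segment sel) (input_state a m \<kappa> T (\<lambda>i. f i + \<epsilon> i \<omega>)) t p \<sigma> \<and>
      t \<le> time_bound a T \<and> p \<le> 3 * T + 7 * capacity a T + 60 \<and> outputs \<sigma> cps \<and>
      seeded_binary_segmentation Min a m sel \<kappa> T (\<lambda>i. f i + \<epsilon> i \<omega>) cps"
    by (rule exec_program)
qed

end
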